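(* Let $n,x,y,p$ be nonnegative integers with $2\leq p\leq n$, $1\leq y\leq 2n$ and $$0\leq x<\min\Big\{2n-y+1,\ \frac{(p-1)y}{n+1+y}\Big\}.$$ Let $k$ be an integer or $k=+\infty$ with $$\frac{2n(n+1+y)(3n+p-x)}{(p-1)y-x(n+1+y)}\leq k\leq +\infty .$$ Let $f,g$ be two linearly nondegenerate meromorphic mappings of $\mathbb{C}^m$ into $\mathbb{C}P^n$ and let $H_1,\dots,H_q$ be $q:=3n+1-x$ hyperplanes in $\mathbb{C}P^n$ in general position. For $j=1,\dots,q$ set $$E_f^j:=\{z\in\mathbb{C}^m:\ 0\leq v_{(f,H_j)}(z)\leq k\},\qquad {}^{*}E_f^j:=\{z\in\mathbb{C}^m:\ 0< v_{(f,H_j)}(z)\leq k\},$$ and similarly $E_g^j$, ${}^{*}E_g^j$ with $g$ in place of $f$. Assume: (a) $\min\{v_{(f,H_j)},1\}=\min\{v_{(g,H_j)},1\}$ on $E_f^j\cap E_g^j$ for all $j\in\{n+2+y,\dots,q\}$, and $\min\{v_{(f,H_j)},p\}=\min\{v_{(g,H_j)},p\}$ on $E_f^j\cap E_g^j$ for all $j\in\{1,\dots,n+1+y\}$; (b) $\dim({}^{*}E_f^i\cap{}^{*}E_f^j)\leq m-2$ and $\dim({}^{*}E_g^i\cap{}^{*}E_g^j)\leq m-2$ for all $1\leq i<j\leq q$; (c) $f=g$ on $\bigcup_{j=1}^{q}({}^{*}E_f^j\cap{}^{*}E_g^j)$. Then $f=g$.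
   Context: A meromorphic mapping $f:\mathbb{C}^m\to\mathbb{C}P^n$ has a reduced representation $f=(f_0:\dots:f_n)$: the $f_i$ are holomorphic on $\mathbb{C}^m$ and $f(z)=(f_0(z):\dots:f_n(z))$ outside the analytic set $\{f_0=\dots=f_n=0\}$, which has codimension $\geq 2$. $f$ is linearly nondegenerate if its image is not contained in any hyperplane, i.e. $f_0,\dots,f_n$ are linearly independent over $\mathbb{C}$. For a hyperplane $H=\{a_0w_0+\dots+a_nw_n=0\}$ with image of $f$ not contained in $H$, set $(f,H)=a_0f_0+\dots+a_nf_n$, and $v_{(f,H)}(z)\in\mathbb{N}_0$ is the vanishing order of the holomorphic function $(f,H)$ at $z$ (the intersection multiplicity of $f$ with $H$ at $f(z)$); $f^{-1}(H)$ denotes $\{z: v_{(f,H)}(z)>0\}$. Hyperplanes $H_1,\dots,H_q$ ($q\geq n+1$) are in general position if any $n+1$ of them have linearly independent coefficient vectors. Dimensions refer to analytic sets (the empty set having dimension $\le m-2$). *)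

theory Defs
  imports "HOL-Analysis.Analysis" "HOL-Library.Extended_Nat"
begin

text \<open>Complex-linearity of a (real-linear) map from C^m to C.\<close>
definition cplx_linear :: "(complex^'m \<Rightarrow> complex) \<Rightarrow> bool" where
  "cplx_linear D \<longleftrightarrow> (\<forall>(c::complex) v. D (c *s v) = c * D v)"

definition holo_on :: "(complex^'m \<Rightarrow> complex) \<Rightarrow> (complex^'m) set \<Rightarrow> bool" where
  "holo_on F U \<longleftrightarrow> (\<forall>z\<in>U. \<exists>D. (F has_derivative D) (at z) \<and> cplx_linear D)"

text \<open>Vanishing order of a holomorphic function at z: the largest k such that
  F(z+w) = O(|w|^k) as w \<rightarrow> 0 (i.e. the degree of the lowest nonzero homogeneous
  term of the Taylor expansion).\<close>
definition vorder :: "(complex^'m \<Rightarrow> complex) \<Rightarrow> complex^'m \<Rightarrow> nat" where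
  "vorder F z = (GREATEST k. \<exists>C>0. \<exists>r>0. \<forall>w. norm w < r \<longrightarrow>
                     norm (F (z + w)) \<le> C * norm w ^ k)"

text \<open>A subset A of C^m has (complex) dimension \<le> m-2 iff it contains no piece of
  a smooth complex hypersurface, i.e. there is no open U, point a \<in> U and holomorphic
  h on U with h a = 0, dh(a) \<noteq> 0 and {w \<in> U. h w = 0} \<subseteq> A.\<close>
definition dim_le_m2 :: "(complex^'m) set \<Rightarrow> bool" where
  "dim_le_m2 A \<longleftrightarrow> \<not> (\<exists>U a h D. open U \<and> a \<in> U \<and> holo_on h U \<and> h a = 0 \<and>
        (h has_derivative D) (at a) \<and> D \<noteq> (\<lambda>v. 0) \<and> {w\<in>U. h w = 0} \<subseteq> A)"

text \<open>Reduced representation (f_0 : ... : f_n) of a meromorphic map C^m \<rightarrow> CP^n.\<close>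
definition reduced_rep :: "nat \<Rightarrow> (nat \<Rightarrow> complex^'m \<Rightarrow> complex) \<Rightarrow> bool" where
  "reduced_rep n f \<longleftrightarrow> (\<forall>i\<le>n. holo_on (f i) UNIV) \<and> dim_le_m2 {z. \<forall>i\<le>n. f i z = 0}"

definition lin_nondegenerate :: "nat \<Rightarrow> (nat \<Rightarrow> complex^'m \<Rightarrow> complex) \<Rightarrow> bool" where
  "lin_nondegenerate n f \<longleftrightarrow>
     (\<forall>c::nat \<Rightarrow> complex. (\<forall>z. (\<Sum>i\<le>n. c i * f i z) = 0) \<longrightarrow> (\<forall>i\<le>n. c i = 0))"

definition fH :: "nat \<Rightarrow> (nat \<Rightarrow> complex^'m \<Rightarrow> complex) \<Rightarrow> (nat \<Rightarrow> complex) \<Rightarrow> complex^'m \<Rightarrow> complex" where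
  "fH n f a z = (\<Sum>i\<le>n. a i * f i z)"

definition general_position :: "nat \<Rightarrow> nat \<Rightarrow> (nat \<Rightarrow> nat \<Rightarrow> complex) \<Rightarrow> bool" where
  "general_position n q a \<longleftrightarrow>
     (\<forall>J. J \<subseteq> {1..q} \<and> card J = n + 1 \<longrightarrow>
        (\<forall>c::nat \<Rightarrow> complex. (\<forall>i\<le>n. (\<Sum>j\<in>J. c j * a j i) = 0) \<longrightarrow> (\<forall>j\<in>J. c j = 0)))"

text \<open>f = g (as maps to CP^n) at the points of S (outside indeterminacy loci).\<close>
definition eq_on :: "nat \<Rightarrow> (nat \<Rightarrow> complex^'m \<Rightarrow> complex) \<Rightarrow> (nat \<Rightarrow> complex^'m \<Rightarrow> complex)
                      \<Rightarrow> (complex^'m) set \<Rightarrow> bool" where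
  "eq_on n f g S \<longleftrightarrow> (\<forall>z\<in>S. \<forall>i\<le>n. \<forall>j\<le>n. f i z * g j z = f j z * g i z)"

definition Eset :: "nat \<Rightarrow> enat \<Rightarrow> (nat \<Rightarrow> complex^'m \<Rightarrow> complex) \<Rightarrow> (nat \<Rightarrow> complex) \<Rightarrow> (complex^'m) set" where
  "Eset n k f a = {z. enat (vorder (fH n f a) z) \<le> k}"

definition Estar :: "nat \<Rightarrow> enat \<Rightarrow> (nat \<Rightarrow> complex^'m \<Rightarrow> complex) \<Rightarrow> (nat \<Rightarrow> complex) \<Rightarrow> (complex^'m) set" where
  "Estar n k f a = {z. 0 < vorder (fH n f a) z \<and> enat (vorder (fH n f a) z) \<le> k}"

end

(* If f and g differ, restrict them to the curve t |-> Psi (c + exp t * e), where Psi is a shear automorphism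
   through prescribed points and c is generic. Along such a curve nondegeneracy is preserved, vanishing
   orders can only increase, and by Baire's theorem the sets of codimension two are avoided. This reduces the
   statement to two entire curves, for which sharing with truncation level 1 is enough. Let F_j, G_j be
   the compositions with the hyperplanes. Proportionality of (F_i, G_i) and (F_j, G_j) is an equivalence
   relation on the indices with classes of at most n elements, so there is a permutation s with
   P_j = F_j G_(s j) - G_j F_(s j) nonzero for all j. At a common zero of low order of F_j and G_j all the P_i
   vanish, and P_j, P_(s^-1 j) vanish at least to order min (ord F_j, ord G_j); summing the orders of the P_j
   against Cartan's second main theorem for f and g gives T(r) = O(log d), where d bounds the logarithmic
   derivatives. Iterating this along a sequence of radii in [r, r + 1] yields T = O(log r), whereas the
   periodicity coming from exp forces T to grow linearly. *)
theory Submission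
  imports Defs "HOL-Complex_Analysis.Complex_Analysis" "Jordan_Normal_Form.Determinant"
begin

section \<open>Orders and zeros of entire functions\<close>

text \<open>Restricting to straight lines would not do: components that are independent on C^m, such
  as those of an affine map, span at most two dimensions on a line. The shear bends the line into a
  curve through test points at which evaluation determinants are nonzero; these stay nonzero for
  small translations \<open>c\<close>, and a meagre exceptional set leaves such a \<open>c\<close>.
  That orders only grow under restriction is the useful direction: a point where the curve has order
  at most \<open>k\<close> lies over a point of order at most \<open>k\<close>, so the hypotheses
  apply there. A restricted curve may be polynomial, and T(r) = O(log r) would then be no
  contradiction; this is why exp is inserted before the estimates. The main obstacle is the error
  term of the second main theorem. It is kept free of exceptional radii by bounding logarithmic
  derivatives pointwise on circles that stay away from zeros, at the price of zero counts and of T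
  at a larger radius inside the logarithm. Both are again bounded by T, so a recursion along the
  radii closes.\<close>

lemma entire_isCont: "F holomorphic_on UNIV \<Longrightarrow> isCont F a"
  using holomorphic_on_imp_continuous_on continuous_on_eq_continuous_at[OF open_UNIV] by blast

text \<open>Unspecified when F vanishes identically.\<close>

definition ord :: "(complex \<Rightarrow> complex) \<Rightarrow> complex \<Rightarrow> nat" where
  "ord F a = (LEAST l. (deriv ^^ l) F a \<noteq> 0)"

lemma entire_nonzero_deriv:
  assumes "F holomorphic_on UNIV" "F b \<noteq> 0"
  shows "\<exists>l. (deriv ^^ l) F a \<noteq> 0"
proof (rule ccontr)
  assume "\<not> ?thesis"
  then have "F w = 0" if "w \<in> ball a (dist a b + 1)" for w
    using holomorphic_fun_eq_0_on_ball[of F a "dist a b + 1" w] assms that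
    by (auto intro: holomorphic_on_subset)
  moreover have "b \<in> ball a (dist a b + 1)" by simp
  ultimately show False using assms by blast
qed

lemma deriv_ord_nonzero:
  assumes "F holomorphic_on UNIV" "F b \<noteq> 0"
  shows "(deriv ^^ ord F a) F a \<noteq> 0"
  unfolding ord_def using entire_nonzero_deriv[OF assms] by (rule LeastI_ex)

lemma deriv_less_ord: "l < ord F a \<Longrightarrow> (deriv ^^ l) F a = 0"
  unfolding ord_def using not_less_Least by blast

lemma ord_le: "(deriv ^^ l) F a \<noteq> 0 \<Longrightarrow> ord F a \<le> l"
  unfolding ord_def by (rule Least_le)

lemma ord_eq_0: "F a \<noteq> 0 \<Longrightarrow> ord F a = 0"
  using ord_le[of 0 F a] by simp

text \<open>The local factorization at \<open>a\<close> becomes global because division by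
  \<open>(z - a) ^ ord F a\<close> is harmless elsewhere; \<open>H\<close> glues the two pieces over
  a ball and \<open>- {a}\<close>. The witness \<open>F b \<noteq> 0\<close>, recurring in these
  lemmas, says that \<open>F\<close> is not identically zero, which is what gives \<open>ord\<close>
  its meaning.\<close>

lemma entire_factor_ord:
  assumes F: "F holomorphic_on UNIV" "F b \<noteq> 0"
  obtains H where "H holomorphic_on UNIV" "H a \<noteq> 0" "\<And>z. F z = (z - a) ^ ord F a * H z"
proof (cases "F a = 0")
  case False
  then show ?thesis using that[of F] F ord_eq_0[of F a] by simp
next
  case True
  let ?p = "ord F a"
  have p: "0 < ?p"
    using True deriv_ord_nonzero[OF F, of a] by (cases ?p) auto
  obtain g r where g: "0 < r" "g holomorphic_on ball a r"
    "\<And>w. w \<in> ball a r \<Longrightarrow> F w - F a = (w - a) ^ ?p * g w"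
    "\<And>w. w \<in> ball a r \<Longrightarrow> g w \<noteq> 0"
    using holomorphic_factor_order_of_zero[OF F(1) open_UNIV UNIV_I p deriv_ord_nonzero[OF F]]
      deriv_less_ord by metis
  define H where "H = (\<lambda>z. if z \<in> ball a r then g z else F z / (z - a) ^ ?p)"
  have eq: "H z = F z / (z - a) ^ ?p" if "z \<noteq> a" for z
    using g(3)[of z] True that by (auto simp: H_def field_simps)
  have "H holomorphic_on (ball a r \<union> - {a})"
  proof (rule holomorphic_on_Un)
    show "H holomorphic_on ball a r"
      using g(2) by (rule holomorphic_transform) (simp add: H_def)
    have "(\<lambda>z. F z / (z - a) ^ ?p) holomorphic_on - {a}"
      by (intro holomorphic_intros holomorphic_on_subset[OF F(1)]) auto
    then show "H holomorphic_on - {a}"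
      by (rule holomorphic_transform) (simp add: eq)
  qed auto
  moreover have "ball a r \<union> - {a} = UNIV" using g(1) by auto
  ultimately have hol: "H holomorphic_on UNIV" by simp
  have Ha: "H a \<noteq> 0" using g by (simp add: H_def)
  have "F z = (z - a) ^ ?p * H z" for z
    using eq[of z] True p by (cases "z = a") auto
  with hol Ha that show ?thesis by blast
qed

lemma le_ordI:
  assumes F: "F holomorphic_on UNIV" "F b \<noteq> 0"
    and H: "H holomorphic_on UNIV" and eq: "\<And>z. F z = (z - a) ^ l * H z"
  shows "l \<le> ord F a"
proof (rule ccontr)
  assume "\<not> ?thesis"
  then have lt: "ord F a < l" by simp
  obtain G where G: "G holomorphic_on UNIV" "G a \<noteq> 0" "\<And>z. F z = (z - a) ^ ord F a * G z"
    using entire_factor_ord[OF F] by blast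
  let ?K = "\<lambda>z. (z - a) ^ (l - ord F a) * H z"
  have "G z = ?K z" if "z \<noteq> a" for z
  proof -
    have "(z - a) ^ ord F a * G z = (z - a) ^ ord F a * ?K z"
      using G(3)[of z] eq[of z] lt by (simp add: mult.assoc[symmetric] power_add[symmetric])
    then show ?thesis using that by simp
  qed
  then have ev: "eventually (\<lambda>z. G z = ?K z) (at a)"
    by (auto simp: eventually_at_filter)
  have cG: "isCont G a" and cK: "isCont ?K a"
    using G(1) H by (auto intro!: entire_isCont holomorphic_intros)
  have "(G \<longlongrightarrow> ?K a) (at a)"
    using cK ev by (simp add: isCont_def filterlim_cong[OF refl refl ev])
  then have "G a = ?K a" using cG LIM_unique by (auto simp: isCont_def)
  then show False using G(2) lt by simp
qed

lemma ord_eqI: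
  assumes F: "F holomorphic_on UNIV"
    and H: "H holomorphic_on UNIV" "H a \<noteq> 0" and eq: "\<And>z. F z = (z - a) ^ l * H z"
  shows "ord F a = l"
proof -
  have "isCont H a" using H(1) by (rule entire_isCont)
  then have "eventually (\<lambda>z. H z \<noteq> 0) (at a)"
    using H(2) by (simp add: isCont_def tendsto_imp_eventually_ne)
  then have "eventually (\<lambda>z. H z \<noteq> 0 \<and> z \<noteq> a) (at a)"
    by (simp add: eventually_at_filter)
  then obtain b where "H b \<noteq> 0" "b \<noteq> a"
    using eventually_happens by fastforce
  then have b: "F b \<noteq> 0" using eq by simp
  have "l \<le> ord F a" by (rule le_ordI[OF F b H(1) eq])
  moreover have "\<not> l < ord F a"
  proof
    assume lt: "l < ord F a"
    obtain G where G: "G holomorphic_on UNIV" "G a \<noteq> 0" "\<And>z. F z = (z - a) ^ ord F a * G z"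
      using entire_factor_ord[OF F b] by blast
    have "H z = (z - a) ^ (ord F a - l) * G z" if "z \<noteq> a" for z
    proof -
      have "(z - a) ^ l * H z = (z - a) ^ l * ((z - a) ^ (ord F a - l) * G z)"
        using G(3)[of z] eq[of z] lt by (simp add: mult.assoc[symmetric] power_add[symmetric])
      then show ?thesis using that by simp
    qed
    then have ev: "eventually (\<lambda>z. H z = (z - a) ^ (ord F a - l) * G z) (at a)"
      by (auto simp: eventually_at_filter)
    have cK: "isCont (\<lambda>z. (z - a) ^ (ord F a - l) * G z) a"
      using G(1) by (auto intro!: entire_isCont holomorphic_intros)
    then have "(H \<longlongrightarrow> 0) (at a)"
      using lt by (simp add: isCont_def filterlim_cong[OF refl refl ev] zero_power)
    then have "H a = 0" using \<open>isCont H a\<close> LIM_unique by (auto simp: isCont_def)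
    with H(2) show False by simp
  qed
  ultimately show ?thesis by simp
qed

lemma ord_pos_iff:
  assumes "F holomorphic_on UNIV" "F b \<noteq> 0"
  shows "0 < ord F a \<longleftrightarrow> F a = 0"
  using ord_eq_0[of F a] deriv_ord_nonzero[OF assms, of a] by (cases "ord F a") auto

lemma entire_factor_zeros:
  assumes F: "F holomorphic_on UNIV" "F b \<noteq> 0" and "finite Z"
  shows "\<exists>H. H holomorphic_on UNIV \<and> (\<forall>a\<in>Z. H a \<noteq> 0) \<and> (\<forall>z. F z = (\<Prod>a\<in>Z. (z - a) ^ ord F a) * H z)"
  using \<open>finite Z\<close>
proof (induction Z)
  case empty
  then show ?case using F by auto
next
  case (insert c Z)
  then obtain H where H: "H holomorphic_on UNIV" "\<forall>a\<in>Z. H a \<noteq> 0"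
    "\<And>z. F z = (\<Prod>a\<in>Z. (z - a) ^ ord F a) * H z" by auto
  let ?P = "\<lambda>z. \<Prod>a\<in>Z. (z - a) ^ ord F a"
  have Hb: "H b \<noteq> 0" using H(3)[of b] F(2) by auto
  obtain K where K: "K holomorphic_on UNIV" "K c \<noteq> 0" "\<And>z. H z = (z - c) ^ ord H c * K z"
    using entire_factor_ord[OF H(1) Hb] by blast
  have "ord F c = ord H c"
    by (rule ord_eqI[where H="\<lambda>z. ?P z * K z"])
      (use F H(1) K insert in \<open>auto intro!: holomorphic_intros simp: H(3)\<close>)
  then have "\<forall>z. F z = (\<Prod>a\<in>insert c Z. (z - a) ^ ord F a) * K z"
    using insert H(3) K(3) by simp
  moreover have "\<forall>a\<in>insert c Z. K a \<noteq> 0" using H(2) K by auto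
  ultimately show ?case using K(1) by blast
qed

lemma finite_zeros_cball:
  assumes F: "F holomorphic_on UNIV" "F b \<noteq> 0"
  shows "finite {z \<in> cball 0 R. F z = 0}"
proof (rule ccontr)
  assume inf: "infinite {z \<in> cball 0 R. F z = 0}"
  obtain l where l: "l islimpt {z \<in> cball 0 R. F z = 0}"
    using compact_eq_Bolzano_Weierstrass[of "cball 0 R :: complex set"] inf
    by (metis (no_types, lifting) compact_cball mem_Collect_eq subsetI)
  have "F b = 0"
    by (rule analytic_continuation[OF F(1) open_UNIV connected_UNIV subset_UNIV UNIV_I l]) auto
  with F(2) show False by simp
qed

lemma finite_zeros_ball:
  assumes F: "F holomorphic_on UNIV" "F b \<noteq> 0"
  shows "finite {z \<in> ball 0 R. F z = 0}"
  using finite_zeros_cball[OF F, of R] by (rule rev_finite_subset) auto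

text \<open>The logarithm lives on a disc strictly larger than \<open>cball 0 R\<close>, because the
  mean of \<open>Re G\<close> over the circle of radius \<open>R\<close> will be taken with
  \<open>G\<close> holomorphic beyond that circle.\<close>

lemma entire_zero_free_log:
  assumes H: "H holomorphic_on UNIV" and nz: "\<And>z. z \<in> cball 0 R \<Longrightarrow> H z \<noteq> 0" and R: "0 < R"
  obtains G R' where "R < R'" "G holomorphic_on ball 0 R'" "\<And>z. z \<in> ball 0 R' \<Longrightarrow> H z = exp (G z)"
proof -
  have op: "open {z. H z \<noteq> 0}"
    using H by (intro open_Collect_neq continuous_intros holomorphic_on_imp_continuous_on)
  obtain e where e: "0 < e" "(\<Union>x\<in>cball 0 R. ball x e) \<subseteq> {z. H z \<noteq> 0}"
    using compact_subset_open_imp_ball_epsilon_subset[OF compact_cball op, of 0 R] nz by blast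
  have nz': "H z \<noteq> 0" if z: "z \<in> ball 0 (R + e)" for z
  proof (cases "norm z \<le> R")
    case True then show ?thesis using nz by simp
  next
    case False
    \<comment> \<open>The radial projection of \<open>z\<close> to the circle belongs to
      \<open>cball 0 R\<close> and is closer to \<open>z\<close> than \<open>e\<close>.\<close>
    let ?x = "of_real (R / norm z) * z"
    have z0: "z \<noteq> 0" using False R by (metis norm_zero less_imp_le)
    then have "norm ?x = R" using R by (auto simp: norm_mult norm_divide)
    moreover have "dist ?x z < e"
    proof -
      have "?x - z = of_real (R / norm z - 1) * z" by (simp add: algebra_simps)
      then have "dist ?x z = \<bar>R / norm z - 1\<bar> * norm z"
        by (simp only: dist_norm norm_mult norm_of_real)
      also have "\<dots> = norm z - R" using False R z0 by (simp add: abs_if field_simps)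
      finally show ?thesis using z by simp
    qed
    ultimately have "?x \<in> cball 0 R" "z \<in> ball ?x e" by (simp_all only: mem_cball_0 mem_ball order_refl)
    then show ?thesis using e(2) by blast
  qed
  obtain G where "G holomorphic_on ball 0 (R + e)" "\<And>z. z \<in> ball 0 (R + e) \<Longrightarrow> H z = exp (G z)"
    using contractible_imp_holomorphic_log[of H "ball 0 (R+e)"] nz' H
    by (metis convex_ball convex_imp_contractible holomorphic_on_subset subset_UNIV)
  then show ?thesis using that[of "R + e" G] e(1) by simp
qed

section \<open>Circle means and Jensen's formula\<close>

definition cmean :: "(complex \<Rightarrow> real) \<Rightarrow> real \<Rightarrow> real" where
  "cmean u r = integral {0..1} (\<lambda>s. u (circlepath 0 r s))"

lemma norm_circlepath_0 [simp]: "norm (circlepath 0 r s) = \<bar>r\<bar>"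
  by (simp add: circlepath norm_mult)

lemma circlepath_sphere: "0 \<le> r \<Longrightarrow> circlepath 0 r s \<in> sphere 0 r"
  by (simp add: dist_norm)

lemma continuous_on_circlepath: "continuous_on A (circlepath z r)"
  unfolding circlepath by (intro continuous_intros)

lemma cmean_has_integral:
  assumes "0 \<le> r" "continuous_on (sphere 0 r) u"
  shows "((\<lambda>s. u (circlepath 0 r s)) has_integral cmean u r) {0..1}"
proof -
  have "continuous_on {0..1} (\<lambda>s. u (circlepath 0 r s))"
    using assms circlepath_sphere[OF assms(1)]
    by (intro continuous_on_compose2[OF assms(2) continuous_on_circlepath]) auto
  then show ?thesis unfolding cmean_def
    by (intro integrable_integral integrable_continuous_real)
qed

lemma cmean_add:
  assumes "0 \<le> r" "continuous_on (sphere 0 r) u" "continuous_on (sphere 0 r) v"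
  shows "cmean (\<lambda>z. u z + v z) r = cmean u r + cmean v r"
  unfolding cmean_def
  by (rule integral_unique, rule has_integral_add)
    (rule cmean_has_integral[unfolded cmean_def], (rule assms)+)+

lemma cmean_cmult: "cmean (\<lambda>z. c * u z) r = c * cmean u r"
  unfolding cmean_def by simp

lemma cmean_const [simp]: "cmean (\<lambda>z. c) r = c"
  unfolding cmean_def by simp

lemma cmean_diff:
  assumes "0 \<le> r" "continuous_on (sphere 0 r) u" "continuous_on (sphere 0 r) v"
  shows "cmean (\<lambda>z. u z - v z) r = cmean u r - cmean v r"
  unfolding cmean_def
  by (rule integral_unique, rule has_integral_diff)
    (rule cmean_has_integral[unfolded cmean_def], (rule assms)+)+

lemma cmean_sum:
  assumes "0 \<le> r" "finite A" "\<And>a. a \<in> A \<Longrightarrow> continuous_on (sphere 0 r) (u a)"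
  shows "cmean (\<lambda>z. \<Sum>a\<in>A. u a z) r = (\<Sum>a\<in>A. cmean (u a) r)"
  unfolding cmean_def
  by (rule integral_unique, rule has_integral_sum[OF assms(2)],
      rule cmean_has_integral[unfolded cmean_def, OF assms(1) assms(3)])

lemma cmean_mono:
  assumes "0 \<le> r" "continuous_on (sphere 0 r) u" "continuous_on (sphere 0 r) v"
    and "\<And>z. norm z = r \<Longrightarrow> u z \<le> v z"
  shows "cmean u r \<le> cmean v r"
  by (rule has_integral_le[OF cmean_has_integral[OF assms(1,2)] cmean_has_integral[OF assms(1,3)]])
    (use assms in auto)

lemma cmean_cong:
  assumes "0 \<le> r" "\<And>z. norm z = r \<Longrightarrow> u z = v z"
  shows "cmean u r = cmean v r"
  unfolding cmean_def by (rule integral_cong) (use assms in auto)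

lemma holomorphic_mean_value:
  assumes "continuous_on (cball 0 r) G" "G holomorphic_on ball 0 r" "0 < r"
  shows "((\<lambda>s. G (circlepath 0 r s)) has_integral G 0) {0..1}"
proof -
  have "((\<lambda>u. G u / (u - 0)) has_contour_integral 2 * of_real pi * \<i> * G 0) (circlepath 0 r)"
    by (rule Cauchy_integral_circlepath) (use assms in auto)
  then have "((\<lambda>s. (G (circlepath 0 r s) / circlepath 0 r s) *
      vector_derivative (circlepath 0 r) (at s within {0..1})) has_integral 2 * of_real pi * \<i> * G 0) {0..1}"
    by (simp add: has_contour_integral_def)
  then have "((\<lambda>s. (2 * of_real pi * \<i>) * G (circlepath 0 r s)) has_integral 2 * of_real pi * \<i> * G 0) {0..1}"
  proof (rule has_integral_eq[rotated])
    fix s :: real assume "s \<in> {0..1}"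
    then have "vector_derivative (circlepath 0 r) (at s within {0..1}) = 2 * of_real pi * \<i> * circlepath 0 r s"
      by (subst vector_derivative_circlepath01) (simp_all add: circlepath)
    moreover have "circlepath 0 r s \<noteq> 0" using assms(3) by (simp add: circlepath)
    ultimately show "G (circlepath 0 r s) / circlepath 0 r s * vector_derivative (circlepath 0 r) (at s within {0..1})
      = 2 * of_real pi * \<i> * G (circlepath 0 r s)" by simp
  qed
  then have "((\<lambda>s. (1 / (2 * of_real pi * \<i>)) * ((2 * of_real pi * \<i>) * G (circlepath 0 r s)))
       has_integral (1 / (2 * of_real pi * \<i>)) * (2 * of_real pi * \<i> * G 0)) {0..1}"
    by (rule has_integral_mult_right)
  then show ?thesis by simp
qed

lemma cmean_Re:
  assumes "G holomorphic_on ball 0 R" "0 < r" "r < R"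
  shows "cmean (\<lambda>z. Re (G z)) r = Re (G 0)"
proof -
  have "cball 0 r \<subseteq> ball (0::complex) R" "ball 0 r \<subseteq> ball (0::complex) R" using assms by auto
  then have "((\<lambda>s. G (circlepath 0 r s)) has_integral G 0) {0..1}"
    using assms by (intro holomorphic_mean_value)
      (auto intro: holomorphic_on_subset continuous_on_subset dest: holomorphic_on_imp_continuous_on)
  from has_integral_linear[OF this bounded_linear_Re] show ?thesis
    by (simp add: cmean_def o_def integral_unique)
qed

text \<open>On the circle, |z - a| = r |1 - conj(a) z / r^2|. The second factor vanishes at most at
  the reflection of \<open>a\<close>, outside the circle, so its logarithm is the real part of a
  holomorphic function on a larger disc, with value 0 at the origin.\<close>

lemma cmean_ln_dist:
  assumes "norm a < r"
  shows "cmean (\<lambda>z. ln (norm (z - a))) r = ln r"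
proof -
  have r: "0 < r" using assms norm_ge_zero[of a] by linarith
  define w where "w = (\<lambda>z. 1 - cnj a * z / of_real (r\<^sup>2))"
  obtain R where R: "r < R" "norm a * R < r\<^sup>2"
  proof (cases "a = 0")
    case True then show ?thesis using that[of "r+1"] r by simp
  next
    case False
    have "r < r\<^sup>2 / norm a" using False assms r by (simp add: field_simps power2_eq_square)
    then obtain R where "r < R" "R < r\<^sup>2 / norm a" using dense by blast
    then show ?thesis using that[of R] False by (simp add: field_simps)
  qed
  have small: "norm (cnj a * z / of_real (r\<^sup>2)) < 1" if "norm z < R" for z
  proof -
    have "norm a * norm z \<le> norm a * R" using that by (intro mult_left_mono) auto
    then have "norm a * norm z < r\<^sup>2" using R by linarith
    then show ?thesis using r by (simp add: norm_mult norm_divide norm_power)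
  qed
  have pos: "0 < Re (w z)" if "norm z < R" for z
    using small[OF that] complex_Re_le_cmod[of "cnj a * z / of_real (r\<^sup>2)"] by (simp add: w_def)
  have hol: "(\<lambda>z. Ln (w z)) holomorphic_on ball 0 R"
  proof -
    have "w holomorphic_on ball 0 R" unfolding w_def using r by (intro holomorphic_intros) auto
    moreover have "w z \<notin> \<real>\<^sub>\<le>\<^sub>0" if "z \<in> ball 0 R" for z
      using pos[of z] that complex_nonpos_Reals_iff[of "w z"] by auto
    ultimately show ?thesis by (intro holomorphic_on_Ln') auto
  qed
  have "cmean (\<lambda>z. ln (norm (z - a))) r = cmean (\<lambda>z. ln r + Re (Ln (w z))) r"
  proof (rule cmean_cong)
    fix z :: complex assume z: "norm z = r"
    have zz: "z * cnj z = of_real (r\<^sup>2)" using z complex_norm_square[of z] by simp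
    have z0: "z \<noteq> 0" using z r by auto
    have "z - a = z * cnj (w z)"
      using zz r by (simp add: w_def algebra_simps)
    then have "norm (z - a) = r * norm (w z)" using z by (simp add: norm_mult)
    moreover have "w z \<noteq> 0" using pos[of z] z R by auto
    ultimately show "ln (norm (z - a)) = ln r + Re (Ln (w z))"
      using r by (simp add: ln_mult)
  qed (use r in auto)
  also have "\<dots> = ln r + cmean (\<lambda>z. Re (Ln (w z))) r"
  proof -
    have "sphere 0 r \<subseteq> ball (0::complex) R" using R by auto
    then have "continuous_on (sphere 0 r) (\<lambda>z. Ln (w z))"
      using holomorphic_on_imp_continuous_on[OF hol] continuous_on_subset by blast
    then show ?thesis using r by (subst cmean_add) (auto intro!: continuous_intros)
  qed
  also have "cmean (\<lambda>z. Re (Ln (w z))) r = 0"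
    using cmean_Re[OF hol r R(1)] by (simp add: w_def)
  finally show ?thesis by simp
qed

text \<open>Nevanlinna's integrated counting function of the divisor \<open>\<mu>\<close>. The
  weight of the origin, involving \<open>r / 0\<close>, is arbitrary; every divisor to which it is
  applied is 0 there.\<close>

definition Ncount :: "(complex \<Rightarrow> nat) \<Rightarrow> real \<Rightarrow> real" where
  "Ncount \<mu> r = (\<Sum>a | a \<in> ball 0 r \<and> \<mu> a \<noteq> 0. real (\<mu> a) * ln (r / norm a))"

lemma continuous_on_ln_norm:
  assumes "F holomorphic_on UNIV" "\<And>z. z \<in> S \<Longrightarrow> F z \<noteq> 0"
  shows "continuous_on S (\<lambda>z. ln (norm (F z)))"
  using assms by (intro continuous_intros continuous_on_subset[OF holomorphic_on_imp_continuous_on[OF assms(1)]]) auto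


lemma entire_factor_disc:
  assumes F: "F holomorphic_on UNIV" "F b \<noteq> 0" and r: "0 < r"
    and nz: "\<And>z. norm z = r \<Longrightarrow> F z \<noteq> 0"
  obtains G R where "r < R" "G holomorphic_on ball 0 R"
    "\<And>z. z \<in> ball 0 R \<Longrightarrow> F z = (\<Prod>a\<in>{z \<in> ball 0 r. F z = 0}. (z - a) ^ ord F a) * exp (G z)"
proof -
  let ?Z = "{z \<in> ball 0 r. F z = 0}"
  have fin: "finite ?Z" by (rule finite_zeros_ball[OF F])
  obtain H where H: "H holomorphic_on UNIV" "\<forall>a\<in>?Z. H a \<noteq> 0"
    "\<And>z. F z = (\<Prod>a\<in>?Z. (z - a) ^ ord F a) * H z"
    using entire_factor_zeros[OF F fin] by blast
  have Hnz: "H z \<noteq> 0" if "z \<in> cball 0 r" for z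
  proof
    assume "H z = 0"
    then have "F z = 0" using H(3)[of z] by (metis mult_zero_right)
    then have "norm z < r" using nz[of z] that by (cases "norm z = r") auto
    then have "z \<in> ?Z" using \<open>F z = 0\<close> by simp
    then show False using H(2) \<open>H z = 0\<close> by blast
  qed
  obtain G R where G: "r < R" "G holomorphic_on ball 0 R" "\<And>z. z \<in> ball 0 R \<Longrightarrow> H z = exp (G z)"
    using entire_zero_free_log[OF H(1) Hnz r] by blast
  show ?thesis
    by (rule that[OF G(1,2)]) (metis H(3) G(3))
qed

text \<open>The zeros in the disc are split off. Each factor \<open>z - a\<close> has logarithmic
  mean \<open>ln r\<close> by \<open>cmean_ln_dist\<close>, and what remains is the real part of a
  holomorphic function, with its mean value property. The same factorization at 0 brings in
  \<open>ln (norm (F 0))\<close>.\<close>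

theorem jensen:
  assumes F: "F holomorphic_on UNIV" "F 0 \<noteq> 0" and r: "0 < r"
    and nz: "\<And>z. norm z = r \<Longrightarrow> F z \<noteq> 0"
  shows "cmean (\<lambda>z. ln (norm (F z))) r = ln (norm (F 0)) + Ncount (ord F) r"
proof -
  let ?Z = "{z \<in> ball 0 r. F z = 0}"
  have fin: "finite ?Z" by (rule finite_zeros_ball[OF F])
  obtain G R where G: "r < R" "G holomorphic_on ball 0 R"
    "\<And>z. z \<in> ball 0 R \<Longrightarrow> F z = (\<Prod>a\<in>?Z. (z - a) ^ ord F a) * exp (G z)"
    using entire_factor_disc[OF F r nz] by blast
  have lnF: "ln (norm (F z)) = (\<Sum>a\<in>?Z. real (ord F a) * ln (norm (z - a))) + Re (G z)"
    if "z \<in> ball 0 R" "F z \<noteq> 0" for z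
  proof -
    have ne: "z - a \<noteq> 0" if "a \<in> ?Z" for a using that \<open>F z \<noteq> 0\<close> by auto
    have "norm (F z) = (\<Prod>a\<in>?Z. norm (z - a) ^ ord F a) * exp (Re (G z))"
      unfolding G(3)[OF that(1)] norm_mult prod_norm[symmetric] norm_power norm_exp_eq_Re ..
    moreover have "(\<Prod>a\<in>?Z. norm (z - a) ^ ord F a) > 0" using ne by (intro prod_pos) auto
    ultimately have "ln (norm (F z)) = ln (\<Prod>a\<in>?Z. norm (z - a) ^ ord F a) + Re (G z)"
      by (simp only: ln_mult_pos exp_gt_zero ln_exp)
    also have "ln (\<Prod>a\<in>?Z. norm (z - a) ^ ord F a) = (\<Sum>a\<in>?Z. ln (norm (z - a) ^ ord F a))"
      using ne by (intro ln_prod[OF fin]) auto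
    also have "\<dots> = (\<Sum>a\<in>?Z. real (ord F a) * ln (norm (z - a)))"
      using ne by (intro sum.cong) (auto simp: ln_realpow)
    finally show ?thesis .
  qed
  have cG: "continuous_on (sphere 0 r) (\<lambda>z. Re (G z))"
    using G by (intro continuous_intros continuous_on_subset[OF holomorphic_on_imp_continuous_on[OF G(2)]]) auto
  have ca: "continuous_on (sphere 0 r) (\<lambda>z. real (ord F a) * ln (norm (z - a)))" if "a \<in> ?Z" for a
    using that by (intro continuous_intros) auto
  have "cmean (\<lambda>z. ln (norm (F z))) r = cmean (\<lambda>z. (\<Sum>a\<in>?Z. real (ord F a) * ln (norm (z - a))) + Re (G z)) r"
    using r G(1) nz by (intro cmean_cong lnF) auto
  also have "\<dots> = (\<Sum>a\<in>?Z. real (ord F a) * ln r) + Re (G 0)"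
  proof -
    have "cmean (\<lambda>z. (\<Sum>a\<in>?Z. real (ord F a) * ln (norm (z - a)))) r = (\<Sum>a\<in>?Z. real (ord F a) * ln r)"
      using r by (subst cmean_sum[OF _ fin ca]) (auto simp: cmean_cmult cmean_ln_dist)
    moreover have "continuous_on (sphere 0 r) (\<lambda>z. \<Sum>a\<in>?Z. real (ord F a) * ln (norm (z - a)))"
      by (rule continuous_on_sum) (rule ca)
    ultimately show ?thesis using r cG cmean_Re[OF G(2) r G(1)] by (subst cmean_add) simp_all
  qed
  also have "Re (G 0) = ln (norm (F 0)) - (\<Sum>a\<in>?Z. real (ord F a) * ln (norm a))"
  proof -
    have "(0::complex) \<in> ball 0 R" using r G(1) by simp
    from lnF[OF this F(2)] show ?thesis by simp
  qed
  also have "(\<Sum>a\<in>?Z. real (ord F a) * ln r) + (ln (norm (F 0)) - (\<Sum>a\<in>?Z. real (ord F a) * ln (norm a)))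
     = ln (norm (F 0)) + (\<Sum>a\<in>?Z. real (ord F a) * ln (r / norm a))"
  proof -
    have "real (ord F a) * ln (r / norm a) = real (ord F a) * ln r - real (ord F a) * ln (norm a)" if "a \<in> ?Z" for a
      using that F(2) r by (subst ln_div) (auto simp: algebra_simps)
    then show ?thesis by (simp add: sum_subtractf)
  qed
  also have "(\<Sum>a\<in>?Z. real (ord F a) * ln (r / norm a)) = Ncount (ord F) r"
    unfolding Ncount_def using ord_pos_iff[OF F] by (intro sum.cong) auto
  finally show ?thesis .
qed

section \<open>Logarithmic derivatives\<close>

lemma deriv_circle_integral:
  assumes cG: "continuous_on (cball 0 R) G" and hG: "G holomorphic_on ball 0 R" and z: "norm z < R"
  shows "((\<lambda>s. G (circlepath 0 R s) * circlepath 0 R s / (circlepath 0 R s - z)\<^sup>2) has_integral deriv G z) {0..1}"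
proof -
  let ?c = "circlepath 0 R"
  have "((\<lambda>u. G u / (u - z) ^ Suc 1) has_contour_integral (2 * of_real pi * \<i>) / fact 1 * (deriv ^^ 1) G z) ?c"
    using Cauchy_has_contour_integral_higher_derivative_circlepath[OF cG hG, of z 1] z by simp
  then have "((\<lambda>s. G (?c s) / (?c s - z)\<^sup>2 * vector_derivative ?c (at s within {0..1}))
      has_integral 2 * of_real pi * \<i> * deriv G z) {0..1}"
    by (simp add: has_contour_integral_def power2_eq_square)
  then have "((\<lambda>s. (2 * of_real pi * \<i>) * (G (?c s) * ?c s / (?c s - z)\<^sup>2))
      has_integral 2 * of_real pi * \<i> * deriv G z) {0..1}"
  proof (rule has_integral_eq[rotated])
    fix s :: real assume "s \<in> {0..1}"
    then have "vector_derivative ?c (at s within {0..1}) = 2 * of_real pi * \<i> * ?c s"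
      by (subst vector_derivative_circlepath01) (simp_all add: circlepath)
    then show "G (?c s) / (?c s - z)\<^sup>2 * vector_derivative ?c (at s within {0..1})
      = 2 * of_real pi * \<i> * (G (?c s) * ?c s / (?c s - z)\<^sup>2)" by simp
  qed
  then have "((\<lambda>s. (1 / (2 * of_real pi * \<i>)) * ((2 * of_real pi * \<i>) * (G (?c s) * ?c s / (?c s - z)\<^sup>2)))
      has_integral (1 / (2 * of_real pi * \<i>)) * (2 * of_real pi * \<i> * deriv G z)) {0..1}"
    by (rule has_integral_mult_right)
  then show ?thesis by simp
qed

text \<open>A differentiated Schwarz formula: in the application only \<open>Re G\<close>, the
  logarithm of a modulus, is under control. Adding to Cauchy's formula for \<open>deriv G z\<close>
  an integral with \<open>cnj G\<close> that is equal to 0 turns \<open>G\<close> into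
  \<open>2 * Re G\<close> under the integral.\<close>

lemma deriv_bound_Re_cmean:
  assumes G: "G holomorphic_on ball 0 R'" and R: "0 < R" "R < R'" and z: "norm z < R"
  shows "norm (deriv G z) \<le> 2 * R / (R - norm z)\<^sup>2 * cmean (\<lambda>w. \<bar>Re (G w)\<bar>) R"
proof -
  have sub: "cball 0 R \<subseteq> ball (0::complex) R'" "ball 0 R \<subseteq> ball (0::complex) R'" using R by auto
  have cG: "continuous_on (cball 0 R) G"
    using G sub by (blast intro: continuous_on_subset holomorphic_on_imp_continuous_on)
  have hG: "G holomorphic_on ball 0 R" using G sub by (blast intro: holomorphic_on_subset)
  let ?c = "circlepath 0 R"
  have c: "?c s * cnj (?c s) = of_real (R\<^sup>2)" "?c s \<noteq> 0" "norm (?c s) = R" for s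
  proof -
    show 3: "norm (?c s) = R" using R by simp
    then show "?c s * cnj (?c s) = of_real (R\<^sup>2)"
      using complex_norm_square[of "?c s"] by (simp del: norm_circlepath_0)
    show "?c s \<noteq> 0" using R by (simp add: circlepath)
  qed
  note I1 = deriv_circle_integral[OF cG hG z]
  \<comment> \<open>Chosen so that on the circle, where \<open>u * cnj u = R\<^sup>2\<close>, the
    conjugate of \<open>k\<close> is the Cauchy kernel times \<open>cnj G\<close>. Inside the disc
    \<open>k\<close> is holomorphic and vanishes at 0, whence the integral 0.\<close>
  define k where "k = (\<lambda>u. G u * (of_real (R\<^sup>2) * u) / (of_real (R\<^sup>2) - cnj z * u)\<^sup>2)"
  have ne: "of_real (R\<^sup>2) - cnj z * u \<noteq> 0" if "u \<in> cball 0 R" for u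
  proof
    assume "of_real (R\<^sup>2) - cnj z * u = 0"
    then have "norm (of_real (R\<^sup>2) :: complex) = norm z * norm u"
      by (metis complex_mod_cnj eq_iff_diff_eq_0 norm_mult)
    then have "R * R = norm z * norm u" using R by (simp add: norm_power norm_mult power2_eq_square)
    also have "\<dots> \<le> norm z * R" using that by (intro mult_left_mono) auto
    also have "\<dots> < R * R" using z R by simp
    finally show False by simp
  qed
  have "((\<lambda>s. k (?c s)) has_integral k 0) {0..1}"
  proof (rule holomorphic_mean_value)
    show "continuous_on (cball 0 R) k" unfolding k_def
      using ne by (intro continuous_intros cG) auto
    show "k holomorphic_on ball 0 R" unfolding k_def
      using ne by (intro holomorphic_intros hG) auto
  qed (use R in auto)
  moreover have "k 0 = 0" by (simp add: k_def)
  ultimately have "((\<lambda>s. cnj (k (?c s))) has_integral 0) {0..1}"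
    using has_integral_linear[OF _ bounded_linear_cnj, of "\<lambda>s. k (?c s)"]
        by (metis (no_types, lifting) comp_def complex_cnj_zero has_integral_cong)
  then have I2: "((\<lambda>s. cnj (G (?c s)) * ?c s / (?c s - z)\<^sup>2) has_integral 0) {0..1}"
  proof (rule has_integral_eq[rotated])
    fix s :: real
    let ?w = "?c s"
    have "of_real (R\<^sup>2) - z * cnj ?w = cnj ?w * (?w - z)"
      using c(1)[of s] by (simp add: algebra_simps)
    then have "cnj (k ?w) = cnj (G ?w) * (of_real (R\<^sup>2) * cnj ?w) / (cnj ?w * (?w - z))\<^sup>2"
      by (simp add: k_def)
    also have "\<dots> = cnj (G ?w) * (?w * cnj ?w * cnj ?w) / (cnj ?w * (?w - z))\<^sup>2"
      using c(1)[of s] by simp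
    also have "\<dots> = cnj (G ?w) * ?w / (?w - z)\<^sup>2"
      using c(2)[of s] by (simp add: power2_eq_square)
    finally show "cnj (k ?w) = cnj (G ?w) * ?w / (?w - z)\<^sup>2" .
  qed
  have I: "((\<lambda>s. 2 * of_real (Re (G (?c s))) * ?c s / (?c s - z)\<^sup>2) has_integral deriv G z) {0..1}"
    using has_integral_add[OF I1 I2]
    by (simp add: complex_add_cnj add_divide_distrib[symmetric] distrib_right[symmetric])
  have cRe: "continuous_on (sphere 0 R) (\<lambda>w. \<bar>Re (G w)\<bar>)"
    by (intro continuous_intros continuous_on_subset[OF cG]) auto
  let ?C = "2 * R / (R - norm z)\<^sup>2"
  have g: "((\<lambda>s. ?C * \<bar>Re (G (?c s))\<bar>) has_integral ?C * cmean (\<lambda>w. \<bar>Re (G w)\<bar>) R) {0..1}"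
    by (intro has_integral_mult_right cmean_has_integral cRe) (use R in auto)
  have "norm (integral {0..1} (\<lambda>s. 2 * of_real (Re (G (?c s))) * ?c s / (?c s - z)\<^sup>2))
     \<le> integral {0..1} (\<lambda>s. ?C * \<bar>Re (G (?c s))\<bar>)"
  proof (rule integral_norm_bound_integral)
    fix s :: real assume "s \<in> {0..1}"
    have "R - norm z \<le> norm (?c s - z)" using norm_triangle_ineq2[of "?c s" z] c(3)[of s] by simp
    then have "(R - norm z)\<^sup>2 \<le> norm (?c s - z) ^ 2" using z by (intro power_mono) auto
    then have "2 * \<bar>Re (G (?c s))\<bar> * R / norm (?c s - z) ^ 2 \<le> 2 * \<bar>Re (G (?c s))\<bar> * R / (R - norm z)\<^sup>2"
      using z R by (intro divide_left_mono) (auto intro!: mult_pos_pos zero_less_power)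
    then show "norm (2 * of_real (Re (G (?c s))) * ?c s / (?c s - z)\<^sup>2) \<le> ?C * \<bar>Re (G (?c s))\<bar>"
      using c(3)[of s] by (simp add: norm_mult norm_divide norm_power mult.commute)
  qed (use I g in \<open>auto simp: has_integral_iff\<close>)
  then show ?thesis unfolding integral_unique[OF I] integral_unique[OF g] .
qed

text \<open>Factor by factor: |z + w - c| is at most |z - c| (1 + |w| / d), and 1 + x is at most exp
  x.\<close>

lemma norm_prod_shift_le:
  fixes z w :: complex
  assumes "finite Z" "0 < d" "\<And>a. a \<in> Z \<Longrightarrow> d \<le> norm (z - a)"
  shows "norm (\<Prod>a\<in>Z. (z + w - a) ^ m a) \<le> exp (real (\<Sum>a\<in>Z. m a) * norm w / d) * norm (\<Prod>a\<in>Z. (z - a) ^ m a)"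
  using assms(1,3)
proof (induction Z)
  case (insert c Z)
  have "norm (z + w - c) \<le> norm (z - c) + norm w"
    using norm_triangle_ineq[of "z - c" w] by (simp add: algebra_simps)
  also have "\<dots> = norm (z - c) * (1 + norm w / norm (z - c))"
    using insert.prems[of c] assms(2) by (auto simp: field_simps)
  also have "\<dots> \<le> norm (z - c) * (1 + norm w / d)"
    using insert.prems[of c] assms(2) by (intro mult_left_mono add_left_mono divide_left_mono mult_pos_pos) auto
  also have "\<dots> \<le> norm (z - c) * exp (norm w / d)"
    by (intro mult_left_mono exp_ge_add_one_self) auto
  finally have "norm (z + w - c) ^ m c \<le> (norm (z - c) * exp (norm w / d)) ^ m c"
    by (intro power_mono) auto
  also have "\<dots> = exp (real (m c) * norm w / d) * norm (z - c) ^ m c"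
    by (simp add: power_mult_distrib exp_of_nat_mult[symmetric])
  finally have 1: "norm (z + w - c) ^ m c \<le> exp (real (m c) * norm w / d) * norm (z - c) ^ m c" .
  have 2: "norm (\<Prod>a\<in>Z. (z + w - a) ^ m a) \<le> exp (real (\<Sum>a\<in>Z. m a) * norm w / d) * norm (\<Prod>a\<in>Z. (z - a) ^ m a)"
    using insert by auto
  have "norm (\<Prod>a\<in>insert c Z. (z + w - a) ^ m a) = norm (z + w - c) ^ m c * norm (\<Prod>a\<in>Z. (z + w - a) ^ m a)"
    using insert by (simp add: norm_mult norm_power)
  also have "\<dots> \<le> (exp (real (m c) * norm w / d) * norm (z - c) ^ m c) *
      (exp (real (\<Sum>a\<in>Z. m a) * norm w / d) * norm (\<Prod>a\<in>Z. (z - a) ^ m a))"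
    using 1 2 by (intro mult_mono) auto
  also have "\<dots> = exp (real (\<Sum>a\<in>insert c Z. m a) * norm w / d) * norm (\<Prod>a\<in>insert c Z. (z - a) ^ m a)"
    using insert by (simp add: norm_mult norm_power exp_add[symmetric] add_divide_distrib algebra_simps flip: exp_add)
  finally show ?case .
qed auto

definition sep :: "(complex \<Rightarrow> complex) \<Rightarrow> real \<Rightarrow> real \<Rightarrow> bool" where
  "sep F \<delta> r \<longleftrightarrow> (\<forall>a. F a = 0 \<longrightarrow> \<delta> \<le> \<bar>norm a - r\<bar>)"

definition zcount :: "(complex \<Rightarrow> complex) \<Rightarrow> real \<Rightarrow> nat" where
  "zcount F r = (\<Sum>a | a \<in> ball 0 r \<and> F a = 0. ord F a)"

lemma sep_mono: "sep F \<delta> r \<Longrightarrow> \<delta>' \<le> \<delta> \<Longrightarrow> sep F \<delta>' r"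
  unfolding sep_def by (meson order_trans)

lemma sep_dist: "sep F \<delta> r \<Longrightarrow> F a = 0 \<Longrightarrow> norm z = r \<Longrightarrow> \<delta> \<le> norm (z - a)"
  using norm_triangle_ineq3[of z a] by (fastforce simp: sep_def abs_minus_commute)

lemma sep_nonzero: "sep F \<delta> r \<Longrightarrow> 0 < \<delta> \<Longrightarrow> norm z = r \<Longrightarrow> F z \<noteq> 0"
  by (force simp: sep_def)

lemma abs_ln_le: "0 < \<delta> \<Longrightarrow> \<delta> \<le> x \<Longrightarrow> x \<le> (M::real) \<Longrightarrow> \<bar>ln x\<bar> \<le> 1 / \<delta> + M"
proof -
  assume a: "0 < \<delta>" "\<delta> \<le> x" "x \<le> M"
  have "ln x \<le> x" using ln_le_minus_one[of x] a by simp
  moreover have "ln (1 / x) \<le> 1 / x" using ln_le_minus_one[of "1/x"] a by simp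
  moreover have "1 / x \<le> 1 / \<delta>" using a by (intro divide_left_mono) auto
  moreover have "ln (1 / x) = - ln x" using a by (simp add: ln_div)
  moreover have "0 \<le> 1 / \<delta>" "0 \<le> M" using a by auto
  ultimately show ?thesis using a(3) by linarith
qed

text \<open>A pointwise substitute for the lemma on the logarithmic derivative, valid on circles that stay away from
  the zeros. Here u is the reciprocal of the zero-free factor of F2; then K = u F changes at most by the
  factor exp 2 on discs of radius 1/d about points of the circle, and Cauchy's estimate bounds the
  derivatives of K. In Wronskians the common factor u cancels.\<close>

lemma log_derivative_estimate:
  fixes F2 :: "complex \<Rightarrow> complex"
  assumes F2: "F2 holomorphic_on UNIV" "F2 0 \<noteq> 0"
    and pos: "0 < r" "0 < \<eta>" "r + 2 * \<eta> \<le> R" "0 < \<delta>"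
    and sep2: "sep F2 \<delta> R" and N2: "real (zcount F2 R) \<le> N"
  obtains u where "u holomorphic_on ball 0 R" "\<And>z. u z \<noteq> 0"
    "\<And>F z l. \<lbrakk>F holomorphic_on UNIV; F 0 \<noteq> 0; sep F \<delta> r; sep F \<delta> R; real (zcount F R) \<le> N;
        cmean (\<lambda>z. \<bar>ln (norm (F z)) - ln (norm (F2 z))\<bar>) R \<le> B; norm z = r\<rbrakk>
      \<Longrightarrow> norm ((deriv ^^ l) (\<lambda>z. u z * F z) z) \<le> fact l * exp 2 *
        (N / \<delta> + 1 / \<eta> + 2 * R / \<eta>\<^sup>2 * (B + 2 * N * (1 / \<delta> + 2 * R))) ^ l * norm (u z * F z)"
proof -
  have R: "0 < R" "r < R" using pos by auto
  have ex: "\<exists>G R'. R < R' \<and> G holomorphic_on ball 0 R' \<and>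
    (\<forall>z\<in>ball 0 R'. F z = (\<Prod>a\<in>{z \<in> ball 0 R. F z = 0}. (z - a) ^ ord F a) * exp (G z))"
    if F: "F holomorphic_on UNIV" "F 0 \<noteq> 0" "sep F \<delta> R" for F
  proof -
    obtain G R' where "R < R'" "G holomorphic_on ball 0 R'"
      "\<And>z. z \<in> ball 0 R' \<Longrightarrow> F z = (\<Prod>a\<in>{z \<in> ball 0 R. F z = 0}. (z - a) ^ ord F a) * exp (G z)"
      using entire_factor_disc[OF F(1,2) R(1) sep_nonzero[OF F(3) pos(4)]] by blast
    then show ?thesis by blast
  qed
  define Z where "Z = (\<lambda>F::complex\<Rightarrow>complex. {z \<in> ball 0 R. F z = 0})"
  obtain G2 R2 where G2: "R < R2" "G2 holomorphic_on ball 0 R2"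
    "\<And>z. z \<in> ball 0 R2 \<Longrightarrow> F2 z = (\<Prod>a\<in>Z F2. (z - a) ^ ord F2 a) * exp (G2 z)"
    using ex[OF F2 sep2] unfolding Z_def by blast
  define u where "u = (\<lambda>z. exp (- G2 z))"
  have hu: "u holomorphic_on ball 0 R"
    unfolding u_def using G2 by (intro holomorphic_intros holomorphic_on_subset[OF G2(2)]) auto
  have lnF: "ln (norm (F z)) = (\<Sum>a\<in>Z F. real (ord F a) * ln (norm (z - a))) + Re (G z)"
    if "F z = (\<Prod>a\<in>Z F. (z - a) ^ ord F a) * exp (G z)" "F z \<noteq> 0" "finite (Z F)" for F G z
  proof -
    have ne: "z - a \<noteq> 0" if "a \<in> Z F" for a using that \<open>F z \<noteq> 0\<close> by (auto simp: Z_def)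
    have "norm (F z) = (\<Prod>a\<in>Z F. norm (z - a) ^ ord F a) * exp (Re (G z))"
      unfolding that(1) norm_mult prod_norm[symmetric] norm_power norm_exp_eq_Re ..
    moreover have "(\<Prod>a\<in>Z F. norm (z - a) ^ ord F a) > 0" using ne by (intro prod_pos) auto
    ultimately have "ln (norm (F z)) = ln (\<Prod>a\<in>Z F. norm (z - a) ^ ord F a) + Re (G z)"
      by (simp only: ln_mult_pos exp_gt_zero ln_exp)
    also have "ln (\<Prod>a\<in>Z F. norm (z - a) ^ ord F a) = (\<Sum>a\<in>Z F. ln (norm (z - a) ^ ord F a))"
      using ne by (intro ln_prod[OF that(3)]) auto
    also have "\<dots> = (\<Sum>a\<in>Z F. real (ord F a) * ln (norm (z - a)))"
      using ne by (intro sum.cong) (auto simp: ln_realpow)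
    finally show ?thesis .
  qed
  have finZ: "finite (Z F)" if "F holomorphic_on UNIV" "F 0 \<noteq> 0" for F
    unfolding Z_def by (rule finite_zeros_ball[OF that])
  have sumZ: "\<bar>\<Sum>a\<in>Z F. real (ord F a) * ln (norm (z - a))\<bar> \<le> N * (1 / \<delta> + 2 * R)"
    if "sep F \<delta> R" "norm z = R" "real (zcount F R) \<le> N" for F z
  proof -
    have "\<bar>\<Sum>a\<in>Z F. real (ord F a) * ln (norm (z - a))\<bar> \<le> (\<Sum>a\<in>Z F. \<bar>real (ord F a) * ln (norm (z - a))\<bar>)"
      by (rule sum_abs)
    also have "\<dots> \<le> (\<Sum>a\<in>Z F. real (ord F a) * (1 / \<delta> + 2 * R))"
    proof (rule sum_mono)
      fix a assume a: "a \<in> Z F"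
      have "\<bar>ln (norm (z - a))\<bar> \<le> 1 / \<delta> + 2 * R"
        using sep_dist[OF that(1) _ that(2), of a] a that(2) norm_triangle_ineq4[of z a] pos
        by (intro abs_ln_le) (auto simp: Z_def)
      then show "\<bar>real (ord F a) * ln (norm (z - a))\<bar> \<le> real (ord F a) * (1 / \<delta> + 2 * R)"
        by (simp add: abs_mult mult_left_mono)
    qed
    also have "\<dots> = real (zcount F R) * (1 / \<delta> + 2 * R)"
      by (simp add: zcount_def Z_def sum_distrib_right)
    also have "\<dots> \<le> N * (1 / \<delta> + 2 * R)"
      using that pos R by (intro mult_right_mono) auto
    finally show ?thesis .
  qed
  show thesis
  proof (rule that[OF hu])
    show "u z \<noteq> 0" for z by (simp add: u_def)
    fix F :: "complex \<Rightarrow> complex" and z :: complex and l :: nat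
    assume F: "F holomorphic_on UNIV" "F 0 \<noteq> 0" and s: "sep F \<delta> r" "sep F \<delta> R"
      and NF: "real (zcount F R) \<le> N"
      and B: "cmean (\<lambda>z. \<bar>ln (norm (F z)) - ln (norm (F2 z))\<bar>) R \<le> B" and z: "norm z = r"
    obtain G1 R1 where G1: "R < R1" "G1 holomorphic_on ball 0 R1"
      "\<And>z. z \<in> ball 0 R1 \<Longrightarrow> F z = (\<Prod>a\<in>Z F. (z - a) ^ ord F a) * exp (G1 z)"
      using ex[OF F s(2)] unfolding Z_def by blast
    define R3 where "R3 = min R1 R2"
    have R3: "R < R3" using G1 G2 by (simp add: R3_def)
    define G where "G = (\<lambda>z. G1 z - G2 z)"
    have hG: "G holomorphic_on ball 0 R3" unfolding G_def R3_def
      by (intro holomorphic_intros holomorphic_on_subset[OF G1(2)] holomorphic_on_subset[OF G2(2)]) auto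
    have N0: "0 \<le> N" using N2 by linarith
    \<comment> \<open>The factors carrying the zeros of \<open>F\<close> and those carrying the
      zeros of \<open>F2\<close> each cost \<open>N * (1 / \<delta> + 2 * R)\<close> by
      \<open>sumZ\<close>.\<close>
    define B1 where "B1 = B + 2 * N * (1 / \<delta> + 2 * R)"
    have "cmean (\<lambda>w. \<bar>Re (G w)\<bar>) R \<le> cmean (\<lambda>w. \<bar>ln (norm (F w)) - ln (norm (F2 w))\<bar> + 2 * N * (1 / \<delta> + 2 * R)) R"
    proof (rule cmean_mono)
      show "continuous_on (sphere 0 R) (\<lambda>w. \<bar>Re (G w)\<bar>)"
        using R3 by (intro continuous_intros continuous_on_subset[OF holomorphic_on_imp_continuous_on[OF hG]]) auto
      show "continuous_on (sphere 0 R) (\<lambda>w. \<bar>ln (norm (F w)) - ln (norm (F2 w))\<bar> + 2 * N * (1 / \<delta> + 2 * R))"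
        using sep_nonzero[OF s(2) pos(4)] sep_nonzero[OF sep2 pos(4)]
        by (intro continuous_intros continuous_on_ln_norm F F2) auto
      fix w :: complex assume w: "norm w = R"
      have "w \<in> ball 0 R1" "w \<in> ball 0 R2" using w G1 G2 by auto
      then have "ln (norm (F w)) = (\<Sum>a\<in>Z F. real (ord F a) * ln (norm (w - a))) + Re (G1 w)"
        "ln (norm (F2 w)) = (\<Sum>a\<in>Z F2. real (ord F2 a) * ln (norm (w - a))) + Re (G2 w)"
        using sep_nonzero[OF s(2) pos(4) w] sep_nonzero[OF sep2 pos(4) w]
        by (auto intro!: lnF finZ F F2 G1(3) G2(3))
      then show "\<bar>Re (G w)\<bar> \<le> \<bar>ln (norm (F w)) - ln (norm (F2 w))\<bar> + 2 * N * (1 / \<delta> + 2 * R)"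
        using sumZ[OF s(2) w NF] sumZ[OF sep2 w N2] by (simp add: G_def)
    qed (use R in auto)
    also have "\<dots> \<le> B1"
    proof -
      have "continuous_on (sphere 0 R) (\<lambda>w. \<bar>ln (norm (F w)) - ln (norm (F2 w))\<bar>)"
        using sep_nonzero[OF s(2) pos(4)] sep_nonzero[OF sep2 pos(4)]
        by (intro continuous_intros continuous_on_ln_norm F F2) auto
      then show ?thesis using B R by (subst cmean_add) (auto simp: B1_def)
    qed
    finally have cm: "cmean (\<lambda>w. \<bar>Re (G w)\<bar>) R \<le> B1" .
    have cm0: "0 \<le> cmean (\<lambda>w. \<bar>Re (G w)\<bar>) R"
      using R3 R unfolding cmean_def
      by (intro integral_nonneg integrable_continuous_real
          continuous_on_compose2[OF continuous_on_subset[OF holomorphic_on_imp_continuous_on[OF hG]] continuous_on_circlepath] continuous_intros) auto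
    define B2 where "B2 = 2 * R / \<eta>\<^sup>2 * B1"
    have B20: "0 \<le> B2" using cm cm0 R by (simp add: B2_def)
    have dG: "norm (deriv G w) \<le> B2" if "norm w \<le> r + \<eta>" for w
    proof -
      have "\<eta>\<^sup>2 \<le> (R - norm w)\<^sup>2" using that pos by (intro power_mono) auto
      then have "2 * R / (R - norm w)\<^sup>2 \<le> 2 * R / \<eta>\<^sup>2" 
        using pos R that by (intro divide_left_mono mult_pos_pos zero_less_power) auto
      then have "2 * R / (R - norm w)\<^sup>2 * cmean (\<lambda>w. \<bar>Re (G w)\<bar>) R \<le> B2"
        unfolding B2_def using cm cm0 R by (intro mult_mono) auto
      moreover have "norm w < R" using that pos by auto
      ultimately show ?thesis using deriv_bound_Re_cmean[OF hG R(1) R3, of w] by linarith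
    qed
    \<comment> \<open>For shifts of size at most \<open>1 / d\<close> each summand has one task:
      \<open>N / \<delta>\<close> keeps the zero factors of \<open>F\<close> within a factor
      \<open>exp 1\<close>, \<open>B2\<close> does the same for \<open>exp G\<close>, and
      \<open>1 / \<eta>\<close> keeps the point within radius \<open>r + \<eta>\<close>, where
      \<open>dG\<close> applies.\<close>
    define d where "d = N / \<delta> + 1 / \<eta> + B2"
    have dpos: "0 < d" "1 / \<eta> \<le> d" "N / \<delta> \<le> d" "B2 \<le> d"
      using pos N0 B20 by (auto simp: d_def add_pos_nonneg add_nonneg_pos intro!: add_nonneg_pos add_pos_nonneg)
    define K where "K = (\<lambda>z. u z * F z)"
    have rho: "1 / d \<le> \<eta>" using dpos pos by (simp add: field_simps)
    have inb: "norm (z + w) \<le> r + \<eta>" if "norm w \<le> 1 / d" for w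
      using norm_triangle_ineq[of z w] that rho z by linarith
    have Kb: "norm (K (z + w)) \<le> exp 2 * norm (K z)" if w: "norm w \<le> 1 / d" for w
    proof -
      have Keq: "K v = (\<Prod>a\<in>Z F. (v - a) ^ ord F a) * exp (G v)" if "norm v < R" for v
        using G1(3)[of v] G1(1) that by (simp add: K_def u_def G_def exp_diff exp_minus field_simps)
      have "norm (\<Prod>a\<in>Z F. (z + w - a) ^ ord F a) \<le> exp (real (\<Sum>a\<in>Z F. ord F a) * norm w / \<delta>) * norm (\<Prod>a\<in>Z F. (z - a) ^ ord F a)"
        using sep_dist[OF s(1) _ z] by (intro norm_prod_shift_le finZ F pos) (auto simp: Z_def)
      also have "\<dots> \<le> exp 1 * norm (\<Prod>a\<in>Z F. (z - a) ^ ord F a)"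
      proof -
        have "real (\<Sum>a\<in>Z F. ord F a) \<le> N" using NF by (simp add: zcount_def Z_def)
        then have "real (\<Sum>a\<in>Z F. ord F a) * norm w / \<delta> \<le> N * (1 / d) / \<delta>"
          using w pos N0 by (intro divide_right_mono mult_mono) auto
        also have "\<dots> \<le> 1" using dpos pos by (simp add: field_simps)
        finally show ?thesis by (intro mult_right_mono) auto
      qed
      finally have 1: "norm (\<Prod>a\<in>Z F. (z + w - a) ^ ord F a) \<le> exp 1 * norm (\<Prod>a\<in>Z F. (z - a) ^ ord F a)" .
      have "norm (G (z + w) - G z) \<le> B2 * norm (z + w - z)"
      proof (rule field_differentiable_bound[of "cball 0 (r + \<eta>)" G "deriv G"])
        fix v :: complex assume v: "v \<in> cball 0 (r + \<eta>)"
        then have "v \<in> ball 0 R3" using pos R3 by auto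
        then show "(G has_field_derivative deriv G v) (at v within cball 0 (r + \<eta>))"
          using hG holomorphic_derivI[OF hG open_ball] by blast
        show "norm (deriv G v) \<le> B2" using dG v by simp
      qed (use inb[OF w] z pos in auto)
      also have "\<dots> \<le> B2 * (1 / d)" using w B20 by (intro mult_left_mono) auto
      also have "\<dots> \<le> 1" using dpos by (simp add: field_simps)
      finally have "Re (G (z + w) - G z) \<le> 1" using complex_Re_le_cmod order_trans by blast
      then have 2: "norm (exp (G (z + w))) \<le> exp 1 * norm (exp (G z))"
        by (simp add: norm_exp_eq_Re exp_add[symmetric])
      have "norm (K (z + w)) = norm (\<Prod>a\<in>Z F. (z + w - a) ^ ord F a) * norm (exp (G (z + w)))"
        using Keq[of "z + w"] inb[OF w] pos by (simp add: norm_mult)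
      also have "\<dots> \<le> (exp 1 * norm (\<Prod>a\<in>Z F. (z - a) ^ ord F a)) * (exp 1 * norm (exp (G z)))"
        using 1 2 by (intro mult_mono) auto
      also have "\<dots> = (exp 1 * exp 1) * norm (K z)"
        using Keq[of z] z R by (simp add: norm_mult)
      also have "exp 1 * exp 1 = (exp 2 :: real)" by (simp add: exp_add[symmetric])
      finally show ?thesis .
    qed
    have hK: "K holomorphic_on ball 0 R" unfolding K_def
      by (intro holomorphic_intros hu holomorphic_on_subset[OF F(1)]) auto
    have subK: "cball z (1 / d) \<subseteq> ball 0 R"
    proof
      fix v assume "v \<in> cball z (1 / d)"
      then have "norm (v - z) \<le> 1 / d" by (simp add: dist_norm norm_minus_commute)
      from inb[OF this] show "v \<in> ball 0 R" using pos by simp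
    qed
    have "norm ((deriv ^^ l) K z) \<le> fact l * (exp 2 * norm (K z)) / (1 / d) ^ l"
    proof (rule Cauchy_inequality)
      show "K holomorphic_on ball z (1 / d)"
        using hK subK ball_subset_cball by (blast intro: holomorphic_on_subset)
      show "continuous_on (cball z (1 / d)) K"
        using holomorphic_on_imp_continuous_on[OF hK] subK continuous_on_subset by blast
      fix v assume "norm (z - v) = 1 / d"
      then show "norm (K v) \<le> exp 2 * norm (K z)"
        using Kb[of "v - z"] by (simp add: norm_minus_commute)
    qed (use dpos in auto)
    also have "\<dots> = fact l * exp 2 * d ^ l * norm (K z)"
      using dpos by (simp add: power_divide)
    finally show "norm ((deriv ^^ l) (\<lambda>z. u z * F z) z) \<le> fact l * exp 2 *
        (N / \<delta> + 1 / \<eta> + 2 * R / \<eta>\<^sup>2 * (B + 2 * N * (1 / \<delta> + 2 * R))) ^ l * norm (u z * F z)"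
      by (simp add: K_def d_def B2_def B1_def)
  qed
qed

section \<open>Wronskians\<close>

text \<open>Determinants with the size as an argument, because non-vanishing of Wronskians is proved by induction on it.\<close>

definition ndet :: "nat \<Rightarrow> (nat \<Rightarrow> nat \<Rightarrow> complex) \<Rightarrow> complex" where
  "ndet n A = Determinant.det (Matrix.mat n n (\<lambda>(i, j). A i j))"

lemma permutes_less_n: "p permutes {0..<n} \<Longrightarrow> i < n \<Longrightarrow> p i < n" for i n :: nat
  using permutes_in_image[of p "{0..<n}" i] by simp

lemma ndet_cong: "(\<And>i j. i < n \<Longrightarrow> j < n \<Longrightarrow> A i j = B i j) \<Longrightarrow> ndet n A = ndet n B"
  unfolding ndet_def by (rule arg_cong[where f = Determinant.det]) (rule eq_matI, auto)

lemma ndet_expand: "ndet n A = (\<Sum>p | p permutes {0..<n}. signof p * (\<Prod>i = 0..<n. A i (p i)))"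
proof -
  have "ndet n A = (\<Sum>p | p permutes {0..<n}. signof p * (\<Prod>i = 0..<n. Matrix.mat n n (\<lambda>(i, j). A i j) $$ (i, p i)))"
    unfolding ndet_def by (rule det_def'[of _ n]) simp
  also have "\<dots> = (\<Sum>p | p permutes {0..<n}. signof p * (\<Prod>i = 0..<n. A i (p i)))"
    by (intro sum.cong prod.cong arg_cong2[where f = "(*)"] refl)
      (auto simp: permutes_less_n)
  finally show ?thesis .
qed

lemma ndet_mult: "ndet n (\<lambda>i j. \<Sum>k<n. A i k * B k j) = ndet n A * ndet n B"
proof -
  have "Matrix.mat n n (\<lambda>(i, j). \<Sum>k<n. A i k * B k j) =
      Matrix.mat n n (\<lambda>(i, j). A i j) * Matrix.mat n n (\<lambda>(i, j). B i j)"
    by (rule eq_matI) (auto simp: scalar_prod_def atLeast0LessThan)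
  then show ?thesis unfolding ndet_def by (simp add: det_mult[of _ n])
qed

lemma ndet_lower:
  assumes "\<And>i j. i < j \<Longrightarrow> j < n \<Longrightarrow> A i j = 0"
  shows "ndet n A = (\<Prod>i<n. A i i)"
proof -
  have "ndet n A = prod_list (diag_mat (Matrix.mat n n (\<lambda>(i, j). A i j)))"
    unfolding ndet_def by (rule det_lower_triangular[where n = n]) (use assms in auto)
  also have "diag_mat (Matrix.mat n n (\<lambda>(i, j). A i j)) = map (\<lambda>i. A i i) [0..<n]"
    unfolding diag_mat_def by (rule map_cong) auto
  also have "prod_list \<dots> = (\<Prod>i<n. A i i)"
    by (simp add: prod.distinct_set_conv_list[symmetric] atLeast0LessThan)
  finally show ?thesis .
qed

lemma ndet_scale_cols: "ndet n (\<lambda>i j. c j * A i j) = (\<Prod>j<n. c j) * ndet n A"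
proof -
  have "ndet n (\<lambda>i j. c j * A i j) = (\<Sum>p | p permutes {0..<n}. signof p * (\<Prod>i = 0..<n. c (p i) * A i (p i)))"
    by (rule ndet_expand)
  also have "\<dots> = (\<Sum>p | p permutes {0..<n}. (\<Prod>j<n. c j) * (signof p * (\<Prod>i = 0..<n. A i (p i))))"
  proof (rule sum.cong[OF refl])
    fix p assume "p \<in> {p. p permutes {0..<n}}"
    then have "(\<Prod>i = 0..<n. c (p i)) = (\<Prod>j<n. c j)"
      using prod.permute[of p "{0..<n}" c] by (simp add: o_def atLeast0LessThan)
    then show "signof p * (\<Prod>i = 0..<n. c (p i) * A i (p i)) = (\<Prod>j<n. c j) * (signof p * (\<Prod>i = 0..<n. A i (p i)))"
      by (simp add: prod.distrib)
  qed
  also have "\<dots> = (\<Prod>j<n. c j) * ndet n A"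
    by (simp add: ndet_expand sum_distrib_left)
  finally show ?thesis .
qed

lemma norm_ndet_le:
  assumes "\<And>i j. i < n \<Longrightarrow> j < n \<Longrightarrow> norm (A i j) \<le> b j"
  shows "norm (ndet n A) \<le> fact n * (\<Prod>j<n. b j)"
proof -
  have "norm (ndet n A) \<le> (\<Sum>p | p permutes {0..<n}. norm (signof p * (\<Prod>i = 0..<n. A i (p i))))"
    unfolding ndet_expand by (rule norm_sum)
  also have "\<dots> \<le> (\<Sum>p | p permutes {0..<n}. (\<Prod>j<n. b j))"
  proof (rule sum_mono)
    fix p assume "p \<in> {p. p permutes {0..<n}}"
    then have p: "p permutes {0..<n}" by simp
    have "norm (signof p * (\<Prod>i = 0..<n. A i (p i))) = (\<Prod>i = 0..<n. norm (A i (p i)))"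
      by (simp add: norm_mult prod_norm[symmetric] sign_def)
    also have "\<dots> \<le> (\<Prod>i = 0..<n. b (p i))"
      by (intro prod_mono) (use assms p permutes_less_n in auto)
    also have "\<dots> = (\<Prod>j<n. b j)"
      using prod.permute[OF p, of b] by (simp add: o_def atLeast0LessThan)
    finally show "norm (signof p * (\<Prod>i = 0..<n. A i (p i))) \<le> (\<Prod>j<n. b j)" .
  qed
  also have "\<dots> = fact n * (\<Prod>j<n. b j)"
    by (simp add: card_permutations[of "{0..<n}" n])
  finally show ?thesis .
qed

lemma ndet_zero_iff:
  "ndet n A = 0 \<longleftrightarrow> (\<exists>v. (\<exists>j<n. v j \<noteq> 0) \<and> (\<forall>i<n. (\<Sum>j<n. A i j * v j) = 0))"
proof -
  let ?A = "Matrix.mat n n (\<lambda>(i, j). A i j)"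
  have "ndet n A = 0 \<longleftrightarrow> (\<exists>v. v \<in> carrier_vec n \<and> v \<noteq> 0\<^sub>v n \<and> ?A *\<^sub>v v = 0\<^sub>v n)"
    unfolding ndet_def by (rule det_0_iff_vec_prod_zero_field) simp
  also have "\<dots> \<longleftrightarrow> (\<exists>v. (\<exists>j<n. v j \<noteq> 0) \<and> (\<forall>i<n. (\<Sum>j<n. A i j * v j) = 0))"
  proof safe
    fix v :: "complex Matrix.vec"
    assume v: "v \<in> carrier_vec n" "v \<noteq> 0\<^sub>v n" "?A *\<^sub>v v = 0\<^sub>v n"
    have "\<exists>j<n. vec_index v j \<noteq> 0"
    proof (rule ccontr)
      assume "\<not> ?thesis"
      then have "v = 0\<^sub>v n" using v(1) by (intro eq_vecI) auto
      with v(2) show False by simp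
    qed
    moreover have "(\<Sum>j<n. A i j * vec_index v j) = 0" if "i < n" for i
    proof -
      have "vec_index (?A *\<^sub>v v) i = (\<Sum>j<n. A i j * vec_index v j)"
        using that v(1) by (auto simp: scalar_prod_def atLeast0LessThan)
      then show ?thesis using v(3) that by simp
    qed
    ultimately show "\<exists>v. (\<exists>j<n. v j \<noteq> 0) \<and> (\<forall>i<n. (\<Sum>j<n. A i j * v j) = 0)" by blast
  next
    fix v :: "nat \<Rightarrow> complex" and j
    assume v: "\<forall>i<n. (\<Sum>j<n. A i j * v j) = 0" and j: "j < n" "v j \<noteq> 0"
    let ?v = "Matrix.vec n v"
    have "vec_index ?v j \<noteq> vec_index (0\<^sub>v n) j" using j by simp
    then have "?v \<noteq> 0\<^sub>v n" by metis
    moreover have "?A *\<^sub>v ?v = 0\<^sub>v n"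
      by (rule eq_vecI) (use v in \<open>auto simp: scalar_prod_def atLeast0LessThan\<close>)
    ultimately show "\<exists>v. v \<in> carrier_vec n \<and> v \<noteq> 0\<^sub>v n \<and> ?A *\<^sub>v v = 0\<^sub>v n" by (intro exI[of _ ?v]) auto
  qed
  finally show ?thesis .
qed

lemma ndet_transpose: "ndet n (\<lambda>i j. A j i) = ndet n A"
proof -
  have "Matrix.mat n n (\<lambda>(i, j). A j i) = transpose_mat (Matrix.mat n n (\<lambda>(i, j). A i j))"
    by (rule eq_matI) auto
  then show ?thesis unfolding ndet_def by (simp add: Determinant.det_transpose[of _ n])
qed

lemma ndet_left_inverse:
  assumes "ndet n A \<noteq> 0"
  obtains B where "\<And>i j. i < n \<Longrightarrow> j < n \<Longrightarrow> (\<Sum>k<n. B i k * A k j) = (if i = j then 1 else 0)"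
proof -
  let ?A = "Matrix.mat n n (\<lambda>(i, j). A i j)"
  have "?A \<in> Units (ring_mat TYPE(complex) n ())"
    by (rule det_non_zero_imp_unit) (use assms in \<open>auto simp: ndet_def\<close>)
  then obtain M where M: "M \<in> carrier_mat n n" "M * ?A = 1\<^sub>m n"
    by (auto simp: Units_def ring_mat_def)
  have "(\<Sum>k<n. M $$ (i, k) * A k j) = (if i = j then 1 else 0)" if "i < n" "j < n" for i j
  proof -
    have "(M * ?A) $$ (i, j) = (\<Sum>k<n. M $$ (i, k) * A k j)"
      using that M(1) by (auto simp: scalar_prod_def atLeast0LessThan)
    then show ?thesis using M(2) that by simp
  qed
  then show ?thesis using that[of "\<lambda>i k. M $$ (i, k)"] by blast
qed

lemma ndet_first_col:
  assumes "\<And>i. 0 < i \<Longrightarrow> i \<le> n \<Longrightarrow> A i 0 = 0"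
  shows "ndet (Suc n) A = A 0 0 * ndet n (\<lambda>i j. A (Suc i) (Suc j))"
proof -
  let ?A = "Matrix.mat (Suc n) (Suc n) (\<lambda>(i, j). A i j)"
  have "ndet (Suc n) A = (\<Sum>i<Suc n. ?A $$ (i, 0) * cofactor ?A i 0)"
    unfolding ndet_def by (rule laplace_expansion_column) auto
  also have "\<dots> = ?A $$ (0, 0) * cofactor ?A 0 0"
    by (subst sum.lessThan_Suc_shift) (use assms in auto)
  also have "cofactor ?A 0 0 = ndet n (\<lambda>i j. A (Suc i) (Suc j))"
    unfolding cofactor_def ndet_def mat_delete_def
    by (simp, rule arg_cong[where f = Determinant.det], rule eq_matI, auto)
  finally show ?thesis by simp
qed

text \<open>Cofactors along the last column do not see that column, so \<open>C\<close> is fixed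
  before the column is chosen. This is what \<open>independent_points\<close> needs when it looks
  for one more point.\<close>

lemma ndet_last_col:
  obtains C where "C n = ndet n A"
    "\<And>A'. (\<And>i j. j < n \<Longrightarrow> A' i j = A i j) \<Longrightarrow> ndet (Suc n) A' = (\<Sum>i<Suc n. A' i n * C i)"
proof -
  let ?M = "\<lambda>A. Matrix.mat (Suc n) (Suc n) (\<lambda>(i, j). A i j)"
  have del: "mat_delete (?M A') i n = mat_delete (?M A) i n" if "\<And>i j. j < n \<Longrightarrow> A' i j = A i j" for A' i
    unfolding mat_delete_def by (rule eq_matI) (use that in auto)
  have "cofactor (?M A) n n = ndet n A"
    unfolding cofactor_def ndet_def mat_delete_def
    by (simp, rule arg_cong[where f = Determinant.det], rule eq_matI, auto)
  moreover have "ndet (Suc n) A' = (\<Sum>i<Suc n. A' i n * cofactor (?M A) i n)"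
    if "\<And>i j. j < n \<Longrightarrow> A' i j = A i j" for A'
  proof -
    have "ndet (Suc n) A' = (\<Sum>i<Suc n. ?M A' $$ (i, n) * cofactor (?M A') i n)"
      unfolding ndet_def by (rule laplace_expansion_column) auto
    also have "\<dots> = (\<Sum>i<Suc n. A' i n * cofactor (?M A) i n)"
      by (intro sum.cong) (use del[OF that] in \<open>auto simp: cofactor_def\<close>)
    finally show ?thesis .
  qed
  ultimately show ?thesis using that[of "\<lambda>i. cofactor (?M A) i n"] by blast
qed

section \<open>Wronskians: change of functions, vanishing order, linear dependence\<close>

lemma higher_deriv_sum:
  assumes "finite I" "\<And>i. i \<in> I \<Longrightarrow> f i holomorphic_on S" "open S" "z \<in> S"
  shows "(deriv ^^ l) (\<lambda>w. \<Sum>i\<in>I. c i * f i w) z = (\<Sum>i\<in>I. c i * (deriv ^^ l) (f i) z)"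
  using assms(1,2)
proof (induction I)
  case empty
  have "(deriv ^^ l) (\<lambda>w. 0 :: complex) = (\<lambda>w. 0)" by (induction l) auto
  then show ?case by simp
next
  case (insert a I)
  have "(deriv ^^ l) (\<lambda>w. c a * f a w + (\<Sum>i\<in>I. c i * f i w)) z =
     (deriv ^^ l) (\<lambda>w. c a * f a w) z + (deriv ^^ l) (\<lambda>w. \<Sum>i\<in>I. c i * f i w) z"
    by (rule higher_deriv_add[OF _ _ assms(3,4)]) (use insert in \<open>auto intro!: holomorphic_intros\<close>)
  then show ?case using insert higher_deriv_cmult[OF _ assms(4,3), of "f a" l "c a"] by simp
qed

definition wron :: "nat \<Rightarrow> (nat \<Rightarrow> complex \<Rightarrow> complex) \<Rightarrow> complex \<Rightarrow> complex" where
  "wron n F z = ndet n (\<lambda>l j. (deriv ^^ l) (F j) z)"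

lemma wron_holomorphic:
  assumes "\<And>j. j < n \<Longrightarrow> F j holomorphic_on S" "open S"
  shows "wron n F holomorphic_on S"
proof -
  have "wron n F = (\<lambda>z. \<Sum>p | p permutes {0..<n}. signof p * (\<Prod>i = 0..<n. (deriv ^^ i) (F (p i)) z))"
    by (simp add: wron_def ndet_expand fun_eq_iff)
  then show ?thesis using assms permutes_less_n
    by (auto intro!: holomorphic_intros holomorphic_higher_deriv)
qed

text \<open>By Leibniz' rule the new matrix of derivatives is \<open>L\<close> times the old one,
  where \<open>L\<close> is lower triangular with \<open>u z\<close> on the diagonal.\<close>

lemma wron_mult:
  assumes "u holomorphic_on S" "\<And>j. j < n \<Longrightarrow> F j holomorphic_on S" "open S" "z \<in> S"
  shows "wron n (\<lambda>j z. u z * F j z) z = u z ^ n * wron n F z"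
proof -
  define L where "L = (\<lambda>l i. if i \<le> l then of_nat (l choose i) * (deriv ^^ (l - i)) u z else 0)"
  have "(deriv ^^ l) (\<lambda>z. u z * F j z) z = (\<Sum>i<n. L l i * (deriv ^^ i) (F j) z)" if "l < n" "j < n" for l j
  proof -
    have "(deriv ^^ l) (\<lambda>z. F j z * u z) z =
       (\<Sum>i = 0..l. of_nat (l choose i) * (deriv ^^ i) (F j) z * (deriv ^^ (l - i)) u z)"
      using assms that by (intro higher_deriv_mult) auto
    also have "\<dots> = (\<Sum>i = 0..l. L l i * (deriv ^^ i) (F j) z)"
      by (intro sum.cong) (auto simp: L_def)
    also have "\<dots> = (\<Sum>i<n. L l i * (deriv ^^ i) (F j) z)"
      using that by (intro sum.mono_neutral_left) (auto simp: L_def)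
    finally show ?thesis by (simp add: mult.commute)
  qed
  then have "wron n (\<lambda>j z. u z * F j z) z = ndet n (\<lambda>l j. \<Sum>i<n. L l i * (deriv ^^ i) (F j) z)"
    unfolding wron_def by (intro ndet_cong)
  also have "\<dots> = ndet n L * wron n F z" by (simp add: ndet_mult wron_def)
  also have "ndet n L = (\<Prod>i<n. L i i)" by (rule ndet_lower) (simp add: L_def)
  also have "\<dots> = u z ^ n" by (simp add: L_def)
  finally show ?thesis .
qed

lemma wron_linear:
  assumes "\<And>i. i < n \<Longrightarrow> f i holomorphic_on S" "open S" "z \<in> S"
  shows "wron n (\<lambda>j z. \<Sum>i<n. M i j * f i z) z = wron n f z * ndet n M"
proof -
  have "wron n (\<lambda>j z. \<Sum>i<n. M i j * f i z) z = ndet n (\<lambda>l j. \<Sum>i<n. (deriv ^^ l) (f i) z * M i j)"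
    unfolding wron_def
    by (intro ndet_cong) (subst higher_deriv_sum[OF _ _ assms(2,3)], use assms in \<open>auto simp: mult.commute\<close>)
  then show ?thesis by (simp add: ndet_mult wron_def)
qed

lemma higher_deriv_power_factor:
  assumes "H holomorphic_on UNIV"
  shows "\<exists>K. K holomorphic_on UNIV \<and> (\<forall>z. (deriv ^^ l) (\<lambda>z. (z - a) ^ p * H z) z = (z - a) ^ (p - l) * K z)"
proof (induction l)
  case 0
  then show ?case using assms by auto
next
  case (Suc l)
  then obtain K where K: "K holomorphic_on UNIV"
    "\<And>z. (deriv ^^ l) (\<lambda>z. (z - a) ^ p * H z) z = (z - a) ^ (p - l) * K z" by blast
  define m where "m = p - l"
  have dK: "(K has_field_derivative deriv K z) (at z)" for z
    using K(1) holomorphic_derivI open_UNIV by blast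
  have "(deriv ^^ Suc l) (\<lambda>z. (z - a) ^ p * H z) z = deriv (\<lambda>z. (z - a) ^ m * K z) z" for z
  proof -
    have "(deriv ^^ l) (\<lambda>z. (z - a) ^ p * H z) = (\<lambda>z. (z - a) ^ m * K z)"
      using K(2) by (simp add: m_def fun_eq_iff)
    then show ?thesis by simp
  qed
  also have "deriv (\<lambda>z. (z - a) ^ m * K z) z = of_nat m * (z - a) ^ (m - 1) * K z + (z - a) ^ m * deriv K z" for z
    by (rule DERIV_imp_deriv) (auto intro!: derivative_eq_intros dK simp: algebra_simps)
  also have "\<dots> z = (z - a) ^ (m - 1) * (of_nat m * K z + (if m = 0 then 1 else (z - a)) * deriv K z)" for z
    by (cases m) (auto simp: algebra_simps)
  finally have "(deriv ^^ Suc l) (\<lambda>z. (z - a) ^ p * H z) z =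
    (z - a) ^ (p - Suc l) * (of_nat m * K z + (if m = 0 then 1 else (z - a)) * deriv K z)" for z
    by (simp add: m_def)
  moreover have "(\<lambda>z. of_nat m * K z + (if m = 0 then 1 else (z - a)) * deriv K z) holomorphic_on UNIV"
    using K(1) by (cases "m = 0") (auto intro!: holomorphic_intros holomorphic_deriv)
  ultimately show ?case by blast
qed

text \<open>Column \<open>j\<close> contains derivatives of order at most \<open>n - 1\<close>, so
  it is divisible by \<open>(z - a) ^ (ord (F j) a - (n - 1))\<close>. Truncated subtraction makes
  this factor trivial when the order is small.\<close>

lemma wron_vanishing:
  assumes F: "\<And>j. j < n \<Longrightarrow> F j holomorphic_on UNIV" "\<And>j. j < n \<Longrightarrow> F j (b j) \<noteq> 0"
  shows "\<exists>Q. Q holomorphic_on UNIV \<and> (\<forall>z. wron n F z = (z - a) ^ (\<Sum>j<n. ord (F j) a - (n - 1)) * Q z)"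
proof -
  have "\<exists>K. K holomorphic_on UNIV \<and> (\<forall>z. (deriv ^^ l) (F j) z = (z - a) ^ (ord (F j) a - (n - 1)) * K z)"
    if lj: "l < n" "j < n" for l j
  proof -
    obtain H where H: "H holomorphic_on UNIV" "\<And>z. F j z = (z - a) ^ ord (F j) a * H z"
      using entire_factor_ord[OF F(1)[OF lj(2)] F(2)[OF lj(2)]] by blast
    then have Fj: "F j = (\<lambda>z. (z - a) ^ ord (F j) a * H z)" by blast
    obtain K where K: "K holomorphic_on UNIV"
      "\<And>z. (deriv ^^ l) (\<lambda>z. (z - a) ^ ord (F j) a * H z) z = (z - a) ^ (ord (F j) a - l) * K z"
      using higher_deriv_power_factor[OF H(1)] by blast
    have "ord (F j) a - l = (ord (F j) a - (n - 1)) + ((ord (F j) a - l) - (ord (F j) a - (n - 1)))"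
      using lj by linarith
    then have "(z - a) ^ (ord (F j) a - l) = (z - a) ^ (ord (F j) a - (n - 1)) *
        (z - a) ^ ((ord (F j) a - l) - (ord (F j) a - (n - 1)))" for z
      by (metis power_add)
    moreover have "(deriv ^^ l) (F j) z = (z - a) ^ (ord (F j) a - l) * K z" for z
      by (subst Fj) (rule K(2))
    ultimately have "(deriv ^^ l) (F j) z = (z - a) ^ (ord (F j) a - (n - 1)) *
        ((z - a) ^ ((ord (F j) a - l) - (ord (F j) a - (n - 1))) * K z)" for z
      by (simp add: mult.assoc)
    then show ?thesis
      by (intro exI[of _ "\<lambda>z. (z - a) ^ ((ord (F j) a - l) - (ord (F j) a - (n - 1))) * K z"])
        (auto intro!: holomorphic_intros K)
  qed
  then obtain K where K: "\<And>l j. l < n \<Longrightarrow> j < n \<Longrightarrow> K l j holomorphic_on UNIV"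
    "\<And>l j z. l < n \<Longrightarrow> j < n \<Longrightarrow> (deriv ^^ l) (F j) z = (z - a) ^ (ord (F j) a - (n - 1)) * K l j z"
    by metis
  have "wron n F z = (z - a) ^ (\<Sum>j<n. ord (F j) a - (n - 1)) * ndet n (\<lambda>l j. K l j z)" for z
  proof -
    have "wron n F z = ndet n (\<lambda>l j. (z - a) ^ (ord (F j) a - (n - 1)) * K l j z)"
      unfolding wron_def by (intro ndet_cong K(2))
    then show ?thesis by (simp add: ndet_scale_cols power_sum)
  qed
  moreover have "(\<lambda>z. ndet n (\<lambda>l j. K l j z)) holomorphic_on UNIV"
    unfolding ndet_expand using K(1) permutes_less_n by (auto intro!: holomorphic_intros)
  ultimately show ?thesis by blast
qed

text \<open>Division by \<open>F 0\<close> reduces the Wronskian to that of the derivatives of the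
  quotients \<open>F j / F 0\<close>; a relation between these derivatives integrates to one between
  the quotients up to a constant. The conclusion is local because each step shrinks the open set to
  a ball on which the divisor has no zero.\<close>

lemma wron_zero_imp_dependent:
  assumes "\<And>j. j < n \<Longrightarrow> F j holomorphic_on S" "open S" "S \<noteq> {}" "\<And>z. z \<in> S \<Longrightarrow> wron n F z = 0"
  shows "\<exists>c T. open T \<and> T \<noteq> {} \<and> T \<subseteq> S \<and> (\<exists>j<n. c j \<noteq> 0) \<and> (\<forall>z\<in>T. (\<Sum>j<n. c j * F j z) = 0)"
  using assms
proof (induction n arbitrary: F S)
  case 0
  then have "wron 0 F z = 1" for z by (simp add: wron_def ndet_expand)
  then show ?case using 0 by auto
next
  case (Suc n)
  show ?case
  proof (cases "\<forall>z\<in>S. F 0 z = 0")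
    case True
    define c :: "nat \<Rightarrow> complex" where "c = (\<lambda>j. if j = 0 then 1 else 0)"
    have "(\<Sum>j<Suc n. c j * F j z) = F 0 z" for z
      by (subst sum.lessThan_Suc_shift) (simp add: c_def)
    then show ?thesis using True Suc.prems by (intro exI[of _ c] exI[of _ S]) (auto simp: c_def)
  next
    case False
    then obtain z0 where z0: "z0 \<in> S" "F 0 z0 \<noteq> 0" by blast
    have "continuous_on S (F 0)" using Suc.prems(1)[of 0] holomorphic_on_imp_continuous_on by auto
    then have "open (S \<inter> F 0 -` (- {0}))"
      using continuous_open_preimage Suc.prems(2) by blast
    then obtain e where e: "0 < e" "ball z0 e \<subseteq> S \<inter> F 0 -` (- {0})"
      using z0 unfolding open_contains_ball by (metis (no_types, lifting) ComplI IntI singletonD vimageI)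
    let ?B = "ball z0 e"
    have hF: "F j holomorphic_on ?B" if "j < Suc n" for j
      using Suc.prems(1)[OF that] e(2) by (blast intro: holomorphic_on_subset)
    have nz: "F 0 z \<noteq> 0" if "z \<in> ?B" for z using e(2) that by auto
    define u where "u = (\<lambda>z. inverse (F 0 z))"
    have hu: "u holomorphic_on ?B" unfolding u_def using hF[of 0] nz by (intro holomorphic_intros) auto
    define h where "h = (\<lambda>j z. u z * F j z)"
    have hh: "h j holomorphic_on ?B" if "j < Suc n" for j
      unfolding h_def by (intro holomorphic_intros hu hF that)
    have w0: "wron (Suc n) h z = 0" if "z \<in> ?B" for z
      using wron_mult[OF hu hF open_ball that] Suc.prems(4)[of z] e(2) that by (auto simp: h_def)
    have h0: "(deriv ^^ l) (h 0) z = (if l = 0 then 1 else 0)" if "z \<in> ?B" for l z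
    proof -
      have "(deriv ^^ l) (h 0) z = (deriv ^^ l) (\<lambda>z. 1) z"
        by (rule higher_deriv_cong_ev) (use eventually_nhds_in_open[OF open_ball that] in \<open>auto elim!: eventually_mono simp: h_def u_def nz\<close>)
      also have "\<dots> = (if l = 0 then 1 else 0)" by (simp add: higher_deriv_const)
      finally show ?thesis .
    qed
    have w1: "wron n (\<lambda>j. deriv (h (Suc j))) z = 0" if "z \<in> ?B" for z
    proof -
      have "wron (Suc n) h z = (deriv ^^ 0) (h 0) z * ndet n (\<lambda>i j. (deriv ^^ Suc i) (h (Suc j)) z)"
        unfolding wron_def by (rule ndet_first_col) (use h0[OF that] in auto)
      then show ?thesis using w0[OF that] h0[OF that, of 0]
        by (simp add: wron_def funpow_Suc_right del: funpow.simps(2))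
    qed
    obtain c T where T: "open T" "T \<noteq> {}" "T \<subseteq> ?B" "\<exists>j<n. c j \<noteq> 0"
      "\<forall>z\<in>T. (\<Sum>j<n. c j * deriv (h (Suc j)) z) = 0"
    proof -
      have "deriv (h (Suc j)) holomorphic_on ?B" if "j < n" for j
        using that by (intro holomorphic_deriv hh) auto
      from Suc.IH[OF this open_ball _ w1] e(1) show ?thesis using that by auto
    qed
    obtain z1 e1 where e1: "0 < e1" "ball z1 e1 \<subseteq> T" using T(1,2) by (meson all_not_in_conv open_contains_ball)
    define g where "g = (\<lambda>z. \<Sum>j<n. c j * h (Suc j) z)"
    have "(g has_field_derivative 0) (at z)" if "z \<in> ball z1 e1" for z
    proof -
      have zB: "z \<in> ?B" using that e1 T(3) by blast
      have "(g has_field_derivative (\<Sum>j<n. c j * deriv (h (Suc j)) z)) (at z)"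
      proof -
        have "(h (Suc j) has_field_derivative deriv (h (Suc j)) z) (at z)" if "j < n" for j
          using that zB by (intro holomorphic_derivI[OF hh open_ball]) auto
        then show ?thesis unfolding g_def by (intro DERIV_sum DERIV_cmult) auto
      qed
      then show ?thesis using T(5) e1(2) that by (metis subsetD)
    qed
    then have "g constant_on ball z1 e1"
      by (intro has_field_derivative_0_imp_constant_on) auto
    then obtain k where k: "\<And>z. z \<in> ball z1 e1 \<Longrightarrow> g z = k" by (auto simp: constant_on_def)
    \<comment> \<open>The constant of integration becomes the coefficient of \<open>F 0\<close>
      after multiplying back.\<close>
    define c' where "c' = (\<lambda>j. case j of 0 \<Rightarrow> - k | Suc i \<Rightarrow> c i)"
    have "(\<Sum>j<Suc n. c' j * F j z) = 0" if "z \<in> ball z1 e1" for z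
    proof -
      have zB: "z \<in> ?B" using that e1 T(3) by blast
      have "(\<Sum>j<n. c j * F (Suc j) z) = F 0 z * g z"
        using nz[OF zB] by (simp add: g_def h_def u_def sum_distrib_left field_simps)
      then show ?thesis using k[OF that]
        by (subst sum.lessThan_Suc_shift) (simp add: c'_def)
    qed
    moreover have "\<exists>j<Suc n. c' j \<noteq> 0"
    proof -
      obtain j where "j < n" "c j \<noteq> 0" using T(4) by blast
      then show ?thesis by (intro exI[of _ "Suc j"]) (simp add: c'_def)
    qed
    moreover have "ball z1 e1 \<subseteq> S" using e1 T(3) e(2) by blast
    ultimately show ?thesis using e1(1)
      by (intro exI[of _ c'] exI[of _ "ball z1 e1"]) auto
  qed
qed

lemma wron_nonzero:
  assumes F: "\<And>j. j < n \<Longrightarrow> F j holomorphic_on UNIV"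
    and ind: "\<And>c. (\<And>z. (\<Sum>j<n. c j * F j z) = 0) \<Longrightarrow> \<forall>j<n. c j = 0"
  shows "\<exists>z. wron n F z \<noteq> 0"
proof (rule ccontr)
  assume "\<not> ?thesis"
  then obtain c T where T: "open T" "T \<noteq> {}" "\<exists>j<n. c j \<noteq> 0" "\<forall>z\<in>T. (\<Sum>j<n. c j * F j z) = 0"
    using wron_zero_imp_dependent[of n F UNIV] F by auto
  obtain z0 where z0: "z0 \<in> T" using T(2) by blast
  have hol: "(\<lambda>z. \<Sum>j<n. c j * F j z) holomorphic_on UNIV" by (intro holomorphic_intros F) auto
  have "(\<Sum>j<n. c j * F j z) = 0" for z
    by (rule analytic_continuation_open[of T UNIV "\<lambda>z. \<Sum>j<n. c j * F j z" "\<lambda>z. 0"])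
      (use T hol z0 in auto)
  then show False using ind[of c] T(3) by blast
qed

section \<open>Cartan's second main theorem\<close>

definition lf :: "nat \<Rightarrow> (nat \<Rightarrow> 'a \<Rightarrow> complex) \<Rightarrow> (nat \<Rightarrow> complex) \<Rightarrow> 'a \<Rightarrow> complex" where
  "lf n f a z = (\<Sum>i\<le>n. a i * f i z)"

text \<open>Cartan's characteristic function, taken with the sum norm and without subtracting the
  value at the origin, so that it can be negative.\<close>

definition Tchar :: "nat \<Rightarrow> (nat \<Rightarrow> complex \<Rightarrow> complex) \<Rightarrow> real \<Rightarrow> real" where
  "Tchar n f r = cmean (\<lambda>z. ln (\<Sum>i\<le>n. norm (f i z))) r"

lemma lf_holomorphic:
  "(\<And>i. i \<le> n \<Longrightarrow> f i holomorphic_on UNIV) \<Longrightarrow> lf n f b holomorphic_on UNIV"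
  unfolding lf_def by (intro holomorphic_intros) auto

section \<open>Linear algebra of hyperplanes in general position\<close>

lemma enumerate_finite_set:
  assumes "finite J" "card J = m"
  obtains e where "bij_betw e {..<m} J"
  using ex_bij_betw_nat_finite[OF assms(1)] assms(2) by (auto simp: atLeast0LessThan)

lemma general_position_ndet:
  assumes gp: "general_position n q a" and J: "J \<subseteq> {1..q}" and e: "bij_betw e {..<Suc n} J"
  shows "ndet (Suc n) (\<lambda>i k. a (e k) i) \<noteq> 0"
proof
  assume "ndet (Suc n) (\<lambda>i k. a (e k) i) = 0"
  then obtain v where v: "\<exists>j<Suc n. v j \<noteq> 0" "\<forall>i<Suc n. (\<Sum>k<Suc n. a (e k) i * v k) = 0"
    unfolding ndet_zero_iff by blast
  define c where "c = (\<lambda>j. v (inv_into {..<Suc n} e j))"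
  have inv: "inv_into {..<Suc n} e (e k) = k" if "k < Suc n" for k
    using bij_betw_inv_into_left[OF e] that by auto
  have "(\<Sum>j\<in>J. c j * a j i) = 0" if "i \<le> n" for i
  proof -
    have "(\<Sum>j\<in>J. c j * a j i) = (\<Sum>k<Suc n. c (e k) * a (e k) i)"
      by (rule sum.reindex_bij_betw[OF e, symmetric])
    also have "\<dots> = (\<Sum>k<Suc n. a (e k) i * v k)"
      by (intro sum.cong) (auto simp: c_def inv)
    finally show ?thesis using v(2) that by simp
  qed
  moreover have "card J = n + 1" using bij_betw_same_card[OF e] by simp
  ultimately have c0: "\<forall>j\<in>J. c j = 0" using gp J unfolding general_position_def by blast
  obtain k where k: "k < Suc n" "v k \<noteq> 0" using v(1) by blast
  have "e k \<in> J" using e k(1) by (auto simp: bij_betw_def)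
  then show False using c0 k inv[OF k(1)] by (auto simp: c_def)
qed

lemma general_position_nonzero:
  assumes gp: "general_position n q a" and q: "n < q" and j: "j \<in> {1..q}"
  shows "\<exists>i\<le>n. a j i \<noteq> 0"
proof (rule ccontr)
  assume c: "\<not> ?thesis"
  have "n \<le> card ({1..q} - {j})" using q j by simp
  then obtain E where E: "E \<subseteq> {1..q} - {j}" "card E = n" "finite E" using obtain_subset_with_card_n by blast
  have card: "card (insert j E) = n + 1" using E by (subst card_insert_disjoint) auto
  have sub: "insert j E \<subseteq> {1..q}" using E j by blast
  have "(\<Sum>l\<in>insert j E. (if l = j then 1 else 0) * a l i) = 0" if "i \<le> n" for i
    using c that E by (intro sum.neutral) auto
  from gp[unfolded general_position_def, rule_format, of "insert j E" "\<lambda>l. if l = j then 1 else 0" j, OF _ this]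
  show False using card sub by simp
qed

lemma general_position_inverse:
  assumes gp: "general_position n q a" and J: "J \<subseteq> {1..q}" "card J = Suc n"
  obtains B where "\<And>w i. i \<le> n \<Longrightarrow> w i = (\<Sum>j\<in>J. B i j * (\<Sum>k\<le>n. a j k * w k))"
proof -
  have "finite J" using J(1) finite_subset by blast
  then obtain e where e: "bij_betw e {..<Suc n} J" using enumerate_finite_set J(2) by blast
  have "ndet (Suc n) (\<lambda>k i. a (e k) i) \<noteq> 0"
    using general_position_ndet[OF gp J(1) e] ndet_transpose[of "Suc n" "\<lambda>i k. a (e k) i"] by simp
  then obtain B where B: "\<And>i j. i < Suc n \<Longrightarrow> j < Suc n \<Longrightarrow> (\<Sum>k<Suc n. B i k * a (e k) j) = (if i = j then 1 else 0)"
    using ndet_left_inverse by blast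
  have "w i = (\<Sum>j\<in>J. B i (inv_into {..<Suc n} e j) * (\<Sum>k\<le>n. a j k * w k))" if i: "i \<le> n" for w i
  proof -
    have "(\<Sum>j\<in>J. B i (inv_into {..<Suc n} e j) * (\<Sum>k\<le>n. a j k * w k)) =
      (\<Sum>l<Suc n. B i (inv_into {..<Suc n} e (e l)) * (\<Sum>k\<le>n. a (e l) k * w k))"
      by (rule sum.reindex_bij_betw[OF e, symmetric])
    also have "\<dots> = (\<Sum>l<Suc n. \<Sum>k<Suc n. B i l * a (e l) k * w k)"
      using bij_betw_inv_into_left[OF e]
      by (intro sum.cong) (auto simp: sum_distrib_left mult.assoc lessThan_Suc_atMost)
    also have "\<dots> = (\<Sum>k<Suc n. (\<Sum>l<Suc n. B i l * a (e l) k) * w k)"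
      by (subst sum.swap) (simp only: sum_distrib_right)
    also have "\<dots> = (\<Sum>k<Suc n. if i = k then w k else 0)"
      by (intro sum.cong) (use B i in auto)
    also have "\<dots> = w i" using i by simp
    finally show ?thesis by simp
  qed
  then show ?thesis using that[of "\<lambda>i j. B i (inv_into {..<Suc n} e j)"] by blast
qed

lemma general_position_norm_le:
  assumes gp: "general_position n q a"
  obtains C where "0 < C"
    "\<And>J w. J \<subseteq> {1..q} \<Longrightarrow> card J = Suc n \<Longrightarrow>
      (\<Sum>i\<le>n. norm (w i)) \<le> C * (\<Sum>j\<in>J. norm (\<Sum>k\<le>n. a j k * w k :: complex))"
proof -
  define P where "P = (\<lambda>J C. \<forall>w. (\<Sum>i\<le>n. norm (w i)) \<le> C * (\<Sum>j\<in>J. norm (\<Sum>k\<le>n. a j k * w k)))"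
  have ex: "\<exists>C. P J C" if J: "J \<subseteq> {1..q}" "card J = Suc n" for J
  proof -
    obtain B where B: "\<And>w i. i \<le> n \<Longrightarrow> w i = (\<Sum>j\<in>J. B i j * (\<Sum>k\<le>n. a j k * w k))"
      using general_position_inverse[OF gp J] by blast
    have fin: "finite J" using J(1) finite_subset by blast
    define b where "b = (\<Sum>i\<le>n. \<Sum>j\<in>J. norm (B i j))"
    have bb: "(\<Sum>i\<le>n. norm (B i j)) \<le> b" if "j \<in> J" for j
      unfolding b_def using that fin by (intro sum_mono member_le_sum[of j J]) auto
    have "(\<Sum>i\<le>n. norm (w i)) \<le> b * (\<Sum>j\<in>J. norm (\<Sum>k\<le>n. a j k * w k))" for w
    proof -
      have "(\<Sum>i\<le>n. norm (w i)) \<le> (\<Sum>i\<le>n. \<Sum>j\<in>J. norm (B i j) * norm (\<Sum>k\<le>n. a j k * w k))"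
      proof (rule sum_mono)
        fix i assume "i \<in> {..n}"
        then have "norm (w i) = norm (\<Sum>j\<in>J. B i j * (\<Sum>k\<le>n. a j k * w k))" using B[of i w] by simp
        also have "\<dots> \<le> (\<Sum>j\<in>J. norm (B i j * (\<Sum>k\<le>n. a j k * w k)))" by (rule norm_sum)
        finally show "norm (w i) \<le> (\<Sum>j\<in>J. norm (B i j) * norm (\<Sum>k\<le>n. a j k * w k))"
          by (simp add: norm_mult)
      qed
      also have "\<dots> = (\<Sum>j\<in>J. (\<Sum>i\<le>n. norm (B i j)) * norm (\<Sum>k\<le>n. a j k * w k))"
        by (subst sum.swap) (simp only: sum_distrib_right)
      also have "\<dots> \<le> (\<Sum>j\<in>J. b * norm (\<Sum>k\<le>n. a j k * w k))"
        by (intro sum_mono mult_right_mono bb) auto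
      finally show ?thesis by (simp add: sum_distrib_left)
    qed
    then show ?thesis unfolding P_def by blast
  qed
  then obtain C where C: "\<forall>J\<in>{J. J \<subseteq> {1..q} \<and> card J = Suc n}. P J (C J)"
    using bchoice[of "{J. J \<subseteq> {1..q} \<and> card J = Suc n}" P] by blast
  \<comment> \<open>Dominates the constants of the finitely many subsets \<open>J\<close> at
    once.\<close>
  define D where "D = 1 + (\<Sum>J\<in>Pow {1..q}. \<bar>C J\<bar>)"
  have "0 < D" by (simp add: D_def add_pos_nonneg sum_nonneg)
  moreover have "(\<Sum>i\<le>n. norm (w i)) \<le> D * (\<Sum>j\<in>J. norm (\<Sum>k\<le>n. a j k * w k))"
    if "J \<subseteq> {1..q}" "card J = Suc n" for J w
  proof -
    have "\<bar>C J\<bar> \<le> (\<Sum>J\<in>Pow {1..q}. \<bar>C J\<bar>)" using that by (intro member_le_sum) auto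
    then have "C J \<le> D" by (simp add: D_def)
    then have "C J * (\<Sum>j\<in>J. norm (\<Sum>k\<le>n. a j k * w k)) \<le> D * (\<Sum>j\<in>J. norm (\<Sum>k\<le>n. a j k * w k))"
      by (intro mult_right_mono sum_nonneg) auto
    moreover have "P J (C J)" using C that by blast
    ultimately show ?thesis unfolding P_def by (meson order_trans)
  qed
  ultimately show ?thesis by (rule that)
qed

text \<open>At most \<open>n\<close> forms are small at a given vector: if \<open>n + 1\<close> of
  them were below \<open>c\<close> times its norm, their sum would contradict
  \<open>general_position_norm_le\<close>, which dictates \<open>c = 1 / (C * (n + 1))\<close>. The
  set \<open>R\<close> consists of the small forms, filled up to \<open>n + 1\<close>
  elements.\<close>

lemma general_position_large:
  assumes gp: "general_position n q a" and q: "Suc n \<le> q"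
  obtains c where "0 < c"
    "\<And>w. \<exists>R\<subseteq>{1..q}. card R = Suc n \<and>
      (\<forall>j\<in>{1..q} - R. c * (\<Sum>i\<le>n. norm (w i)) \<le> norm (\<Sum>k\<le>n. a j k * w k :: complex))"
proof -
  obtain C where C: "0 < C" "\<And>J w. J \<subseteq> {1..q} \<Longrightarrow> card J = Suc n \<Longrightarrow>
      (\<Sum>i\<le>n. norm (w i)) \<le> C * (\<Sum>j\<in>J. norm (\<Sum>k\<le>n. a j k * w k :: complex))"
    using general_position_norm_le[OF gp] by blast
  define c where "c = 1 / (C * real (Suc n))"
  have c0: "0 < c" using C(1) by (simp add: c_def)
  have "\<exists>R\<subseteq>{1..q}. card R = Suc n \<and>
      (\<forall>j\<in>{1..q} - R. c * (\<Sum>i\<le>n. norm (w i)) \<le> norm (\<Sum>k\<le>n. a j k * w k))" for w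
  proof -
    define B where "B = {j\<in>{1..q}. norm (\<Sum>k\<le>n. a j k * w k) < c * (\<Sum>i\<le>n. norm (w i))}"
    have finB: "finite B" "B \<subseteq> {1..q}" by (auto simp: B_def)
    have cB: "card B \<le> n"
    proof (rule ccontr)
      assume "\<not> card B \<le> n"
      then obtain J where J: "J \<subseteq> B" "card J = Suc n" 
        using obtain_subset_with_card_n[of "Suc n" B] not_less_eq_eq by metis
      have "finite J" "J \<noteq> {}" using J finB finite_subset by auto
      have "(\<Sum>i\<le>n. norm (w i)) \<le> C * (\<Sum>j\<in>J. norm (\<Sum>k\<le>n. a j k * w k))"
        using J finB by (intro C(2)) auto
      also have "\<dots> < C * (\<Sum>j\<in>J. c * (\<Sum>i\<le>n. norm (w i)))"
        using \<open>finite J\<close> \<open>J \<noteq> {}\<close> J C(1) by (intro mult_strict_left_mono sum_strict_mono) (auto simp: B_def)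
      also have "\<dots> = (\<Sum>i\<le>n. norm (w i))" using J(2) C(1) by (simp add: c_def)
      finally show False by simp
    qed
    have "Suc n - card B \<le> card ({1..q} - B)"
      using finB q by (simp add: card_Diff_subset)
    then obtain E where E: "E \<subseteq> {1..q} - B" "card E = Suc n - card B" "finite E"
      using obtain_subset_with_card_n by blast
    have "card (B \<union> E) = Suc n" using E finB cB by (subst card_Un_disjoint) auto
    moreover have "B \<union> E \<subseteq> {1..q}" using E finB by auto
    moreover have "\<forall>j\<in>{1..q} - (B \<union> E). c * (\<Sum>i\<le>n. norm (w i)) \<le> norm (\<Sum>k\<le>n. a j k * w k)"
      by (auto simp: B_def)
    ultimately show ?thesis by blast
  qed
  then show ?thesis by (rule that[OF c0])
qed

section \<open>Comparison of counting functions\<close>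

lemma Ncount_eq:
  assumes "finite Z" "Z \<subseteq> ball 0 r" "\<And>a. a \<in> ball 0 r \<Longrightarrow> \<mu> a \<noteq> 0 \<Longrightarrow> a \<in> Z"
  shows "Ncount \<mu> r = (\<Sum>a\<in>Z. real (\<mu> a) * ln (r / norm a))"
  unfolding Ncount_def using assms by (intro sum.mono_neutral_left) auto

lemma ln_ratio_nonneg: "a \<in> ball 0 r \<Longrightarrow> 0 \<le> ln (r / norm (a::complex))"
  by (cases "a = 0") (auto simp: field_simps)

lemma Ncount_nonneg: "0 \<le> Ncount \<mu> r"
  unfolding Ncount_def using ln_ratio_nonneg by (intro sum_nonneg mult_nonneg_nonneg) auto

text \<open>The bridge from arguments about multiplicities at single points to growth estimates: the
  weights \<open>ln (r / norm a)\<close> are nonnegative, so inequalities between weighted divisors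
  can be summed.\<close>

lemma Ncount_linear_mono:
  assumes I: "finite I" "\<And>i. i \<in> I \<Longrightarrow> finite {z \<in> ball 0 r. \<mu> i z \<noteq> 0}"
    and J: "finite J" "\<And>i. i \<in> J \<Longrightarrow> finite {z \<in> ball 0 r. \<nu> i z \<noteq> 0}"
    and le: "\<And>z. z \<in> ball 0 r \<Longrightarrow> (\<Sum>i\<in>I. c i * real (\<mu> i z)) \<le> (\<Sum>i\<in>J. d i * real (\<nu> i z))"
  shows "(\<Sum>i\<in>I. c i * Ncount (\<mu> i) r) \<le> (\<Sum>i\<in>J. d i * Ncount (\<nu> i) r)"
proof -
  define Z where "Z = (\<Union>i\<in>I. {z \<in> ball 0 r. \<mu> i z \<noteq> 0}) \<union> (\<Union>i\<in>J. {z \<in> ball 0 r. \<nu> i z \<noteq> 0})"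
  have Z: "finite Z" "Z \<subseteq> ball 0 r" using I J by (auto simp: Z_def)
  have "(\<Sum>i\<in>I. c i * Ncount (\<mu> i) r) = (\<Sum>i\<in>I. \<Sum>a\<in>Z. c i * real (\<mu> i a) * ln (r / norm a))"
    by (intro sum.cong refl, subst Ncount_eq[OF Z]) (auto simp: Z_def sum_distrib_left mult.assoc)
  also have "\<dots> = (\<Sum>a\<in>Z. (\<Sum>i\<in>I. c i * real (\<mu> i a)) * ln (r / norm a))"
    by (subst sum.swap) (simp only: sum_distrib_right)
  also have "\<dots> \<le> (\<Sum>a\<in>Z. (\<Sum>i\<in>J. d i * real (\<nu> i a)) * ln (r / norm a))"
    using Z(2) by (intro sum_mono mult_right_mono le ln_ratio_nonneg) auto
  also have "\<dots> = (\<Sum>i\<in>J. \<Sum>a\<in>Z. d i * real (\<nu> i a) * ln (r / norm a))"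
    by (subst sum.swap) (simp only: sum_distrib_right)
  also have "\<dots> = (\<Sum>i\<in>J. d i * Ncount (\<nu> i) r)"
    by (intro sum.cong refl, subst Ncount_eq[OF Z]) (auto simp: Z_def sum_distrib_left mult.assoc)
  finally show ?thesis .
qed

lemma finite_ord_support:
  assumes "F holomorphic_on UNIV" "F b \<noteq> 0"
  shows "finite {z \<in> ball 0 r. ord F z \<noteq> 0}"
  using finite_zeros_ball[OF assms, of r] ord_pos_iff[OF assms]
  by (rule_tac rev_finite_subset) auto

lemma cmean_nonneg:
  assumes "0 \<le> r" "continuous_on (sphere 0 r) u" "\<And>z. norm z = r \<Longrightarrow> 0 \<le> u z"
  shows "0 \<le> cmean u r"
  using cmean_mono[of r "\<lambda>z. 0" u] assms by simp

text \<open>The normalisation at 0 is needed for Jensen's formula and is achieved by a translation.\<close>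

locale entire_curve =
  fixes n q :: nat and f :: "nat \<Rightarrow> complex \<Rightarrow> complex" and a :: "nat \<Rightarrow> nat \<Rightarrow> complex"
  assumes hol: "\<And>i. i \<le> n \<Longrightarrow> f i holomorphic_on UNIV"
    and no_common_zero: "\<And>z. \<exists>i\<le>n. f i z \<noteq> 0"
    and gp: "general_position n q a" and q: "Suc n \<le> q"
    and F0: "\<And>j. j \<in> {1..q} \<Longrightarrow> lf n f (a j) 0 \<noteq> 0"
    and W0: "wron (Suc n) f 0 \<noteq> 0"
begin

abbreviation "F j \<equiv> lf n f (a j)"
abbreviation "nrm z \<equiv> \<Sum>i\<le>n. norm (f i z)"

lemma lf_hol: "lf n f b holomorphic_on UNIV"
  using hol by (rule lf_holomorphic)

lemma nrm_pos: "0 < nrm z"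
proof -
  obtain i where "i \<le> n" "f i z \<noteq> 0" using no_common_zero by blast
  then show ?thesis by (intro sum_pos2[of _ i]) auto
qed

lemma continuous_ln_nrm: "continuous_on A (\<lambda>z. ln (nrm z))"
proof -
  have "continuous_on A (f i)" if "i \<le> n" for i
    using hol[OF that] holomorphic_on_imp_continuous_on continuous_on_subset by blast
  moreover have "nrm z \<noteq> 0" for z using nrm_pos[of z] by simp
  ultimately show ?thesis by (intro continuous_intros) auto
qed

lemma lf_le: "norm (lf n f b z) \<le> (\<Sum>i\<le>n. norm (b i)) * nrm z"
proof -
  have "norm (lf n f b z) \<le> (\<Sum>i\<le>n. norm (b i) * norm (f i z))"
    unfolding lf_def by (rule order_trans[OF norm_sum]) (simp add: norm_mult)
  also have "\<dots> \<le> (\<Sum>i\<le>n. (\<Sum>i\<le>n. norm (b i)) * norm (f i z))"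
    by (intro sum_mono mult_right_mono member_le_sum) auto
  finally show ?thesis by (simp add: sum_distrib_left)
qed

lemma cmean_ln_lf_le:
  assumes b: "b i0 \<noteq> 0" "i0 \<le> n" and r: "0 < r" and nz: "\<And>z. norm z = r \<Longrightarrow> lf n f b z \<noteq> 0"
  shows "cmean (\<lambda>z. ln (norm (lf n f b z))) r \<le> Tchar n f r + ln (\<Sum>i\<le>n. norm (b i))"
proof -
  have bp: "0 < (\<Sum>i\<le>n. norm (b i))" using b by (intro sum_pos2[of _ i0]) auto
  have "cmean (\<lambda>z. ln (norm (lf n f b z))) r \<le> cmean (\<lambda>z. ln (nrm z) + ln (\<Sum>i\<le>n. norm (b i))) r"
  proof (rule cmean_mono)
    fix z :: complex assume z: "norm z = r"
    have "ln (norm (lf n f b z)) \<le> ln ((\<Sum>i\<le>n. norm (b i)) * nrm z)"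
      using nz[OF z] lf_le[of b z] by (intro ln_mono) auto
    also have "\<dots> = ln (nrm z) + ln (\<Sum>i\<le>n. norm (b i))"
      using ln_mult_pos[OF bp nrm_pos[of z]] by simp
    finally show "ln (norm (lf n f b z)) \<le> ln (nrm z) + ln (\<Sum>i\<le>n. norm (b i))" .
  next
    show "continuous_on (sphere 0 r) (\<lambda>z. ln (norm (lf n f b z)))"
      using nz by (intro continuous_on_ln_norm lf_hol) auto
    show "continuous_on (sphere 0 r) (\<lambda>z. ln (nrm z) + ln (\<Sum>i\<le>n. norm (b i)))"
      by (intro continuous_intros continuous_ln_nrm)
  qed (use r in auto)
  then show ?thesis using r
    by (subst (asm) cmean_add) (auto simp: Tchar_def intro!: continuous_ln_nrm)
qed

text \<open>One half of the first main theorem: Jensen's formula turns the count into a circle mean,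
  and the form is at most a constant times \<open>nrm\<close>.\<close>

lemma Ncount_lf_le:
  assumes b0: "lf n f b 0 \<noteq> 0" and r: "0 < r" and nz: "\<And>z. norm z = r \<Longrightarrow> lf n f b z \<noteq> 0"
  shows "Ncount (ord (lf n f b)) r \<le> Tchar n f r + (\<bar>ln (\<Sum>i\<le>n. norm (b i))\<bar> + \<bar>ln (norm (lf n f b 0))\<bar>)"
proof -
  obtain i0 where "b i0 \<noteq> 0" "i0 \<le> n"
  proof (rule ccontr)
    assume "\<not> thesis"
    then have "lf n f b 0 = 0" using that unfolding lf_def by (intro sum.neutral) auto
    with b0 show False by simp
  qed
  from cmean_ln_lf_le[of b, OF this r nz] show ?thesis
    using jensen[OF lf_hol b0 r nz] by linarith
qed

lemma hyperplane_nonzero: "j \<in> {1..q} \<Longrightarrow> \<exists>i\<le>n. a j i \<noteq> 0"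
proof (rule ccontr)
  assume "j \<in> {1..q}" "\<not> (\<exists>i\<le>n. a j i \<noteq> 0)"
  then have "lf n f (a j) 0 = 0" unfolding lf_def by (intro sum.neutral) auto
  then show False using F0[OF \<open>j \<in> {1..q}\<close>] by simp
qed

lemma card_zero_hyperplanes: "card {j \<in> {1..q}. F j z = 0} \<le> n"
proof (rule ccontr)
  assume "\<not> ?thesis"
  then have "Suc n \<le> card {j \<in> {1..q}. F j z = 0}" by (simp only: not_less_eq_eq)
  then obtain J where J: "J \<subseteq> {j \<in> {1..q}. F j z = 0}" "card J = Suc n"
    by (rule obtain_subset_with_card_n)
  have J': "J \<subseteq> {1..q}" using J by blast
  obtain B where "\<And>w i. i \<le> n \<Longrightarrow> w i = (\<Sum>j\<in>J. B i j * (\<Sum>k\<le>n. a j k * w k))"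
    using general_position_inverse[OF gp J' J(2)] by blast
  from this[of _ "\<lambda>i. f i z"] have "f i z = 0" if "i \<le> n" for i
    using that J(1) by (auto simp: lf_def intro!: sum.neutral)
  then show False using no_common_zero by blast
qed

lemma wron_subset:
  assumes R: "R \<subseteq> {1..q}" "card R = Suc n"
  obtains e D where "bij_betw e {..<Suc n} R" "D \<noteq> 0"
    "\<And>z. wron (Suc n) (\<lambda>k. F (e k)) z = wron (Suc n) f z * D"
proof -
  have "finite R" using R(1) finite_subset by blast
  then obtain e where e: "bij_betw e {..<Suc n} R" using enumerate_finite_set R(2) by blast
  let ?D = "ndet (Suc n) (\<lambda>i k. a (e k) i)"
  have "wron (Suc n) (\<lambda>k. F (e k)) z = wron (Suc n) f z * ?D" for z
  proof -
    have "(\<lambda>k. F (e k)) = (\<lambda>k z. \<Sum>i<Suc n. a (e k) i * f i z)"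
      by (simp add: fun_eq_iff lf_def lessThan_Suc_atMost)
    then show ?thesis using wron_linear[of "Suc n" f UNIV z "\<lambda>i k. a (e k) i"] hol by simp
  qed
  then show ?thesis using that[OF e general_position_ndet[OF gp R(1) e]] by blast
qed

text \<open>At most \<open>n\<close> forms vanish at \<open>z\<close>, so some set \<open>R\<close>
  of \<open>n + 1\<close> forms contains them all. The Wronskian of these forms is that of
  \<open>f\<close> up to a nonzero constant, and \<open>wron_vanishing\<close> bounds its order from
  below by the orders in excess of \<open>n\<close>.\<close>

lemma ord_wron_ge:
  "(\<Sum>j\<in>{1..q}. ord (F j) z) \<le> ord (wron (Suc n) f) z + (\<Sum>j\<in>{1..q}. min (ord (F j) z) n)"
proof -
  let ?B = "{j \<in> {1..q}. F j z = 0}"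
  have "Suc n - card ?B \<le> card ({1..q} - ?B)"
    using q by (subst card_Diff_subset) auto
  then obtain E where E: "E \<subseteq> {1..q} - ?B" "card E = Suc n - card ?B" "finite E"
    using obtain_subset_with_card_n by blast
  define R where "R = ?B \<union> E"
  have "card R = Suc n" unfolding R_def
    using E card_zero_hyperplanes[of z] by (subst card_Un_disjoint) auto
  moreover have R1: "R \<subseteq> {1..q}" using E by (auto simp: R_def)
  ultimately obtain e D where e: "bij_betw e {..<Suc n} R" and D: "D \<noteq> 0"
    "\<And>z. wron (Suc n) (\<lambda>k. F (e k)) z = wron (Suc n) f z * D"
    using wron_subset by blast
  have eR: "e k \<in> {1..q}" if "k < Suc n" for k using e R1 that by (auto simp: bij_betw_def)
  obtain Q where Q: "Q holomorphic_on UNIV"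
    "\<And>w. wron (Suc n) (\<lambda>k. F (e k)) w = (w - z) ^ (\<Sum>k<Suc n. ord (F (e k)) z - n) * Q w"
    using wron_vanishing[of "Suc n" "\<lambda>k. F (e k)" "\<lambda>_. 0" z] lf_hol F0 eR by auto
  have "(\<Sum>k<Suc n. ord (F (e k)) z - n) \<le> ord (wron (Suc n) f) z"
  proof (rule le_ordI)
    show "wron (Suc n) f holomorphic_on UNIV" by (rule wron_holomorphic) (use hol in auto)
    show "wron (Suc n) f 0 \<noteq> 0" by (rule W0)
    show "(\<lambda>w. Q w / D) holomorphic_on UNIV" using Q(1) D(1) by (intro holomorphic_intros) auto
    show "wron (Suc n) f w = (w - z) ^ (\<Sum>k<Suc n. ord (F (e k)) z - n) * (Q w / D)" for w
      using Q(2)[of w] D(2)[of w] D(1) by (simp add: field_simps)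
  qed
  also have "(\<Sum>k<Suc n. ord (F (e k)) z - n) = (\<Sum>j\<in>R. ord (F j) z - n)"
    by (rule sum.reindex_bij_betw[OF e])
  also have "\<dots> = (\<Sum>j\<in>{1..q}. ord (F j) z - n)"
    using R1 ord_eq_0 by (intro sum.mono_neutral_left) (auto simp: R_def)
  finally have "(\<Sum>j\<in>{1..q}. ord (F j) z - n) \<le> ord (wron (Suc n) f) z" .
  moreover have "(\<Sum>j\<in>{1..q}. ord (F j) z) = (\<Sum>j\<in>{1..q}. ord (F j) z - n) + (\<Sum>j\<in>{1..q}. min (ord (F j) z) n)"
    by (subst sum.distrib[symmetric]) (intro sum.cong, auto)
  ultimately show ?thesis by linarith
qed

text \<open>A property of one constant, so that \<open>K\<close> is fixed before the radii
  \<open>r\<close> and \<open>R\<close>, the gap \<open>\<eta>\<close>, the separation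
  \<open>\<delta>\<close>, the zero bound \<open>N\<close> and the growth bound \<open>S\<close>.
  The same \<open>K\<close> serves outside and inside the logarithm. The argument of
  \<open>ln\<close> is the bound of \<open>log_derivative_estimate\<close> for
  \<open>B = 2 * S + K\<close>; it enters with exponent \<open>n\<close> for each of the
  \<open>n + 1\<close> columns of a Wronskian.\<close>

definition smt_constant :: "real \<Rightarrow> bool" where
  "smt_constant K \<longleftrightarrow> 0 \<le> K \<and> (\<forall>r \<eta> R \<delta> N S. 0 < r \<longrightarrow> 0 < \<eta> \<longrightarrow> \<eta> \<le> 1 \<longrightarrow> r + 2 * \<eta> \<le> R \<longrightarrow> 0 < \<delta> \<longrightarrow>
       (\<forall>j\<in>{1..q}. sep (F j) \<delta> r) \<longrightarrow> (\<forall>j\<in>{1..q}. sep (F j) \<delta> R) \<longrightarrow>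
       (\<forall>j\<in>{1..q}. real (zcount (F j) R) \<le> N) \<longrightarrow> (\<forall>z. norm z = r \<longrightarrow> wron (Suc n) f z \<noteq> 0) \<longrightarrow>
       Tchar n f R \<le> S \<longrightarrow>
      (real q - real n - 1) * Tchar n f r \<le> Ncount (\<lambda>z. \<Sum>j\<in>{1..q}. min (ord (F j) z) n) r + K
        + real (n * Suc n) * ln (N / \<delta> + 1 / \<eta> + 2 * R / \<eta>\<^sup>2 * (2 * S + K + 2 * N * (1 / \<delta> + 2 * R))))"

lemma smt_constantD:
  assumes "smt_constant K" "0 < r" "0 < \<eta>" "\<eta> \<le> 1" "r + 2 * \<eta> \<le> R" "0 < \<delta>"
    "\<And>j. j \<in> {1..q} \<Longrightarrow> sep (F j) \<delta> r" "\<And>j. j \<in> {1..q} \<Longrightarrow> sep (F j) \<delta> R"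
    "\<And>j. j \<in> {1..q} \<Longrightarrow> real (zcount (F j) R) \<le> N" "\<And>z. norm z = r \<Longrightarrow> wron (Suc n) f z \<noteq> 0"
    "Tchar n f R \<le> S"
  shows "(real q - real n - 1) * Tchar n f r \<le> Ncount (\<lambda>z. \<Sum>j\<in>{1..q}. min (ord (F j) z) n) r + K
        + real (n * Suc n) * ln (N / \<delta> + 1 / \<eta> + 2 * R / \<eta>\<^sup>2 * (2 * S + K + 2 * N * (1 / \<delta> + 2 * R)))"
  using assms(1)[unfolded smt_constant_def, THEN conjunct2, rule_format, OF assms(2-11)] .

text \<open>At \<open>z\<close> on the circle let \<open>R'\<close> be the \<open>n + 1\<close>
  forms outside which every form is comparable to \<open>nrm z\<close>. Then
  \<open>nrm z ^ (q - n - 1)\<close> times the modulus of the Wronskian is at most the product of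
  all forms times a quotient: the Wronskian of the forms in \<open>R'\<close> by their product. That
  quotient is at most a constant times \<open>d ^ (n * (n + 1))\<close>. Averaging with Jensen's
  formula gives the counting functions, and \<open>ord_wron_ge\<close> truncates them.\<close>

theorem cartan_second_main_theorem: "\<exists>K. smt_constant K"
proof -
  obtain c where c: "0 < c" "\<And>w. \<exists>R\<subseteq>{1..q}. card R = Suc n \<and>
      (\<forall>j\<in>{1..q} - R. c * (\<Sum>i\<le>n. norm (w i)) \<le> norm (\<Sum>k\<le>n. a j k * w k :: complex))"
    using general_position_large[OF gp q] by metis
  define b where "b = (\<lambda>j. \<Sum>i\<le>n. norm (a j i))"
  have bpos: "0 < b j" if "j \<in> {1..q}" for j
    using hyperplane_nonzero[OF that] by (auto simp: b_def intro!: sum_pos2)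
  have one: "1 \<in> {1..q}" and one': "Suc 0 \<le> q" using q by simp_all
  define K0 where "K0 = (\<Sum>j\<in>{1..q}. 2 * (\<bar>ln (b j)\<bar> + \<bar>ln (b 1)\<bar>) + \<bar>ln (norm (F j 0))\<bar> + \<bar>ln (norm (F 1 0))\<bar>)"
  have K0: "2 * (\<bar>ln (b j)\<bar> + \<bar>ln (b 1)\<bar>) + \<bar>ln (norm (F j 0))\<bar> + \<bar>ln (norm (F 1 0))\<bar> \<le> K0" if "j \<in> {1..q}" for j
    unfolding K0_def using that by (intro member_le_sum) auto
  \<comment> \<open>The enumeration \<open>e\<close> and the determinant \<open>D\<close> are chosen
    once for each of the finitely many sets \<open>R\<close>, so that \<open>K1\<close> bounds all
    the \<open>ln (norm D)\<close> before any circle is given.\<close>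
  define P where "P = (\<lambda>R (e, D). bij_betw e {..<Suc n} R \<and> D \<noteq> 0 \<and>
     (\<forall>z. wron (Suc n) (\<lambda>k. F (e k)) z = wron (Suc n) f z * D))"
  define RR where "RR = {R. R \<subseteq> {1..q} \<and> card R = Suc n}"
  have "\<exists>x. P R x" if "R \<in> RR" for R
  proof -
    have R: "R \<subseteq> {1..q}" "card R = Suc n" using that by (auto simp: RR_def)
    obtain e D where "bij_betw e {..<Suc n} R" "D \<noteq> 0"
      "\<And>z. wron (Suc n) (\<lambda>k. F (e k)) z = wron (Suc n) f z * D"
      using wron_subset[OF R] by blast
    then have "P R (e, D)" by (simp add: P_def)
    then show ?thesis by blast
  qed
  then have "\<forall>R\<in>RR. \<exists>x. P R x" by blast
  then obtain x where x: "\<forall>R\<in>RR. P R (x R)" using bchoice by blast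
  have finRR: "finite RR" unfolding RR_def by (rule finite_subset[of _ "Pow {1..q}"]) auto
  define K1 where "K1 = (\<Sum>R\<in>RR. \<bar>ln (norm (snd (x R)))\<bar>)"
  define K2 where "K2 = ln (fact (Suc n) * (fact n * exp 2) ^ Suc n :: real)"
  define K3 where "K3 = real (q - Suc n) * \<bar>ln c\<bar> + K1 + \<bar>K2\<bar>"
  define K4 where "K4 = (\<Sum>j\<in>{1..q}. \<bar>ln (norm (F j 0))\<bar>) + \<bar>ln (norm (wron (Suc n) f 0))\<bar>"
  define K where "K = K0 + K3 + K4"
  have Kn: "0 \<le> K0" "0 \<le> K3" "0 \<le> K4" "0 \<le> K1"
    unfolding K0_def K3_def K4_def K1_def by (auto intro!: sum_nonneg add_nonneg_nonneg)
  have "smt_constant K" unfolding smt_constant_def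
  proof (intro conjI allI impI)
    show "0 \<le> K" using Kn by (simp add: K_def)
    fix r \<eta> R \<delta> N S :: real
    assume pos: "0 < r" "0 < \<eta>" "\<eta> \<le> 1" "r + 2 * \<eta> \<le> R" "0 < \<delta>"
      and sep': "\<forall>j\<in>{1..q}. sep (F j) \<delta> r" "\<forall>j\<in>{1..q}. sep (F j) \<delta> R"
      and N': "\<forall>j\<in>{1..q}. real (zcount (F j) R) \<le> N"
      and W': "\<forall>z. norm z = r \<longrightarrow> wron (Suc n) f z \<noteq> 0" and S: "Tchar n f R \<le> S"
    have sepr: "sep (F j) \<delta> r" and sepR: "sep (F j) \<delta> R" and N: "real (zcount (F j) R) \<le> N"
      if "j \<in> {1..q}" for j using sep' N' that by blast+
    have W: "wron (Suc n) f z \<noteq> 0" if "norm z = r" for z using W' that by blast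
    have R: "0 < R" using pos by simp
    define B where "B = 2 * S + K"
    define d where "d = N / \<delta> + 1 / \<eta> + 2 * R / \<eta>\<^sup>2 * (B + 2 * N * (1 / \<delta> + 2 * R))"
    have nzR: "F j z \<noteq> 0" if "j \<in> {1..q}" "norm z = R" for j z
      using sep_nonzero[OF sepR[OF that(1)] pos(5) that(2)] .
    have nzr: "F j z \<noteq> 0" if "j \<in> {1..q}" "norm z = r" for j z
      using sep_nonzero[OF sepr[OF that(1)] pos(5) that(2)] .
    have contR: "continuous_on (sphere 0 R) (\<lambda>z. ln (norm (F j z)))" if "j \<in> {1..q}" for j
      using nzR[OF that] by (intro continuous_on_ln_norm lf_hol) auto
    have contr: "continuous_on (sphere 0 r) (\<lambda>z. ln (norm (F j z)))" if "j \<in> {1..q}" for j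
      using nzr[OF that] by (intro continuous_on_ln_norm lf_hol) auto
    have up: "ln (norm (F j z)) \<le> ln (nrm z) + ln (b j)" if "j \<in> {1..q}" "F j z \<noteq> 0" for j z
    proof -
      have "ln (norm (F j z)) \<le> ln (b j * nrm z)"
        using that lf_le[of "a j" z] by (intro ln_mono) (auto simp: b_def)
      then show ?thesis using ln_mult_pos[OF bpos[OF that(1)] nrm_pos[of z]] by simp
    qed
    have B: "cmean (\<lambda>z. \<bar>ln (norm (F j z)) - ln (norm (F 1 z))\<bar>) R \<le> B" if j: "j \<in> {1..q}" for j
    proof -
      \<comment> \<open>If \<open>s\<close> and \<open>t\<close> are at most \<open>A\<close>, then
        |s - t| is at most \<open>2 * A - (s + t)\<close>. After averaging, Jensen's formula bounds
        the means of \<open>s\<close> and \<open>t\<close> from below by their values at the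
        origin.\<close>
      have "cmean (\<lambda>z. \<bar>ln (norm (F j z)) - ln (norm (F 1 z))\<bar>) R \<le>
        cmean (\<lambda>z. (2 * ln (nrm z) + 2 * (\<bar>ln (b j)\<bar> + \<bar>ln (b 1)\<bar>)) - (ln (norm (F j z)) + ln (norm (F 1 z)))) R"
      proof (rule cmean_mono)
        fix z :: complex assume z: "norm z = R"
        show "\<bar>ln (norm (F j z)) - ln (norm (F 1 z))\<bar> \<le>
          (2 * ln (nrm z) + 2 * (\<bar>ln (b j)\<bar> + \<bar>ln (b 1)\<bar>)) - (ln (norm (F j z)) + ln (norm (F 1 z)))"
          using up[OF j nzR[OF j z]] up[OF one nzR[OF one z]] abs_ge_self[of "ln (b j)"] abs_ge_self[of "ln (b 1)"]
            abs_ge_zero[of "ln (b j)"] abs_ge_zero[of "ln (b 1)"]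
          by (intro abs_leI) argo+
      qed (use R one' in \<open>auto intro!: continuous_on_diff continuous_on_add continuous_on_rabs
            continuous_on_mult continuous_on_const contR j one continuous_ln_nrm\<close>)
      also have "\<dots> = (2 * Tchar n f R + 2 * (\<bar>ln (b j)\<bar> + \<bar>ln (b 1)\<bar>))
          - (cmean (\<lambda>z. ln (norm (F j z))) R + cmean (\<lambda>z. ln (norm (F 1 z))) R)"
        using R one' by (subst cmean_diff, simp_all add: cmean_add cmean_cmult Tchar_def contR[OF j] contR[OF one, unfolded One_nat_def] continuous_ln_nrm
            continuous_on_add continuous_on_mult)
      also have "\<dots> \<le> 2 * S + K0"
      proof -
        have "cmean (\<lambda>z. ln (norm (F i z))) R \<ge> ln (norm (F i 0))" if "i \<in> {1..q}" for i
          using jensen[OF lf_hol F0[OF that] R nzR[OF that]] Ncount_nonneg[of "ord (F i)" R] by simp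
        from this[OF j] this[OF one] show ?thesis using K0[OF j] S by linarith
      qed
      finally show ?thesis using Kn by (simp add: B_def K_def)
    qed
    have N0: "0 \<le> N" using N[OF one] by linarith
    have B0: "0 \<le> B"
      using cmean_nonneg[of R "\<lambda>z. \<bar>ln (norm (F 1 z)) - ln (norm (F 1 z))\<bar>"] B[OF one] by simp
    have d1: "1 \<le> d"
    proof -
      have "1 \<le> 1 / \<eta>" using pos by simp
      moreover have "0 \<le> N / \<delta>" "0 \<le> 2 * R / \<eta>\<^sup>2 * (B + 2 * N * (1 / \<delta> + 2 * R))" using N0 B0 pos R by auto
      ultimately show ?thesis by (simp add: d_def)
    qed
    obtain u where u: "u holomorphic_on ball 0 R" "\<And>z. u z \<noteq> 0"
      "\<And>G z l. \<lbrakk>G holomorphic_on UNIV; G 0 \<noteq> 0; sep G \<delta> r; sep G \<delta> R; real (zcount G R) \<le> N;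
        cmean (\<lambda>z. \<bar>ln (norm (G z)) - ln (norm (F 1 z))\<bar>) R \<le> B; norm z = r\<rbrakk>
      \<Longrightarrow> norm ((deriv ^^ l) (\<lambda>z. u z * G z) z) \<le> fact l * exp 2 * d ^ l * norm (u z * G z)"
      using log_derivative_estimate[OF lf_hol F0[OF one] pos(1,2,4,5) sepR[OF one] N[OF one], where B=B]
      unfolding d_def by blast
    have pw: "real (q - Suc n) * ln (nrm z) + ln (norm (wron (Suc n) f z)) \<le>
       (\<Sum>j\<in>{1..q}. ln (norm (F j z))) + (K3 + real (n * Suc n) * ln d)" if z: "norm z = r" for z
    proof -
      obtain R' where R': "R' \<subseteq> {1..q}" "card R' = Suc n"
        "\<forall>j\<in>{1..q} - R'. c * nrm z \<le> norm (\<Sum>k\<le>n. a j k * f k z)"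
        using c(2)[of "\<lambda>i. f i z"] by blast
      obtain e D where eD: "x R' = (e, D)" by (cases "x R'")
      have RR': "R' \<in> RR" using R' by (simp add: RR_def)
      then have e: "bij_betw e {..<Suc n} R'" "D \<noteq> 0"
        "\<And>z. wron (Suc n) (\<lambda>k. F (e k)) z = wron (Suc n) f z * D"
        using x eD by (auto simp: P_def)
      have er: "e k \<in> {1..q}" if "k < Suc n" for k using e(1) R'(1) that by (auto simp: bij_betw_def)
      have zb: "z \<in> ball 0 R" using z pos by simp
      have "norm (wron (Suc n) (\<lambda>k z. u z * F (e k) z) z) \<le>
        fact (Suc n) * (\<Prod>k<Suc n. fact n * exp 2 * d ^ n * norm (u z * F (e k) z))"
        unfolding wron_def
      proof (rule norm_ndet_le)
        fix l k assume lk: "l < Suc n" "k < Suc n"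
        have "norm ((deriv ^^ l) (\<lambda>z. u z * F (e k) z) z) \<le> fact l * exp 2 * d ^ l * norm (u z * F (e k) z)"
          by (rule u(3)) (use er[OF lk(2)] lf_hol F0 sepr sepR N B z in auto)
        also have "\<dots> \<le> fact n * exp 2 * d ^ n * norm (u z * F (e k) z)"
          using lk d1 by (intro mult_right_mono mult_mono power_increasing) (auto intro!: fact_mono)
        finally show "norm ((deriv ^^ l) (\<lambda>z. u z * F (e k) z) z) \<le> fact n * exp 2 * d ^ n * norm (u z * F (e k) z)" .
      qed
      also have "\<dots> = norm (u z) ^ Suc n * ((fact (Suc n) * (fact n * exp 2) ^ Suc n) * d ^ (n * Suc n) * (\<Prod>k<Suc n. norm (F (e k) z)))"
      proof -
        have "(\<Prod>k<Suc n. fact n * exp 2 * d ^ n * norm (u z * F (e k) z)) =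
          (\<Prod>k<Suc n. (fact n * exp 2 * d ^ n * norm (u z)) * norm (F (e k) z))"
          by (intro prod.cong) (auto simp: norm_mult)
        also have "\<dots> = (fact n * exp 2 * d ^ n * norm (u z)) ^ Suc n * (\<Prod>k<Suc n. norm (F (e k) z))"
          by (subst prod.distrib) (simp only: prod_constant card_lessThan)
        finally show ?thesis by (simp only: power_mult_distrib power_mult[symmetric] mult_ac)
      qed
      also have "(\<Prod>k<Suc n. norm (F (e k) z)) = (\<Prod>j\<in>R'. norm (F j z))"
        by (rule prod.reindex_bij_betw[OF e(1)])
      finally have "norm (wron (Suc n) (\<lambda>k z. u z * F (e k) z) z) \<le> norm (u z) ^ Suc n *
        ((fact (Suc n) * (fact n * exp 2) ^ Suc n) * d ^ (n * Suc n) * (\<Prod>j\<in>R'. norm (F j z)))" .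
      moreover have "wron (Suc n) (\<lambda>k z. u z * F (e k) z) z = u z ^ Suc n * (wron (Suc n) f z * D)"
        using wron_mult[OF u(1) _ open_ball zb, of "Suc n" "\<lambda>k. F (e k)"] e(3)[of z]
        by (simp add: holomorphic_on_subset[OF lf_hol])
      ultimately have "norm (u z) ^ Suc n * (norm (wron (Suc n) f z) * norm D) \<le> norm (u z) ^ Suc n *
        ((fact (Suc n) * (fact n * exp 2) ^ Suc n) * d ^ (n * Suc n) * (\<Prod>j\<in>R'. norm (F j z)))"
        by (simp only: norm_mult norm_power)
      then have ineq: "norm (wron (Suc n) f z) * norm D \<le>
        (fact (Suc n) * (fact n * exp 2) ^ Suc n) * d ^ (n * Suc n) * (\<Prod>j\<in>R'. norm (F j z))"
        by (rule mult_left_le_imp_le) (use u(2)[of z] in simp)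
      have finR': "finite R'" using R'(1) finite_subset by blast
      have Fpos: "0 < norm (F j z)" if "j \<in> {1..q}" for j using nzr[OF that z] by simp
      have pR: "0 < (\<Prod>j\<in>R'. norm (F j z))" using Fpos R'(1) by (intro prod_pos) auto
      have kp: "0 < (fact (Suc n) * (fact n * exp 2) ^ Suc n :: real)" by (intro mult_pos_pos zero_less_power) auto
      have dp: "0 < d ^ (n * Suc n)" using d1 by (intro zero_less_power) linarith
      have "ln (norm (wron (Suc n) f z) * norm D) \<le>
        ln ((fact (Suc n) * (fact n * exp 2) ^ Suc n) * d ^ (n * Suc n) * (\<Prod>j\<in>R'. norm (F j z)))"
        using W[OF z] e(2) by (intro ln_mono ineq mult_pos_pos) auto
      also have "\<dots> = K2 + real (n * Suc n) * ln d + (\<Sum>j\<in>R'. ln (norm (F j z)))"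
        using kp dp pR Fpos R'(1) finR' d1
        by (subst ln_mult_pos, simp, simp, subst ln_mult_pos, simp, simp, subst ln_prod)
          (auto simp: K2_def ln_realpow)
      finally have A1: "ln (norm (wron (Suc n) f z)) + ln (norm D)
          \<le> K2 + real (n * Suc n) * ln d + (\<Sum>j\<in>R'. ln (norm (F j z)))"
        using W[OF z] e(2) by (subst (asm) ln_mult_pos) auto
      have "\<bar>ln (norm (snd (x R')))\<bar> \<le> K1"
        unfolding K1_def using RR' finRR by (intro member_le_sum) auto
      then have A2: "\<bar>ln (norm D)\<bar> \<le> K1" using eD by simp
      have "(\<Sum>j\<in>{1..q} - R'. ln c + ln (nrm z)) \<le> (\<Sum>j\<in>{1..q} - R'. ln (norm (F j z)))"
      proof (rule sum_mono)
        fix j assume j: "j \<in> {1..q} - R'"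
        have "ln (c * nrm z) \<le> ln (norm (F j z))"
          using R'(3) j c(1) nrm_pos[of z] by (intro ln_mono) (auto simp: lf_def)
        then show "ln c + ln (nrm z) \<le> ln (norm (F j z))"
          using ln_mult_pos[OF c(1) nrm_pos[of z]] by simp
      qed
      moreover have "card ({1..q} - R') = q - Suc n" using R' finR' by (simp add: card_Diff_subset)
      ultimately have "real (q - Suc n) * (ln c + ln (nrm z)) \<le> (\<Sum>j\<in>{1..q} - R'. ln (norm (F j z)))"
        by simp
      moreover have "- (real (q - Suc n) * ln c) \<le> real (q - Suc n) * \<bar>ln c\<bar>"
        using mult_left_mono[of "- ln c" "\<bar>ln c\<bar>" "real (q - Suc n)"] by simp
      moreover have "(\<Sum>j\<in>{1..q}. ln (norm (F j z))) = (\<Sum>j\<in>{1..q} - R'. ln (norm (F j z))) + (\<Sum>j\<in>R'. ln (norm (F j z)))"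
        using R'(1) by (intro sum.subset_diff) auto
      ultimately show ?thesis using A1 A2 by (simp only: K3_def distrib_left) linarith
    qed
    have Whol: "wron (Suc n) f holomorphic_on UNIV" by (rule wron_holomorphic) (use hol in auto)
    have contW: "continuous_on (sphere 0 r) (\<lambda>z. ln (norm (wron (Suc n) f z)))"
      using W by (intro continuous_on_ln_norm Whol) auto
    have "cmean (\<lambda>z. real (q - Suc n) * ln (nrm z) + ln (norm (wron (Suc n) f z))) r \<le>
       cmean (\<lambda>z. (\<Sum>j\<in>{1..q}. ln (norm (F j z))) + (K3 + real (n * Suc n) * ln d)) r"
      using pos contr contW
      by (intro cmean_mono pw) (auto intro!: continuous_on_add continuous_on_mult continuous_ln_nrm continuous_on_sum)
    also have "\<dots> = (\<Sum>j\<in>{1..q}. cmean (\<lambda>z. ln (norm (F j z))) r) + (K3 + real (n * Suc n) * ln d)"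
      using pos cmean_sum[of r "{1..q}", OF _ _ contr]
      by (subst cmean_add) (auto intro!: continuous_on_sum contr)
    also have "(\<Sum>j\<in>{1..q}. cmean (\<lambda>z. ln (norm (F j z))) r) = (\<Sum>j\<in>{1..q}. ln (norm (F j 0)) + Ncount (ord (F j)) r)"
      by (intro sum.cong refl jensen lf_hol F0 pos(1) nzr)
    also have "cmean (\<lambda>z. real (q - Suc n) * ln (nrm z) + ln (norm (wron (Suc n) f z))) r
      = real (q - Suc n) * Tchar n f r + (ln (norm (wron (Suc n) f 0)) + Ncount (ord (wron (Suc n) f)) r)"
      using pos contW jensen[OF Whol W0 pos(1) W]
      by (subst cmean_add) (auto simp: cmean_cmult Tchar_def intro!: continuous_on_mult continuous_ln_nrm)
    finally have main: "real (q - Suc n) * Tchar n f r + (ln (norm (wron (Suc n) f 0))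
        + Ncount (ord (wron (Suc n) f)) r)
      \<le> (\<Sum>j\<in>{1..q}. ln (norm (F j 0)) + Ncount (ord (F j)) r) + (K3 + real (n * Suc n) * ln d)" .
    have finF: "finite {z \<in> ball 0 r. ord (F j) z \<noteq> 0}" if "j \<in> {1..q}" for j
      by (rule finite_ord_support[OF lf_hol F0[OF that]])
    have finM: "finite {z \<in> ball 0 r. (\<Sum>j\<in>{1..q}. min (ord (F j) z) n) \<noteq> 0}"
      by (rule finite_subset[of _ "\<Union>j\<in>{1..q}. {z \<in> ball 0 r. ord (F j) z \<noteq> 0}"])
        (use finF in \<open>auto simp: sum_eq_0_iff\<close>)
    have "(\<Sum>j\<in>{1..q}. 1 * Ncount (ord (F j)) r) \<le>
       (\<Sum>i\<in>{0, 1::nat}. 1 * Ncount (if i = 0 then ord (wron (Suc n) f) else (\<lambda>z. \<Sum>j\<in>{1..q}. min (ord (F j) z) n)) r)"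
    proof (rule Ncount_linear_mono)
      fix z :: complex
      show "(\<Sum>i\<in>{1..q}. 1 * real (ord (F i) z)) \<le> (\<Sum>i\<in>{0, 1::nat}. 1 * real ((if i
          = 0 then ord (wron (Suc n) f) else (\<lambda>z. \<Sum>j\<in>{1..q}. min (ord (F j) z) n)) z))"
        using ord_wron_ge[of z] by (simp flip: of_nat_sum of_nat_add)
    next
      fix i :: nat
      show "finite {z \<in> ball 0 r. (if i = 0 then ord (wron (Suc n) f) else (\<lambda>z. \<Sum>j\<in>{1..q}. min (ord (F j) z) n)) z \<noteq> 0}"
        using finM finite_ord_support[OF Whol W0, of r] by (cases "i = 0") (simp_all only: if_True if_False simp_thms)
    qed (use finF in auto)
    then have "(\<Sum>j\<in>{1..q}. Ncount (ord (F j)) r) \<le> Ncount (ord (wron (Suc n) f)) r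
        + Ncount (\<lambda>z. \<Sum>j\<in>{1..q}. min (ord (F j) z) n) r"
      by simp
    moreover have "(\<Sum>j\<in>{1..q}. ln (norm (F j 0))) - ln (norm (wron (Suc n) f 0)) \<le> K4"
    proof -
      have "(\<Sum>j\<in>{1..q}. ln (norm (F j 0))) \<le> (\<Sum>j\<in>{1..q}. \<bar>ln (norm (F j 0))\<bar>)"
        by (intro sum_mono abs_ge_self)
      then show ?thesis unfolding K4_def by linarith
    qed
    moreover have "real (q - Suc n) = real q - real n - 1" using q by simp
    ultimately have "(real q - real n - 1) * Tchar n f r \<le> Ncount (\<lambda>z. \<Sum>j\<in>{1..q}. min (ord (F j) z) n) r
        + K3 + K4 + real (n * Suc n) * ln d"
      using main by (simp add: sum.distrib)
    then show "(real q - real n - 1) * Tchar n f r \<le> Ncount (\<lambda>z. \<Sum>j\<in>{1..q}. min (ord (F j) z) n) r + K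
        + real (n * Suc n) * ln (N / \<delta> + 1 / \<eta> + 2 * R / \<eta>\<^sup>2 * (2 * S + K + 2 * N * (1 / \<delta> + 2 * R)))"
      using Kn by (simp add: K_def d_def B_def)
  qed
  then show ?thesis by blast
qed

end

section \<open>Pairs of entire curves\<close>

text \<open>Sort by class and shift cyclically by n: every class is a block of length at most n.\<close>

lemma permutation_avoiding_classes:
  fixes \<kappa> :: "nat \<Rightarrow> nat"
  assumes cls: "\<And>v. card {j \<in> {1..q}. \<kappa> j = v} \<le> n" and q: "2 * n \<le> q" "0 < n"
  obtains \<sigma> where "bij_betw \<sigma> {1..q} {1..q}" "\<And>j. j \<in> {1..q} \<Longrightarrow> \<kappa> (\<sigma> j) \<noteq> \<kappa> j"
proof -
  define xs where "xs = sort_key \<kappa> [1..<Suc q]"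
  have xs: "distinct xs" "length xs = q" "set xs = {1..q}" "sorted (map \<kappa> xs)"
    by (auto simp: xs_def simp del: upt_Suc)
  have e: "bij_betw ((!) xs) {..<q} {1..q}"
    using bij_betw_nth[OF xs(1)] xs by simp
  \<comment> \<open>Otherwise all positions from \<open>s\<close> to \<open>t\<close> of the sorted
    list carry the same class, which makes more than \<open>n\<close> members.\<close>
  have long: "\<kappa> (xs ! s) \<noteq> \<kappa> (xs ! t)" if "s + n \<le> t" "t < q" for s t
  proof
    assume eq: "\<kappa> (xs ! s) = \<kappa> (xs ! t)"
    have mono: "\<kappa> (xs ! i) \<le> \<kappa> (xs ! j)" if "i \<le> j" "j < q" for i j
      using sorted_nth_mono[OF xs(4), of i j] that xs(2) by simp
    have "(!) xs ` {s..s + n} \<subseteq> {j \<in> {1..q}. \<kappa> j = \<kappa> (xs ! s)}"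
    proof (intro image_subsetI CollectI conjI)
      fix i assume i: "i \<in> {s..s + n}"
      then have "i < q" using that by auto
      then show "xs ! i \<in> {1..q}" using xs nth_mem by metis
      show "\<kappa> (xs ! i) = \<kappa> (xs ! s)"
        using mono[of s i] mono[of i t] eq i that \<open>i < q\<close> by auto
    qed
    then have "card ((!) xs ` {s..s + n}) \<le> card {j \<in> {1..q}. \<kappa> j = \<kappa> (xs ! s)}"
      by (intro card_mono) auto
    then have "card ((!) xs ` {s..s + n}) \<le> n" using cls[of "\<kappa> (xs ! s)"] by linarith
    moreover have "inj_on ((!) xs) {s..s + n}"
      using e that by (intro inj_on_subset[OF bij_betw_imp_inj_on[OF e]]) auto
    ultimately show False by (simp add: card_image)
  qed
  define p where "p = (\<lambda>t. (t + n) mod q)"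
  have q0: "0 < q" "n < q" using q by auto
  have "inj_on p {..<q}"
  proof (rule inj_onI)
    fix s t assume st: "s \<in> {..<q}" "t \<in> {..<q}" "p s = p t"
    have p: "p u = (if u + n < q then u + n else u + n - q)" if "u < q" for u
      using that q0 by (auto simp: p_def mod_if)
    show "s = t" using st q0 p[of s] p[of t] by (auto split: if_splits)
  qed
  moreover have "p ` {..<q} \<subseteq> {..<q}" using q0 by (auto simp: p_def)
  ultimately have p: "bij_betw p {..<q} {..<q}"
    by (simp add: bij_betw_def endo_inj_surj)
  have pne: "\<kappa> (xs ! p t) \<noteq> \<kappa> (xs ! t)" if "t < q" for t
  proof (cases "t + n < q")
    case True
    then show ?thesis using long[of t "t + n"] by (auto simp: p_def)
  next
    \<comment> \<open>Past the end of the list the shift moves back by \<open>q - n\<close> places,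
      and this is at least \<open>n\<close>.\<close>
    case False
    then have "p t = t + n - q" using that q0 by (auto simp: p_def mod_if)
    then show ?thesis using long[of "p t" t] that q False by auto
  qed
  define \<sigma> where "\<sigma> = (\<lambda>j. xs ! p (inv_into {..<q} ((!) xs) j))"
  have "bij_betw \<sigma> {1..q} {1..q}"
    using bij_betw_trans[OF bij_betw_inv_into[OF e] bij_betw_trans[OF p e]]
    by (simp add: \<sigma>_def comp_def)
  moreover have "\<kappa> (\<sigma> j) \<noteq> \<kappa> j" if "j \<in> {1..q}" for j
  proof -
    have "inv_into {..<q} ((!) xs) j < q" using bij_betw_inv_into[OF e] that by (auto simp: bij_betw_def)
    then show ?thesis using pne bij_betw_inv_into_right[OF e that] by (metis \<sigma>_def)
  qed
  ultimately show ?thesis using that by blast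
qed

text \<open>Takes the place of Borel's growth lemma: b i will be the characteristic function at the i-th radius of an
  increasing bounded sequence of radii.\<close>

lemma bounded_chain_le:
  fixes b :: "nat \<Rightarrow> real"
  assumes bd: "\<And>i. b i \<le> M" and "0 \<le> C"
    and step: "\<And>i. b i \<le> (b (i + 2) + b (i + 4)) / 4 + C * (real i + 1) + L"
  shows "b 0 \<le> 2 * L + 8 * C"
proof -
  \<comment> \<open>The subtracted expression satisfies the recursion with equality. What remains is
    a homogeneous inequality with total weight 1/2, which forces a finite supremum to be at most
    0.\<close>
  define x where "x = (\<lambda>i. b i - (2 * L + 2 * C * real i + 8 * C))"
  have bx: "bdd_above (range x)"
  proof (rule bdd_aboveI2)
    fix i show "x i \<le> M - 2 * L"
      using bd[of i] \<open>0 \<le> C\<close> mult_nonneg_nonneg[of C "real i"] unfolding x_def by linarith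
  qed
  have st: "x i \<le> (x (i + 2) + x (i + 4)) / 4" for i
    using step[of i] by (simp add: x_def field_simps)
  define X where "X = (SUP i. x i)"
  have xX: "x i \<le> X" for i unfolding X_def by (rule cSUP_upper[OF UNIV_I bx])
  have "X \<le> X / 2" unfolding X_def
  proof (rule cSUP_least)
    fix i show "x i \<le> Sup (range x) / 2" using st[of i] xX[of "i + 2"] xX[of "i + 4"] by (simp add: X_def)
  qed simp
  then have "X \<le> 0" by simp
  then show ?thesis using xX[of 0] by (simp add: x_def)
qed

text \<open>Pigeonhole: \<open>m + 1\<close> disjoint intervals of length \<open>w\<close> between
  \<open>s\<close> and \<open>s'\<close> cannot all contain one of at most \<open>m\<close> moduli
  of zeros. Every \<open>\<rho>\<close> in the middle half of a free interval has distance at least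
  \<open>w / 4\<close> from these moduli, and \<open>Q\<close> excludes only finitely many
  \<open>\<rho>\<close>.\<close>

lemma separated_radius:
  assumes \<Phi>: "\<Phi> holomorphic_on UNIV" "\<Phi> 0 \<noteq> 0" and Q: "Q holomorphic_on UNIV" "Q 0 \<noteq> 0"
    and s: "0 < s" "s < s'" and m: "card {a \<in> ball 0 s'. \<Phi> a = 0} \<le> m"
  obtains \<rho> where "s < \<rho>" "\<rho> < s'" "sep \<Phi> ((s' - s) / (4 * (real m + 1))) \<rho>" "\<And>z. norm z = \<rho> \<Longrightarrow> Q z \<noteq> 0"
proof -
  let ?A = "norm ` {a \<in> ball 0 s'. \<Phi> a = 0}"
  have finA: "finite {a \<in> ball 0 s'. \<Phi> a = 0}" by (rule finite_zeros_ball[OF \<Phi>])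
  have cA: "card ?A \<le> m" using card_image_le[OF finA, of norm] m by linarith
  define w where "w = (s' - s) / (real m + 1)"
  have w0: "0 < w" using s by (simp add: w_def)
  define I where "I = (\<lambda>l::nat. {s + real l * w <..< s + (real l + 1) * w})"
  have "\<exists>l\<le>m. I l \<inter> ?A = {}"
  proof (rule ccontr)
    assume "\<not> ?thesis"
    then have "\<forall>l\<in>{..m}. \<exists>x. x \<in> I l \<inter> ?A" by blast
    from bchoice[OF this] obtain x where x: "\<forall>l\<in>{..m}. x l \<in> I l \<inter> ?A" ..
    have "inj_on x {..m}"
    proof (rule linorder_inj_onI)
      fix l l' assume l: "l < l'" "l \<in> {..m}" "l' \<in> {..m}"
      have "real l + 1 \<le> real l'" using l(1) by simp
      then have "(real l + 1) * w \<le> real l' * w" using w0 by (intro mult_right_mono) auto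
      moreover have "x l < s + (real l + 1) * w" "s + real l' * w < x l'" using x l by (auto simp: I_def)
      ultimately show "x l \<noteq> x l'" by linarith
    qed auto
    then have "card (x ` {..m}) = Suc m" by (simp add: card_image)
    moreover have "card (x ` {..m}) \<le> card ?A" using x finA by (intro card_mono) auto
    ultimately show False using cA by simp
  qed
  then obtain l where l: "l \<le> m" "I l \<inter> ?A = {}" by blast
  define u where "u = s + real l * w"
  have Il: "I l = {u <..< u + w}" by (simp add: I_def u_def algebra_simps)
  have us: "s \<le> u" "u + w \<le> s'"
  proof -
    show "s \<le> u" using w0 by (simp add: u_def)
    have "(real l + 1) * w \<le> (real m + 1) * w" using l(1) w0 by (intro mult_right_mono) auto
    also have "\<dots> = s' - s" by (simp add: w_def)
    finally show "u + w \<le> s'" by (simp add: u_def algebra_simps)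
  qed
  let ?B = "norm ` {z \<in> cball 0 s'. Q z = 0}"
  have "finite ?B" using finite_zeros_cball[OF Q] by blast
  moreover have "infinite {u + w/4 <..< u + 3*w/4}" using w0 by (simp add: infinite_Ioo)
  ultimately have "infinite ({u + w/4 <..< u + 3*w/4} - ?B)"
    by (intro Diff_infinite_finite)
  then have "{u + w/4 <..< u + 3*w/4} - ?B \<noteq> {}" by (metis finite.emptyI)
  then obtain \<rho> where "\<rho> \<in> {u + w/4 <..< u + 3*w/4} - ?B" by blast
  then have \<rho>: "u + w/4 < \<rho>" "\<rho> < u + 3*w/4" "\<rho> \<notin> ?B" by simp_all
  have "s < \<rho>" "\<rho> < s'" using \<rho> us w0 by auto
  moreover have "sep \<Phi> ((s' - s) / (4 * (real m + 1))) \<rho>"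
    unfolding sep_def
  proof (intro allI impI)
    fix a assume a: "\<Phi> a = 0"
    have "norm a \<notin> {u <..< u + w}"
    proof
      assume "norm a \<in> {u <..< u + w}"
      then have "a \<in> ball 0 s'" using us by auto
      then have "norm a \<in> ?A" using a by auto
      then show False using l(2) Il \<open>norm a \<in> {u <..< u + w}\<close> by auto
    qed
    then have "norm a \<le> u \<or> u + w \<le> norm a" by auto
    then have "w / 4 \<le> \<bar>norm a - \<rho>\<bar>" using \<rho>(1,2) w0 by (auto simp: abs_if)
    moreover have "(s' - s) / (4 * (real m + 1)) = w / 4" by (simp add: w_def)
    ultimately show "(s' - s) / (4 * (real m + 1)) \<le> \<bar>norm a - \<rho>\<bar>" by (simp only:)
  qed
  moreover have "Q z \<noteq> 0" if "norm z = \<rho>" for z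
    using \<rho>(3) that \<open>\<rho> < s'\<close> by auto
  ultimately show ?thesis by (rule that)
qed

text \<open>A zero in \<open>ball 0 s\<close> has weight \<open>ln (r / norm a)\<close>, which is at
  least \<open>1 - s / r\<close>, in the integrated count.\<close>

lemma zcount_le_Ncount:
  assumes F: "F holomorphic_on UNIV" "F 0 \<noteq> 0" and s: "0 < s" "s < r"
  shows "real (zcount F s) * ((r - s) / r) \<le> Ncount (ord F) r"
proof -
  let ?Z = "{z \<in> ball 0 r. F z = 0}"
  have "real (zcount F s) * ((r - s) / r) = (\<Sum>a | a \<in> ball 0 s \<and> F a = 0. real (ord F a) * ((r - s) / r))"
    by (simp add: zcount_def sum_distrib_right sum_divide_distrib)
  also have "\<dots> \<le> (\<Sum>a | a \<in> ball 0 s \<and> F a = 0. real (ord F a) * ln (r / norm a))"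
  proof (intro sum_mono mult_left_mono)
    fix a assume "a \<in> {a. a \<in> ball 0 s \<and> F a = 0}"
    then have a: "0 < norm a" "norm a < s" using F(2) by auto
    have "ln (norm a / r) \<le> norm a / r - 1" using a s by (intro ln_le_minus_one) auto
    moreover have "ln (norm a / r) = - ln (r / norm a)" using a s by (simp add: ln_div)
    moreover have "norm a / r \<le> s / r" using a s by (intro divide_right_mono) auto
    moreover have "(r - s) / r = 1 - s / r" using s by (simp add: field_simps)
    ultimately show "(r - s) / r \<le> ln (r / norm a)" by linarith
  qed auto
  also have "\<dots> \<le> (\<Sum>a\<in>?Z. real (ord F a) * ln (r / norm a))"
    using finite_zeros_ball[OF F, of r] s
    by (intro sum_mono2 mult_nonneg_nonneg ln_ratio_nonneg) auto
  also have "\<dots> = Ncount (ord F) r"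
    using finite_zeros_ball[OF F, of r] ord_eq_0
    by (intro Ncount_eq[symmetric]) (auto intro: ccontr)
  finally show ?thesis .
qed

lemma card_zeros_le_zcount:
  assumes "F holomorphic_on UNIV" "F 0 \<noteq> 0"
  shows "card {z \<in> ball 0 s. F z = 0} \<le> zcount F s"
proof -
  have "card {z \<in> ball 0 s. F z = 0} = (\<Sum>z\<in>{z \<in> ball 0 s. F z = 0}. 1)" by simp
  also have "\<dots> \<le> (\<Sum>z\<in>{z \<in> ball 0 s. F z = 0}. ord F z)"
    using ord_pos_iff[OF assms] by (intro sum_mono) (auto simp: Suc_le_eq)
  finally show ?thesis by (simp add: zcount_def)
qed

text \<open>The free slope \<open>1 / m\<close> allows the logarithm of a quantity to be absorbed by
  a small multiple of the quantity itself.\<close>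

lemma ln_le_linear:
  fixes x m :: real
  assumes "0 < x" "0 < m"
  shows "ln x \<le> x / m + ln m"
  using ln_le_minus_one[of "x / m"] assms by (simp add: ln_div)

text \<open>Here \<open>d'\<close>, \<open>e\<close>, \<open>R\<close>, \<open>S\<close> stand for
  \<open>1 / \<delta>\<close>, \<open>1 / \<eta>\<close>, the outer radius and
  \<open>2 * S' + K\<close> in \<open>key_constants\<close>. All of them are bounded by powers of
  one quantity \<open>Y\<close>, so the logarithm of the whole is at most a constant plus
  \<open>6 * ln Y\<close>.\<close>

lemma log_derivative_bound_le_power:
  fixes Y :: real
  assumes Y: "1 \<le> Y" and d: "0 \<le> d'" "d' \<le> c1 * Y\<^sup>2" "0 \<le> e" "e \<le> 8 * Y" "0 \<le> R" "R \<le> Y" "0 \<le> S" "S \<le> 2 * Y"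
    and c1: "0 \<le> c1"
  shows "16 * Y * d' + e + 2 * R * e\<^sup>2 * (S + 2 * (16 * Y) * (d' + 2 * R))
     \<le> (16 * c1 + 8 + 128 * (2 + 32 * (c1 + 2))) * Y ^ 6"
proof -
  have p: "Y ^ i \<le> Y ^ 6" if "i \<le> 6" for i using Y that by (intro power_increasing) auto
  have 1: "16 * Y * d' \<le> 16 * c1 * Y ^ 6"
  proof -
    have "16 * Y * d' \<le> 16 * Y * (c1 * Y\<^sup>2)" using Y d by (intro mult_left_mono) auto
    also have "\<dots> = 16 * c1 * Y ^ 3" by (simp add: power_numeral_reduce)
    also have "\<dots> \<le> 16 * c1 * Y ^ 6" using p[of 3] c1 by (intro mult_left_mono) auto
    finally show ?thesis .
  qed
  have 2: "e \<le> 8 * Y ^ 6" using d(4) p[of 1] by simp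
  have 3: "S + 2 * (16 * Y) * (d' + 2 * R) \<le> (2 + 32 * (c1 + 2)) * Y ^ 3"
  proof -
    have "R \<le> Y\<^sup>2" using d(6) power_increasing[of 1 2 Y] Y by simp
    then have "2 * (16 * Y) * (d' + 2 * R) \<le> 2 * (16 * Y) * (c1 * Y\<^sup>2 + 2 * Y\<^sup>2)"
      using Y d by (intro mult_left_mono add_mono) auto
    also have "\<dots> = 32 * (c1 + 2) * Y ^ 3" by (simp add: power_numeral_reduce algebra_simps)
    finally have "2 * (16 * Y) * (d' + 2 * R) \<le> 32 * (c1 + 2) * Y ^ 3" .
    moreover have "S \<le> 2 * Y ^ 3" using d(8) power_increasing[of 1 3 Y] Y by simp
    ultimately show ?thesis by (simp add: distrib_right)
  qed
  have "2 * R * e\<^sup>2 \<le> 2 * Y * (8 * Y)\<^sup>2"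
    using d Y by (intro mult_mono power_mono) auto
  also have "\<dots> = 128 * Y ^ 3" by (simp add: power_numeral_reduce)
  finally have 4: "2 * R * e\<^sup>2 \<le> 128 * Y ^ 3" .
  have "2 * R * e\<^sup>2 * (S + 2 * (16 * Y) * (d' + 2 * R)) \<le> 128 * Y ^ 3 * ((2 + 32 * (c1 + 2)) * Y ^ 3)"
    using d Y by (intro mult_mono[OF 4 3]) auto
  also have "\<dots> = 128 * (2 + 32 * (c1 + 2)) * Y ^ 6" by (simp add: power_numeral_reduce)
  finally show ?thesis using 1 2 by (simp add: distrib_right)
qed

lemma min_ord_le_ord:
  assumes F: "F holomorphic_on UNIV" "F x \<noteq> 0" and G: "G holomorphic_on UNIV" "G y \<noteq> 0"
    and AB: "A holomorphic_on UNIV" "B holomorphic_on UNIV"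
    and P: "\<And>z. P z = F z * A z - G z * B z" "P w \<noteq> 0"
  shows "min (ord F z) (ord G z) \<le> ord P z"
proof -
  let ?m = "min (ord F z) (ord G z)"
  obtain H where H: "H holomorphic_on UNIV" "\<And>u. F u = (u - z) ^ ord F z * H u"
    using entire_factor_ord[OF F] by blast
  obtain K where K: "K holomorphic_on UNIV" "\<And>u. G u = (u - z) ^ ord G z * K u"
    using entire_factor_ord[OF G] by blast
  have pw: "P = (\<lambda>u. F u * A u - G u * B u)" using P(1) by blast
  have split: "(u - z) ^ m = (u - z) ^ ?m * (u - z) ^ (m - ?m)" if "?m \<le> m" for u m
    using that by (metis le_add_diff_inverse power_add)
  show ?thesis
  proof (rule le_ordI)
    show "P holomorphic_on UNIV" unfolding pw by (intro holomorphic_intros F G AB)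
    show "P w \<noteq> 0" by fact
    show "(\<lambda>u. (u - z) ^ (ord F z - ?m) * H u * A u - (u - z) ^ (ord G z - ?m) * K u * B u) holomorphic_on UNIV"
      by (intro holomorphic_intros H K AB)
    fix u
    have "F u = (u - z) ^ ?m * (u - z) ^ (ord F z - ?m) * H u"
      unfolding H(2)[of u] by (subst split) auto
    moreover have "G u = (u - z) ^ ?m * (u - z) ^ (ord G z - ?m) * K u"
      unfolding K(2)[of u] by (subst split) auto
    ultimately show "P u = (u - z) ^ ?m * ((u - z) ^ (ord F z - ?m) * H u * A u - (u - z) ^ (ord G z - ?m) * K u * B u)"
      unfolding P(1) by (simp add: right_diff_distrib mult.assoc)
  qed
qed

lemma lf_wedge:
  assumes "\<And>i l. i \<le> n \<Longrightarrow> l \<le> n \<Longrightarrow> f i z * g l z = f l z * g i z"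
  shows "lf n f b z * lf n g b' z = lf n g b z * lf n f b' z"
proof -
  have "lf n f b z * lf n g b' z = (\<Sum>i\<le>n. \<Sum>l\<le>n. b i * b' l * (f i z * g l z))"
    by (simp add: lf_def sum_product mult_ac)
  also have "\<dots> = (\<Sum>i\<le>n. \<Sum>l\<le>n. b i * b' l * (g i z * f l z))"
    by (intro sum.cong refl) (use assms in \<open>simp add: mult.commute\<close>)
  also have "\<dots> = lf n g b z * lf n f b' z"
    by (simp add: lf_def sum_product mult_ac)
  finally show ?thesis .
qed

text \<open>In the application \<open>\<kappa> = 1 / (k + 1)\<close>, and \<open>good j z\<close> says that z is a zero of the j-th linear form of both
  curves with orders at most k. The form given by b has zeros in arithmetic progression, so the
  characteristic function of f grows at least linearly.\<close>

locale curve_pair = F: entire_curve n q f a + G: entire_curve n q g a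
  for n q :: nat and f g :: "nat \<Rightarrow> complex \<Rightarrow> complex" and a :: "nat \<Rightarrow> nat \<Rightarrow> complex" +
  fixes \<sigma> :: "nat \<Rightarrow> nat" and good :: "nat \<Rightarrow> complex \<Rightarrow> bool" and \<kappa> c :: real
    and b :: "nat \<Rightarrow> complex" and t0 :: complex
  assumes n: "1 \<le> n" and q2: "2 * n + 2 \<le> q"
    and \<sigma>: "bij_betw \<sigma> {1..q} {1..q}" "\<And>j. j \<in> {1..q} \<Longrightarrow> \<sigma> j \<noteq> j"
    and P0: "\<And>j. j \<in> {1..q} \<Longrightarrow> lf n f (a j) 0 * lf n g (a (\<sigma> j)) 0 - lf n g (a j) 0 * lf n f (a (\<sigma> j)) 0 \<noteq> 0"
    and \<kappa>: "0 \<le> \<kappa>"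
    and good_or: "\<And>j z. \<lbrakk>j \<in> {1..q}; lf n f (a j) z = 0 \<or> lf n g (a j) z = 0\<rbrakk> \<Longrightarrow>
        good j z \<or> 1 \<le> \<kappa> * real (ord (lf n f (a j)) z + ord (lf n g (a j)) z)"
    and good_zero: "\<And>j z. \<lbrakk>j \<in> {1..q}; good j z\<rbrakk> \<Longrightarrow> lf n f (a j) z = 0 \<and> lf n g (a j) z = 0"
    and good_wedge: "\<And>j z i l. \<lbrakk>j \<in> {1..q}; good j z; i \<le> n; l \<le> n\<rbrakk> \<Longrightarrow> f i z * g l z = f l z * g i z"
    and good_unique: "\<And>i j z. \<lbrakk>i \<in> {1..q}; j \<in> {1..q}; good i z; good j z\<rbrakk> \<Longrightarrow> i = j"
    and c: "c = 2 + (real q - 2 - 2 * real n) / (2 * real n)"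
    and num: "real q + 2 * real n * real q * c * \<kappa> < c * (real q - real n - 1)"
    and h0: "lf n f b 0 \<noteq> 0" and hz: "\<And>k::nat. lf n f b (t0 + of_nat k * (2 * of_real pi * \<i>)) = 0"
begin

abbreviation "P j z \<equiv> lf n f (a j) z * lf n g (a (\<sigma> j)) z - lf n g (a j) z * lf n f (a (\<sigma> j)) z"

lemma \<sigma>_mem: "j \<in> {1..q} \<Longrightarrow> \<sigma> j \<in> {1..q}"
  using \<sigma>(1) by (auto simp: bij_betw_def)

lemma P_hol: "(\<lambda>z. P j z) holomorphic_on UNIV"
  by (intro holomorphic_intros F.lf_hol G.lf_hol)

lemma c2: "2 \<le> c"
  using c q2 n by simp

text \<open>Besides \<open>P j0\<close>, the functions \<open>F j0\<close> and \<open>G j0\<close>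
  enter \<open>P j1\<close> with \<open>\<sigma> j1 = j0\<close>, and \<open>j1 \<noteq> j0\<close>
  because \<open>\<sigma>\<close> has no fixed point in the range. The other \<open>q - 2\<close>
  functions vanish since the two curves agree at a good point.\<close>

lemma sum_ord_P_ge:
  assumes j0: "j0 \<in> {1..q}" "good j0 z"
  shows "2 * min (ord (F.F j0) z) (ord (G.F j0) z) + (q - 2) \<le> (\<Sum>j\<in>{1..q}. ord (\<lambda>z. P j z) z)"
proof -
  let ?m = "min (ord (F.F j0) z) (ord (G.F j0) z)"
  obtain j1 where j1: "j1 \<in> {1..q}" "\<sigma> j1 = j0" using \<sigma>(1) j0(1)
      by (metis bij_betwE bij_betw_inv_into bij_betw_inv_into_right)
  have ne: "j1 \<noteq> j0" using \<sigma>(2) j1 by metis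
  have one: "1 \<le> ord (\<lambda>z. P j z) z" if "j \<in> {1..q}" for j
  proof -
    have "P j z = 0" using lf_wedge[of n f z g "a j" "a (\<sigma> j)"] good_wedge[OF j0] by simp
    then show ?thesis using ord_pos_iff[OF P_hol P0[OF that]] by (simp add: Suc_le_eq)
  qed
  have "?m \<le> ord (\<lambda>z. P j0 z) z"
    by (rule min_ord_le_ord[where x = 0 and y = 0 and w = 0 and A = "G.F (\<sigma> j0)" and B = "F.F (\<sigma> j0)"])
      (use j0(1) P0[OF j0(1)] in \<open>auto intro!: F.lf_hol G.lf_hol F.F0 G.F0\<close>)
  moreover have "min (ord (G.F j0) z) (ord (F.F j0) z) \<le> ord (\<lambda>z. P j1 z) z"
    by (rule min_ord_le_ord[where x = 0 and y = 0 and w = 0 and A = "F.F j1" and B = "G.F j1"])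
      (use j0(1) P0[OF j1(1)] in \<open>auto intro!: F.lf_hol G.lf_hol F.F0 G.F0 simp: j1(2) mult.commute\<close>)
  moreover have "(\<Sum>j\<in>{1..q}. ord (\<lambda>z. P j z) z) = ord (\<lambda>z. P j0 z) z + (ord (\<lambda>z. P j1 z) z
      + (\<Sum>j\<in>{1..q} - {j0} - {j1}. ord (\<lambda>z. P j z) z))"
    using j0(1) j1(1) ne by (subst sum.remove[of _ j0], simp, simp, subst sum.remove[of _ j1]) auto
  moreover have "q - 2 \<le> (\<Sum>j\<in>{1..q} - {j0} - {j1}. ord (\<lambda>z. P j z) z)"
  proof -
    have "card ({1..q} - {j0} - {j1}) = q - 2" using j0(1) j1(1) ne by (simp add: card_Diff_singleton)
    then have "q - 2 = (\<Sum>j\<in>{1..q} - {j0} - {j1}. 1)" by simp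
    also have "\<dots> \<le> (\<Sum>j\<in>{1..q} - {j0} - {j1}. ord (\<lambda>z. P j z) z)" by (intro sum_mono one) auto
    finally show ?thesis .
  qed
  ultimately show ?thesis by (simp add: min.commute)
qed

text \<open>This is the origin of \<open>c\<close>. At a good point \<open>x j0\<close> is at most
  \<open>min + n\<close> and at most \<open>2 * n\<close>. Hence \<open>2 * x j0\<close> is at most
  \<open>2 * min + 2 * n\<close>, and \<open>(c - 2) * x j0\<close> is at most
  \<open>q - 2 - 2 * n\<close>; together this is exactly the bound of \<open>sum_ord_P_ge\<close>.
  At a zero that is not good, \<open>\<kappa>\<close> times the sum of the orders is at least 1, so
  the second sum pays for the left side, which is at most \<open>2 * n * c\<close>.\<close>

lemma pointwise_ord_inequality:
  "c * (real (\<Sum>j\<in>{1..q}. min (ord (F.F j) z) n) + real (\<Sum>j\<in>{1..q}. min (ord (G.F j) z) n)) \<le>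
     (\<Sum>j\<in>{1..q}. real (ord (\<lambda>z. P j z) z)) + (\<Sum>j\<in>{1..q}. 2 * real n * c * \<kappa> * real (ord (F.F j) z + ord (G.F j) z))"
proof -
  define x where "x = (\<lambda>j. real (min (ord (F.F j) z) n) + real (min (ord (G.F j) z) n))"
  define y where "y = (\<lambda>j. 2 * real n * c * \<kappa> * real (ord (F.F j) z + ord (G.F j) z))"
  have y0: "0 \<le> y j" for j using c2 \<kappa> by (simp add: y_def)
  have x2: "x j \<le> 2 * real n" for j unfolding x_def by linarith
  have bad: "c * x j \<le> y j" if j: "j \<in> {1..q}" "\<not> good j z" for j
  proof (cases "F.F j z = 0 \<or> G.F j z = 0")
    case True
    then have "1 \<le> \<kappa> * real (ord (F.F j) z + ord (G.F j) z)" using good_or[OF j(1) True] j(2) by blast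
    then have "2 * real n * c * 1 \<le> 2 * real n * c * (\<kappa> * real (ord (F.F j) z + ord (G.F j) z))"
      using c2 by (intro mult_left_mono) auto
    moreover have "c * x j \<le> c * (2 * real n)" using x2 c2 by (intro mult_left_mono) auto
    ultimately show ?thesis by (simp add: y_def mult_ac)
  next
    case False
    then show ?thesis using ord_eq_0[of "F.F j" z] ord_eq_0[of "G.F j" z] by (simp add: x_def y_def)
  qed
  have "(\<Sum>j\<in>{1..q}. c * x j) \<le> (\<Sum>j\<in>{1..q}. real (ord (\<lambda>z. P j z) z)) + (\<Sum>j\<in>{1..q}. y j)"
  proof (cases "\<exists>j0\<in>{1..q}. good j0 z")
    case False
    then have "(\<Sum>j\<in>{1..q}. c * x j) \<le> (\<Sum>j\<in>{1..q}. y j)" by (intro sum_mono bad) auto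
    moreover have "0 \<le> (\<Sum>j\<in>{1..q}. real (ord (\<lambda>z. P j z) z))" by (intro sum_nonneg) auto
    ultimately show ?thesis by linarith
  next
    case True
    then obtain j0 where j0: "j0 \<in> {1..q}" "good j0 z" by blast
    have nb: "\<not> good j z" if "j \<in> {1..q} - {j0}" for j using good_unique[of j j0 z] j0 that by auto
    have "(\<Sum>j\<in>{1..q} - {j0}. c * x j) \<le> (\<Sum>j\<in>{1..q} - {j0}. y j)" using nb by (intro sum_mono bad) auto
    moreover have "(\<Sum>j\<in>{1..q}. c * x j) = c * x j0 + (\<Sum>j\<in>{1..q} - {j0}. c * x j)"
      "(\<Sum>j\<in>{1..q}. y j) = y j0 + (\<Sum>j\<in>{1..q} - {j0}. y j)"
      using j0(1) by (simp_all add: sum.remove)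
    moreover have "c * x j0 \<le> real (\<Sum>j\<in>{1..q}. ord (\<lambda>z. P j z) z)"
    proof -
      let ?m = "min (ord (F.F j0) z) (ord (G.F j0) z)"
      have "x j0 \<le> real ?m + real n" unfolding x_def by linarith
      moreover have "(real q - 2 - 2 * real n) / (2 * real n) * x j0
          \<le> (real q - 2 - 2 * real n) / (2 * real n) * (2 * real n)"
        using x2[of j0] q2 by (intro mult_left_mono) auto
      moreover have "(real q - 2 - 2 * real n) / (2 * real n) * (2 * real n) = real q - 2 - 2 * real n" using n by simp
      ultimately have "c * x j0 \<le> 2 * real ?m + (real q - 2)" unfolding c distrib_right by linarith
      also have "\<dots> = real (2 * ?m + (q - 2))" using q2 by simp
      also have "\<dots> \<le> real (\<Sum>j\<in>{1..q}. ord (\<lambda>z. P j z) z)" using sum_ord_P_ge[OF j0] by (simp only: of_nat_le_iff)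
      finally show ?thesis .
    qed
    ultimately show ?thesis using y0[of j0] by simp
  qed
  moreover have "(\<Sum>j\<in>{1..q}. c * x j) = c * (real (\<Sum>j\<in>{1..q}. min (ord (F.F j) z) n)
      + real (\<Sum>j\<in>{1..q}. min (ord (G.F j) z) n))"
    by (simp add: x_def sum_distrib_left[symmetric] sum.distrib)
  ultimately show ?thesis by (simp add: y_def)
qed

text \<open>Two products with different tasks: the zeros of \<open>\<Phi>\<close> must keep a
  distance from the chosen circles, while those of \<open>Q\<close> must merely not lie on them, so
  that Jensen's formula applies to every factor.\<close>

definition "\<Phi> z = (\<Prod>j\<in>{1..q}. F.F j z * G.F j z)"

definition "Q z = \<Phi> z * (wron (Suc n) f z * wron (Suc n) g z * (\<Prod>j\<in>{1..q}. P j z) * lf n f b z)"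

definition "S r = Tchar n f r + Tchar n g r"

lemma \<Phi>_hol: "\<Phi> holomorphic_on UNIV"
  unfolding \<Phi>_def by (intro holomorphic_intros F.lf_hol G.lf_hol)

lemma \<Phi>0: "\<Phi> 0 \<noteq> 0"
  unfolding \<Phi>_def using F.F0 G.F0 by (simp add: prod_zero_iff)

lemma Q_hol: "Q holomorphic_on UNIV"
proof -
  have "wron (Suc n) f holomorphic_on UNIV" "wron (Suc n) g holomorphic_on UNIV"
    using F.hol G.hol by (auto intro!: wron_holomorphic)
  moreover have "\<Phi> holomorphic_on UNIV" by (rule \<Phi>_hol)
  ultimately show ?thesis unfolding Q_def
    by (intro holomorphic_on_mult holomorphic_on_prod P_hol F.lf_hol) 
qed

lemma Q0: "Q 0 \<noteq> 0"
  unfolding Q_def using \<Phi>0 F.W0 G.W0 P0 h0 by (simp add: prod_zero_iff)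

text \<open>One constant for all circles free of zeros of \<open>Q\<close>. The lower bounds for the
  characteristic functions come from counting functions being nonnegative.\<close>

definition generic_bound :: "real \<Rightarrow> bool" where
  "generic_bound C \<longleftrightarrow> 0 \<le> C \<and> (\<forall>r. 0 < r \<longrightarrow> (\<forall>z. norm z = r \<longrightarrow> Q z \<noteq> 0) \<longrightarrow>
      (\<forall>j\<in>{1..q}. Ncount (ord (F.F j)) r \<le> Tchar n f r + C \<and> Ncount (ord (G.F j)) r \<le> Tchar n g r + C
         \<and> Ncount (ord (\<lambda>z. P j z)) r \<le> S r + C) \<and> Ncount (ord (lf n f b)) r \<le> Tchar n f r + C
       \<and> - C \<le> Tchar n f r \<and> - C \<le> Tchar n g r)"

lemma generic_boundD:
  assumes "generic_bound C" "0 < r" "\<And>z. norm z = r \<Longrightarrow> Q z \<noteq> 0"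
  shows "(\<forall>j\<in>{1..q}. Ncount (ord (F.F j)) r \<le> Tchar n f r + C \<and> Ncount (ord (G.F j)) r \<le> Tchar n g r + C
         \<and> Ncount (ord (\<lambda>z. P j z)) r \<le> S r + C) \<and> Ncount (ord (lf n f b)) r \<le> Tchar n f r + C
       \<and> - C \<le> Tchar n f r \<and> - C \<le> Tchar n g r"
  using assms unfolding generic_bound_def by simp

lemma generic_bound_exists: "\<exists>C. generic_bound C"
proof -
  define B where "B = (\<lambda>j. \<Sum>i\<le>n. norm (a j i))"
  define CF where "CF = (\<lambda>j. \<bar>ln (B j)\<bar> + \<bar>ln (norm (F.F j 0))\<bar>)"
  define CG where "CG = (\<lambda>j. \<bar>ln (B j)\<bar> + \<bar>ln (norm (G.F j 0))\<bar>)"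
  define CP where "CP = (\<lambda>j. \<bar>ln (2 * B j * B (\<sigma> j))\<bar> + \<bar>ln (norm (P j 0))\<bar>)"
  define Ch where "Ch = \<bar>ln (\<Sum>i\<le>n. norm (b i))\<bar> + \<bar>ln (norm (lf n f b 0))\<bar>"
  define C where "C = (\<Sum>j\<in>{1..q}. CF j + CG j + CP j) + Ch"
  have nn: "0 \<le> CF j" "0 \<le> CG j" "0 \<le> CP j" "0 \<le> Ch" for j by (auto simp: CF_def CG_def CP_def Ch_def)
  have Cj: "CF j + CG j + CP j \<le> C" if "j \<in> {1..q}" for j
  proof -
    have "CF j + CG j + CP j \<le> (\<Sum>j\<in>{1..q}. CF j + CG j + CP j)"
      using that nn by (intro member_le_sum) (auto intro!: add_nonneg_nonneg)
    then show ?thesis using nn(4) by (simp add: C_def)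
  qed
  have Chle: "Ch \<le> C" unfolding C_def using nn by (simp add: sum_nonneg)
  have Bpos: "0 < B j" if "j \<in> {1..q}" for j
    using F.hyperplane_nonzero[OF that] by (auto simp: B_def intro!: sum_pos2)
  have "(\<forall>j\<in>{1..q}. Ncount (ord (F.F j)) r \<le> Tchar n f r + C \<and> Ncount (ord (G.F j)) r \<le> Tchar n g r + C
         \<and> Ncount (ord (\<lambda>z. P j z)) r \<le> S r + C) \<and> Ncount (ord (lf n f b)) r \<le> Tchar n f r + C
       \<and> - C \<le> Tchar n f r \<and> - C \<le> Tchar n g r" if r: "0 < r" and nz: "\<And>z. norm z = r \<Longrightarrow> Q z \<noteq> 0" for r
  proof -
    have nzF: "F.F j z \<noteq> 0" and nzG: "G.F j z \<noteq> 0" and nzP: "P j z \<noteq> 0" if "j \<in> {1..q}" "norm z = r" for j z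
      using nz[OF that(2)] that(1) unfolding Q_def \<Phi>_def by (auto simp: prod_zero_iff)
    have nzh: "lf n f b z \<noteq> 0" if "norm z = r" for z using nz[OF that] by (auto simp: Q_def)
    have F1: "Ncount (ord (F.F j)) r \<le> Tchar n f r + CF j" if "j \<in> {1..q}" for j
      using F.Ncount_lf_le[OF F.F0[OF that] r nzF[OF that]] by (simp add: CF_def B_def)
    have G1: "Ncount (ord (G.F j)) r \<le> Tchar n g r + CG j" if "j \<in> {1..q}" for j
      using G.Ncount_lf_le[OF G.F0[OF that] r nzG[OF that]] by (simp add: CG_def B_def)
    have P1: "Ncount (ord (\<lambda>z. P j z)) r \<le> S r + CP j" if j: "j \<in> {1..q}" for j
    proof -
      have "cmean (\<lambda>z. ln (norm (P j z))) r \<le> cmean (\<lambda>z. (ln (F.nrm z) + ln (G.nrm z)) + ln (2 * B j * B (\<sigma> j))) r"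
      proof (rule cmean_mono)
        show "continuous_on (sphere 0 r) (\<lambda>z. ln (norm (P j z)))"
          using nzP[OF j] by (intro continuous_on_ln_norm P_hol) auto
        show "continuous_on (sphere 0 r) (\<lambda>z. (ln (F.nrm z) + ln (G.nrm z)) + ln (2 * B j * B (\<sigma> j)))"
          by (intro continuous_on_add F.continuous_ln_nrm G.continuous_ln_nrm continuous_on_const)
        fix z :: complex assume z: "norm z = r"
        have "norm (P j z) \<le> norm (F.F j z) * norm (G.F (\<sigma> j) z) + norm (G.F j z) * norm (F.F (\<sigma> j) z)"
          by (rule order_trans[OF norm_triangle_ineq4]) (simp add: norm_mult)
        also have "\<dots> \<le> (B j * F.nrm z) * (B (\<sigma> j) * G.nrm z) + (B j * G.nrm z) * (B (\<sigma> j) * F.nrm z)"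
          unfolding B_def by (intro add_mono mult_mono F.lf_le G.lf_le mult_nonneg_nonneg sum_nonneg) auto
        also have "\<dots> = (F.nrm z * G.nrm z) * (2 * B j * B (\<sigma> j))" by (simp add: algebra_simps)
        finally have "ln (norm (P j z)) \<le> ln ((F.nrm z * G.nrm z) * (2 * B j * B (\<sigma> j)))"
          using nzP[OF j z] by (intro ln_mono) auto
        also have "\<dots> = (ln (F.nrm z) + ln (G.nrm z)) + ln (2 * B j * B (\<sigma> j))"
          using F.nrm_pos[of z] G.nrm_pos[of z] Bpos[OF j] Bpos[OF \<sigma>_mem[OF j]]
          by (subst ln_mult_pos, simp, simp, subst ln_mult_pos) auto
        finally show "ln (norm (P j z)) \<le> (ln (F.nrm z) + ln (G.nrm z)) + ln (2 * B j * B (\<sigma> j))" .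
      qed (use r in auto)
      also have "\<dots> = S r + ln (2 * B j * B (\<sigma> j))"
        using r by (simp add: cmean_add continuous_on_add F.continuous_ln_nrm G.continuous_ln_nrm S_def Tchar_def)
      finally show ?thesis
        using jensen[OF P_hol P0[OF j] r nzP[OF j]] unfolding CP_def by linarith
    qed
    have one: "1 \<in> {1..q}" using q2 by simp
    have "- C \<le> Tchar n f r" "- C \<le> Tchar n g r"
      using F1[OF one] G1[OF one] Ncount_nonneg[of "ord (F.F 1)" r] Ncount_nonneg[of "ord (G.F 1)" r]
        Cj[OF one] nn(1)[of 1] nn(2)[of 1] nn(3)[of 1] by linarith+
    moreover have "Ncount (ord (lf n f b)) r \<le> Tchar n f r + C"
      using F.Ncount_lf_le[OF h0 r nzh] Chle by (simp add: Ch_def)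
    moreover have "Ncount (ord (F.F j)) r \<le> Tchar n f r + C \<and> Ncount (ord (G.F j)) r \<le> Tchar n g r + C
         \<and> Ncount (ord (\<lambda>z. P j z)) r \<le> S r + C" if "j \<in> {1..q}" for j
      using F1[OF that] G1[OF that] P1[OF that] Cj[OF that] nn(1)[of j] nn(2)[of j] nn(3)[of j] by linarith
    ultimately show ?thesis by blast
  qed
  moreover have "0 \<le> C" using Chle nn(4) by linarith
  ultimately show ?thesis unfolding generic_bound_def by blast
qed

lemma finite_ord_F: "j \<in> {1..q} \<Longrightarrow> finite {z \<in> ball 0 r. ord (F.F j) z \<noteq> 0}"
  by (rule finite_ord_support[OF F.lf_hol F.F0])

lemma finite_ord_G: "j \<in> {1..q} \<Longrightarrow> finite {z \<in> ball 0 r. ord (G.F j) z \<noteq> 0}"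
  by (rule finite_ord_support[OF G.lf_hol G.F0])

text \<open>\<open>Ncount_linear_mono\<close> applied to \<open>pointwise_ord_inequality\<close>;
  the pairs \<open>(j, i)\<close> merely index the three divisors that belong to
  \<open>j\<close>.\<close>

lemma sum_Ncount_le:
  "c * (Ncount (\<lambda>z. \<Sum>j\<in>{1..q}. min (ord (F.F j) z) n) r + Ncount (\<lambda>z. \<Sum>j\<in>{1..q}. min (ord (G.F j) z) n) r) \<le>
     (\<Sum>j\<in>{1..q}. Ncount (ord (\<lambda>z. P j z)) r + 2 * real n * c * \<kappa> * (Ncount (ord (F.F j)) r + Ncount (ord (G.F j)) r))"
proof -
  define \<mu> where "\<mu> = (\<lambda>i::nat. if i = 0 then (\<lambda>z. \<Sum>j\<in>{1..q}. min (ord (F.F j) z) n) else (\<lambda>z. \<Sum>j\<in>{1..q}. min (ord (G.F j) z) n))"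
  define \<nu> where "\<nu> = (\<lambda>(j, i::nat). if i = 0 then ord (\<lambda>z. P j z) else if i = 1 then ord (F.F j) else ord (G.F j))"
  define d where "d = (\<lambda>(j::nat, i::nat). if i = 0 then 1 else 2 * real n * c * \<kappa>)"
  have "(\<Sum>i\<in>{0, 1}. c * Ncount (\<mu> i) r) \<le> (\<Sum>x\<in>{1..q} \<times> {0, 1, 2}. d x * Ncount (\<nu> x) r)"
  proof (rule Ncount_linear_mono)
    fix i :: nat
    have "finite {z \<in> ball 0 r. (\<Sum>j\<in>{1..q}. min (ord (F.F j) z) n) \<noteq> 0}"
      by (rule finite_subset[of _ "\<Union>j\<in>{1..q}. {z \<in> ball 0 r. ord (F.F j) z \<noteq> 0}"])
        (use finite_ord_F in \<open>auto simp: sum_eq_0_iff\<close>)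
    moreover have "finite {z \<in> ball 0 r. (\<Sum>j\<in>{1..q}. min (ord (G.F j) z) n) \<noteq> 0}"
      by (rule finite_subset[of _ "\<Union>j\<in>{1..q}. {z \<in> ball 0 r. ord (G.F j) z \<noteq> 0}"])
        (use finite_ord_G in \<open>auto simp: sum_eq_0_iff\<close>)
    ultimately show "finite {z \<in> ball 0 r. \<mu> i z \<noteq> 0}" by (cases
        "i = 0") (simp_all only: \<mu>_def if_True if_False simp_thms)
  next
    fix x assume "x \<in> {1..q} \<times> {0, 1, 2::nat}"
    then obtain j i where x: "x = (j, i)" "j \<in> {1..q}" by blast
    show "finite {z \<in> ball 0 r. \<nu> x z \<noteq> 0}"
      using finite_ord_F[OF x(2), of r] finite_ord_G[OF x(2), of r] finite_ord_support[OF P_hol P0[OF x(2)], of r]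
      unfolding x \<nu>_def prod.case by (cases "i = 0"; cases "i = 1") (simp_all only: if_True if_False simp_thms)
  next
    fix z :: complex
    have "(\<Sum>i\<in>{0, 1}. c * real (\<mu> i z)) = c * (real (\<Sum>j\<in>{1..q}. min (ord (F.F j) z) n)
        + real (\<Sum>j\<in>{1..q}. min (ord (G.F j) z) n))"
      by (simp add: \<mu>_def distrib_left)
    moreover have "(\<Sum>x\<in>{1..q} \<times> {0, 1, 2}. d x * real (\<nu> x z)) =
      (\<Sum>j\<in>{1..q}. real (ord (\<lambda>z. P j z) z)) + (\<Sum>j\<in>{1..q}. 2 * real n * c * \<kappa> * real (ord (F.F j) z + ord (G.F j) z))"
      by (simp add: sum.cartesian_product' d_def \<nu>_def sum.distrib[symmetric] algebra_simps)
    ultimately show "(\<Sum>i\<in>{0, 1}. c * real (\<mu> i z)) \<le> (\<Sum>x\<in>{1..q} \<times> {0, 1, 2}. d x * real (\<nu> x z))"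
      using pointwise_ord_inequality[of z] by (simp only:)
  qed auto
  then show ?thesis
    by (simp add: \<mu>_def \<nu>_def d_def sum.cartesian_product' distrib_left add.assoc)
qed

lemma \<Phi>_zero: "j \<in> {1..q} \<Longrightarrow> lf n f (a j) z = 0 \<or> lf n g (a j) z = 0 \<Longrightarrow> \<Phi> z = 0"
  unfolding \<Phi>_def by (rule prod_zero) auto

definition key_constants :: "real \<Rightarrow> real \<Rightarrow> real \<Rightarrow> bool" where
  "key_constants C2 C3 K \<longleftrightarrow> 0 \<le> C2 \<and> 0 \<le> C3 \<and> 0 \<le> K \<and> (\<forall>r \<eta> R \<delta> N S'. 0 < r \<longrightarrow> 0 < \<eta> \<longrightarrow> \<eta> \<le> 1 \<longrightarrow> r + 2 * \<eta> \<le> R \<longrightarrow> 0 < \<delta>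
      \<longrightarrow> sep \<Phi> \<delta> r \<longrightarrow> sep \<Phi> \<delta> R \<longrightarrow>
       (\<forall>j\<in>{1..q}. real (zcount (F.F j) R) \<le> N) \<longrightarrow> (\<forall>j\<in>{1..q}. real (zcount (G.F j) R) \<le> N) \<longrightarrow>
       (\<forall>z. norm z = r \<longrightarrow> Q z \<noteq> 0) \<longrightarrow> Tchar n f R \<le> S' \<longrightarrow> Tchar n g R \<le> S' \<longrightarrow> 0 \<le> S' \<longrightarrow>
      S r \<le> C2 + C3 * ln (N / \<delta> + 1 / \<eta> + 2 * R / \<eta>\<^sup>2 * (2 * S' + K + 2 * N * (1 / \<delta> + 2 * R))))"

lemma key_constantsD:
  assumes "key_constants C2 C3 K" "0 < r" "0 < \<eta>" "\<eta> \<le> 1" "r + 2 * \<eta> \<le> R" "0 < \<delta>" "sep \<Phi> \<delta> r" "sep \<Phi> \<delta> R"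
    "\<And>j. j \<in> {1..q} \<Longrightarrow> real (zcount (F.F j) R) \<le> N" "\<And>j. j \<in> {1..q} \<Longrightarrow> real (zcount (G.F j) R) \<le> N"
    "\<And>z. norm z = r \<Longrightarrow> Q z \<noteq> 0" "Tchar n f R \<le> S'" "Tchar n g R \<le> S'" "0 \<le> S'"
  shows "S r \<le> C2 + C3 * ln (N / \<delta> + 1 / \<eta> + 2 * R / \<eta>\<^sup>2 * (2 * S' + K + 2 * N * (1 / \<delta> + 2 * R)))"
  using assms(1)[unfolded key_constants_def, THEN conjunct2, THEN conjunct2, THEN conjunct2, rule_format, OF assms(2-14)] .

text \<open>Add the second main theorems of both curves, multiply by \<open>c\<close> and replace
  the truncated counts by those of the \<open>P j\<close>, each at most \<open>S r + C\<close>. Then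
  \<open>S r\<close> stands on both sides, and the surplus \<open>\<epsilon>\<close> of its
  coefficient on the left is positive by \<open>num\<close>.\<close>

lemma key_inequality: "\<exists>C2 C3 K. key_constants C2 C3 K"
proof -
  obtain C where C': "generic_bound C" using generic_bound_exists by blast
  then have C: "0 \<le> C" by (simp add: generic_bound_def)
  note Cb = generic_boundD[OF C']
  obtain Kf where Kf': "F.smt_constant Kf" using F.cartan_second_main_theorem by blast
  obtain Kg where Kg': "G.smt_constant Kg" using G.cartan_second_main_theorem by blast
  have Kf: "0 \<le> Kf" and Kg: "0 \<le> Kg"
    using Kf' Kg' by (simp_all add: F.smt_constant_def G.smt_constant_def)
  define K where "K = Kf + Kg"
  define w where "w = 2 * real n * c * \<kappa>"
  define \<epsilon> where "\<epsilon> = c * (real q - real n - 1) - real q - w * real q"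
  have \<epsilon>: "0 < \<epsilon>" using num by (simp add: \<epsilon>_def w_def mult_ac)
  have w0: "0 \<le> w" using c2 \<kappa> by (simp add: w_def)
  define C2 where "C2 = (real q * C + 2 * w * real q * C + c * K) / \<epsilon>"
  define C3 where "C3 = 2 * c * real (n * Suc n) / \<epsilon>"
  have sepF: "sep (F.F j) \<delta> r" if "sep \<Phi> \<delta> r" "j \<in> {1..q}" for j \<delta> r
    using that \<Phi>_zero unfolding sep_def by blast
  have sepG: "sep (G.F j) \<delta> r" if "sep \<Phi> \<delta> r" "j \<in> {1..q}" for j \<delta> r
    using that \<Phi>_zero unfolding sep_def by blast
  have "S r \<le> C2 + C3 * ln (N / \<delta> + 1 / \<eta> + 2 * R / \<eta>\<^sup>2 * (2 * S' + K + 2 * N * (1 / \<delta> + 2 * R)))"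
    if pos: "0 < r" "0 < \<eta>" "\<eta> \<le> 1" "r + 2 * \<eta> \<le> R" "0 < \<delta>" and s: "sep \<Phi> \<delta> r" "sep \<Phi> \<delta> R"
      and NF: "\<And>j. j \<in> {1..q} \<Longrightarrow> real (zcount (F.F j) R) \<le> N"
      and NG: "\<And>j. j \<in> {1..q} \<Longrightarrow> real (zcount (G.F j) R) \<le> N"
      and nz: "\<And>z. norm z = r \<Longrightarrow> Q z \<noteq> 0" and S': "Tchar n f R \<le> S'" "Tchar n g R \<le> S'" "0 \<le> S'"
    for r \<eta> R \<delta> N S' :: real
  proof -
    define d where "d = (\<lambda>K. N / \<delta> + 1 / \<eta> + 2 * R / \<eta>\<^sup>2 * (2 * S' + K + 2 * N * (1 / \<delta> + 2 * R)))"
    have N0: "0 \<le> N" using NF[of 1] q2 by simp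
    have R0: "0 < R" using pos by simp
    have dpos: "0 < d k" if "0 \<le> k" for k
      unfolding d_def using pos N0 R0 S'(3) that by (intro add_pos_nonneg add_nonneg_pos) auto
    have dle: "ln (d k) \<le> ln (d K)" if "0 \<le> k" "k \<le> K" for k
    proof (rule ln_mono)
      show "d k \<le> d K" unfolding d_def using that R0 by (intro add_left_mono mult_left_mono) auto
    qed (use dpos that in auto)
    have Wf: "wron (Suc n) f z \<noteq> 0" "wron (Suc n) g z \<noteq> 0" if "norm z = r" for z
      using nz[OF that] by (auto simp: Q_def)
    define m where "m = real (n * Suc n)"
    have m0: "0 \<le> m" by (simp add: m_def)
    have A: "(real q - real n - 1) * Tchar n f r \<le> Ncount (\<lambda>z. \<Sum>j\<in>{1..q}. min (ord (F.F j) z) n) r + Kf + m * ln (d Kf)"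
      unfolding d_def m_def by (rule F.smt_constantD[OF Kf']) (use pos s sepF NF Wf S' in auto)
    have B: "(real q - real n - 1) * Tchar n g r \<le> Ncount (\<lambda>z. \<Sum>j\<in>{1..q}. min (ord (G.F j) z) n) r + Kg + m * ln (d Kg)"
      unfolding d_def m_def by (rule G.smt_constantD[OF Kg']) (use pos s sepG NG Wf S' in auto)
    have "Kf \<le> K" "Kg \<le> K" using Kf Kg by (simp_all add: K_def)
    then have "m * ln (d Kf) \<le> m * ln (d K)" "m * ln (d Kg) \<le> m * ln (d K)"
      using m0 Kf Kg by (auto intro!: mult_left_mono dle)
    then have "(real q - real n - 1) * S r \<le>
      (Ncount (\<lambda>z. \<Sum>j\<in>{1..q}. min (ord (F.F j) z) n) r + Ncount (\<lambda>z. \<Sum>j\<in>{1..q}. min (ord (G.F j) z) n) r) + (K + 2 * m * ln (d K))"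
      using A B unfolding S_def K_def distrib_left by linarith
    then have "c * ((real q - real n - 1) * S r) \<le>
      c * ((Ncount (\<lambda>z. \<Sum>j\<in>{1..q}. min (ord (F.F j) z) n) r + Ncount (\<lambda>z. \<Sum>j\<in>{1..q}. min (ord (G.F j) z) n) r) + (K + 2 * m * ln (d K)))"
      using c2 by (intro mult_left_mono) auto
    also have "\<dots> \<le> (\<Sum>j\<in>{1..q}. Ncount (ord (\<lambda>z. P j z)) r + w * (Ncount (ord (F.F j)) r + Ncount (ord (G.F j)) r))
        + c * (K + 2 * m * ln (d K))"
      using sum_Ncount_le[of r] unfolding w_def distrib_left by simp
    also have "(\<Sum>j\<in>{1..q}. Ncount (ord (\<lambda>z. P j z)) r + w * (Ncount (ord (F.F j)) r + Ncount (ord (G.F j)) r))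
       \<le> (\<Sum>j\<in>{1..q}. (S r + C) + w * (S r + 2 * C))"
    proof (rule sum_mono)
      fix j assume j: "j \<in> {1..q}"
      have "Ncount (ord (F.F j)) r + Ncount (ord (G.F j)) r \<le> S r + 2 * C"
        using Cb[OF pos(1) nz] j unfolding S_def by fastforce
      then have "w * (Ncount (ord (F.F j)) r + Ncount (ord (G.F j)) r) \<le> w * (S r + 2 * C)"
        using w0 by (intro mult_left_mono)
      moreover have "Ncount (ord (\<lambda>z. P j z)) r \<le> S r + C" using Cb[OF pos(1) nz] j by blast
      ultimately show "Ncount (ord (\<lambda>z. P j z)) r + w * (Ncount (ord (F.F j)) r + Ncount (ord (G.F j)) r)
          \<le> (S r + C) + w * (S r + 2 * C)"
        by linarith
    qed
    also have "\<dots> = real q * ((S r + C) + w * (S r + 2 * C))" by simp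
    finally have "\<epsilon> * S r \<le> (real q * C + 2 * w * real q * C + c * K) + 2 * c * m * ln (d K)"
      by (simp add: \<epsilon>_def algebra_simps)
    then have "S r \<le> ((real q * C + 2 * w * real q * C + c * K) + 2 * c * m * ln (d K)) / \<epsilon>"
      using \<epsilon> by (simp add: pos_le_divide_eq mult.commute)
    also have "\<dots> = C2 + C3 * ln (d K)" by (simp add: C2_def C3_def m_def add_divide_distrib)
    finally show ?thesis by (simp add: d_def)
  qed
  moreover have "0 \<le> C2" "0 \<le> C3" "0 \<le> K"
    using C w0 c2 \<epsilon> Kf Kg by (auto simp: C2_def C3_def K_def)
  ultimately have "key_constants C2 C3 K" unfolding key_constants_def by simp
  then show ?thesis by blast
qed

text \<open>A crude bound from compactness. It supplies the a priori bound \<open>M\<close> without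
  which \<open>bounded_chain_le\<close> could not start.\<close>

lemma S_bounded:
  "\<exists>M. \<forall>r. 0 < r \<longrightarrow> r \<le> R \<longrightarrow> S r \<le> M"
proof -
  have "continuous_on (cball 0 R) (\<lambda>z. ln (F.nrm z) + ln (G.nrm z))"
    by (intro continuous_on_add F.continuous_ln_nrm G.continuous_ln_nrm)
  then have "bounded ((\<lambda>z. ln (F.nrm z) + ln (G.nrm z)) ` cball 0 R)"
    using compact_cball compact_continuous_image compact_imp_bounded by blast
  then obtain M where "\<forall>x\<in>(\<lambda>z. ln (F.nrm z) + ln (G.nrm z)) ` cball 0 R. norm x \<le> M"
    unfolding bounded_iff by blast
  then have M: "\<bar>ln (F.nrm z) + ln (G.nrm z)\<bar> \<le> M" if "z \<in> cball 0 R" for z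
    using that by simp
  have "S r \<le> M" if "0 < r" "r \<le> R" for r
  proof -
    have "S r = cmean (\<lambda>z. ln (F.nrm z) + ln (G.nrm z)) r"
      using that by (simp add: S_def Tchar_def cmean_add F.continuous_ln_nrm G.continuous_ln_nrm)
    also have "\<dots> \<le> cmean (\<lambda>z. M) r"
    proof (rule cmean_mono)
      fix z :: complex assume "norm z = r"
      then show "ln (F.nrm z) + ln (G.nrm z) \<le> M" using M[of z] that by auto
    qed (use that in \<open>auto intro!: continuous_on_add F.continuous_ln_nrm G.continuous_ln_nrm\<close>)
    finally show ?thesis by simp
  qed
  then show ?thesis by blast
qed

lemma card_zeros_\<Phi>:
  assumes "\<And>j. j \<in> {1..q} \<Longrightarrow> real (zcount (F.F j) s) \<le> N" "\<And>j. j \<in> {1..q} \<Longrightarrow> real (zcount (G.F j) s) \<le> N"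
  shows "real (card {z \<in> ball 0 s. \<Phi> z = 0}) \<le> 2 * real q * N"
proof -
  have eq: "{z \<in> ball 0 s. \<Phi> z = 0} = (\<Union>j\<in>{1..q}. {z \<in> ball 0 s. F.F j z = 0} \<union> {z \<in> ball 0 s. G.F j z = 0})"
    unfolding \<Phi>_def by (auto simp: prod_zero_iff)
  have "card {z \<in> ball 0 s. \<Phi> z = 0} \<le> (\<Sum>j\<in>{1..q}. card ({z \<in> ball 0 s. F.F j z = 0} \<union> {z \<in> ball 0 s. G.F j z = 0}))"
    unfolding eq by (rule card_UN_le) simp
  also have "\<dots> \<le> (\<Sum>j\<in>{1..q}. zcount (F.F j) s + zcount (G.F j) s)"
    by (intro sum_mono order_trans[OF card_Un_le] add_mono card_zeros_le_zcount F.lf_hol G.lf_hol F.F0 G.F0)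
  finally have "real (card {z \<in> ball 0 s. \<Phi> z = 0}) \<le> (\<Sum>j\<in>{1..q}. real (zcount (F.F j) s) + real (zcount (G.F j) s))"
    by (simp flip: of_nat_sum of_nat_add)
  also have "\<dots> \<le> (\<Sum>j\<in>{1..q}. N + N)" by (intro sum_mono add_mono assms)
  finally show ?thesis by simp
qed

text \<open>For the estimate at \<open>\<rho> i\<close> the outer radius is
  \<open>\<rho> (i + 2)\<close>, and the zeros up to there are counted by means of the
  characteristic functions at \<open>\<rho> (i + 4)\<close>. These later values enter only through a
  logarithm, which \<open>ln_le_linear\<close> makes small enough for
  \<open>bounded_chain_le\<close>. The gaps halve at each step, which costs only a term linear in
  \<open>i\<close>.\<close>

lemma logarithmic_growth:
  "\<exists>D1 D2. 0 \<le> D1 \<and> 0 \<le> D2 \<and> (\<forall>r0\<ge>1. \<exists>\<rho>. r0 < \<rho> \<and> \<rho> < r0 + 1 \<and> (\<forall>z. norm z = \<rho> \<longrightarrow> Q z \<noteq> 0) \<and> S \<rho>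
      \<le> D1 + D2 * ln (r0 + 1))"
proof -
  obtain C where C': "generic_bound C" using generic_bound_exists by blast
  then have C: "0 \<le> C" by (simp add: generic_bound_def)
  note Cb = generic_boundD[OF C']
  obtain C2 C3 K where K': "key_constants C2 C3 K" using key_inequality by blast
  then have K: "0 \<le> C2" "0 \<le> C3" "0 \<le> K" by (simp_all add: key_constants_def)
  note key = key_constantsD[OF K']
  define c1 where "c1 = 1056 * (real q + 1)"
  define A where "A = 16 * c1 + 8 + 128 * (2 + 32 * (c1 + 2))"
  have c1: "0 \<le> c1" by (simp add: c1_def)
  have A: "0 < A" using c1 by (simp add: A_def)
  define C5 where "C5 = C + K + 1"
  \<comment> \<open>Makes \<open>6 * C3 / m\<close> at most 1/4, the coefficient in
    \<open>bounded_chain_le\<close>.\<close>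
  define m where "m = 4 * (6 * C3 + 1)"
  have m: "0 < m" using K by (simp add: m_def)
  define L0 where "L0 = C2 + C3 * \<bar>ln A\<bar> + 6 * C3 * (C5 / m + \<bar>ln m\<bar>) + 2 * C"
  have L0: "0 \<le> L0" using K C m by (simp add: L0_def C5_def)
  show ?thesis
  proof (rule exI[of _ "2 * L0 + 8 * (6 * C3)"], rule exI[of _ "12 * C3"], intro conjI allI impI)
    show "0 \<le> 2 * L0 + 8 * (6 * C3)" "0 \<le> 12 * C3" using L0 K by auto
    fix r0 :: real assume r0: "1 \<le> r0"
    define s where "s = (\<lambda>i::nat. r0 + 1 - (1/2) ^ i)"
    have s_step: "s (Suc i) - s i = (1/2) ^ Suc i" for i by (simp add: s_def)
    have s_pos: "1 \<le> s i" "s i < r0 + 1" for i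
      using r0 power_le_one[of "1/2::real" i] by (auto simp: s_def)
    have s_mono: "s i \<le> s j" if "i \<le> j" for i j
      using power_decreasing[OF that, of "1/2::real"] by (simp add: s_def)
    define mm where "mm = (\<lambda>i. card {a \<in> ball 0 (s (Suc i)). \<Phi> a = 0})"
    have "\<exists>\<rho>. s i < \<rho> \<and> \<rho> < s (Suc i) \<and> sep \<Phi> ((1/2) ^ Suc i / (4 * (real (mm i) + 1))) \<rho> \<and> (\<forall>z. norm z = \<rho>
        \<longrightarrow> Q z \<noteq> 0)" for i
    proof -
      have "s i < s (Suc i)" using s_step[of i] zero_less_power[of "1/2::real" "Suc i"] by linarith
      moreover have "0 < s i" using s_pos(1)[of i] by linarith
      ultimately obtain \<rho> where "s i < \<rho>" "\<rho> < s (Suc i)" "sep \<Phi> ((s (Suc i) - s i) / (4 * (real (mm i) + 1))) \<rho>"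
        "\<And>z. norm z = \<rho> \<Longrightarrow> Q z \<noteq> 0"
        using separated_radius[OF \<Phi>_hol \<Phi>0 Q_hol Q0, of "s i" "s (Suc i)" "mm i"] unfolding mm_def by blast
      then show ?thesis unfolding s_step by blast
    qed
    then obtain \<rho> where \<rho>: "\<And>i. s i < \<rho> i" "\<And>i. \<rho> i < s (Suc i)"
      "\<And>i. sep \<Phi> ((1/2) ^ Suc i / (4 * (real (mm i) + 1))) (\<rho> i)" "\<And>i z. norm z = \<rho> i \<Longrightarrow> Q z \<noteq> 0"
      by metis
    have \<rho>0: "0 < \<rho> i" "\<rho> i < r0 + 1" for i
      using \<rho>(1)[of i] \<rho>(2)[of i] s_pos(1)[of i] s_pos(2)[of "Suc i"] by linarith+
    \<comment> \<open>The shift by \<open>2 * C\<close> makes \<open>b'\<close> nonnegative and lets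
      it dominate each single characteristic function plus \<open>C\<close>.\<close>
    define b' where "b' = (\<lambda>i. S (\<rho> i) + 2 * C)"
    have bb: "Tchar n f (\<rho> i) + C \<le> b' i" "Tchar n g (\<rho> i) + C \<le> b' i" "0 \<le> b' i" for i
      using Cb[OF \<rho>0(1)[of i] \<rho>(4)[of _ i]] unfolding b'_def S_def by auto
    have step: "b' i \<le> (b' (i + 2) + b' (i + 4)) / 4 + (6 * C3) * (real i + 1) + (L0 + 6 * C3 * ln (r0 + 1))" for i
    proof -
      define E where "E = b' (i + 2) + b' (i + 4) + C5"
      have E1: "1 \<le> E" using bb(3)[of "i+2"] bb(3)[of "i+4"] C K by (simp add: E_def C5_def)
      \<comment> \<open>Dominates at once the inverse gap \<open>2 ^ i\<close>, the radii and the
        characteristic functions, so that one power of it bounds the argument of the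
        logarithm.\<close>
      define Y where "Y = 2 ^ i * (r0 + 1) * E"
      have p2: "1 \<le> (2::real) ^ i" by simp
      have Y1: "2 ^ i \<le> Y" "r0 + 1 \<le> Y" "E \<le> Y" "1 \<le> Y"
      proof -
        have e: "1 \<le> (r0 + 1) * E" using r0 E1 mult_mono[of 1 "r0 + 1" 1 E] by simp
        then show "2 ^ i \<le> Y" using mult_left_mono[OF e, of "2 ^ i"] by (simp add: Y_def mult.assoc)
        then show "1 \<le> Y" using p2 by linarith
        have e: "1 \<le> 2 ^ i * E" using p2 E1 mult_mono[of 1 "2 ^ i" 1 E] by simp
        then show "r0 + 1 \<le> Y" using mult_left_mono[OF e, of "r0 + 1"] r0 by (simp add: Y_def mult_ac)
        have e: "1 \<le> 2 ^ i * (r0 + 1)" using p2 r0 mult_mono[of 1 "2 ^ i" 1 "r0 + 1"] by simp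
        then show "E \<le> Y" using mult_left_mono[OF e, of E] E1 by (simp add: Y_def mult_ac)
      qed
      \<comment> \<open>The radius \<open>\<rho> (i + 4)\<close> exceeds \<open>s (i + 3)\<close> by
        more than \<open>(1/2) ^ (i + 4)\<close>; this gap, relative to \<open>r0 + 1\<close>, is
        the factor lost in passing from integrated to plain counts, hence
        \<open>16 * Y\<close>.\<close>
      have zc: "real (zcount H (s (i + 3))) \<le> 16 * Y"
        if H: "H holomorphic_on UNIV" "H 0 \<noteq> 0" "Ncount (ord H) (\<rho> (i + 4)) \<le> b' (i + 4)" for H
      proof -
        have lt: "s (i + 3) + (1/2) ^ (i + 4) < \<rho> (i + 4)"
          using \<rho>(1)[of "i + 4"] s_step[of "i + 3"] by (simp add: eval_nat_numeral)
        have l2: "s (i + 3) < \<rho> (i + 4)" using lt zero_less_power[of "1/2::real" "i + 4"] by linarith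
        have "(1/2) ^ (i + 4) / (r0 + 1) \<le> (\<rho> (i + 4) - s (i + 3)) / \<rho> (i + 4)"
          using lt l2 \<rho>0[of "i + 4"] r0 by (intro frac_le) auto
        then have "real (zcount H (s (i + 3))) * ((1/2) ^ (i + 4) / (r0 + 1))
            \<le> real (zcount H (s (i + 3))) * ((\<rho> (i + 4) - s (i + 3)) / \<rho> (i + 4))"
          by (intro mult_left_mono) auto
        also have "\<dots> \<le> Ncount (ord H) (\<rho> (i + 4))"
          using s_pos(1)[of "i + 3"] by (intro zcount_le_Ncount H l2) auto
        also have "\<dots> \<le> E" using H(3) bb(3)[of "i + 2"] C K by (simp add: E_def C5_def)
        finally have "real (zcount H (s (i + 3))) * ((1/2) ^ (i + 4) / (r0 + 1)) \<le> E" .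
        then have "real (zcount H (s (i + 3))) \<le> E / ((1/2) ^ (i + 4) / (r0 + 1))"
          using r0 by (subst pos_le_divide_eq) auto
        also have "\<dots> = 16 * Y" by (simp add: Y_def power_add power_one_over field_simps)
        finally show ?thesis .
      qed
      have NF: "real (zcount (F.F j) (s (i + 3))) \<le> 16 * Y" if "j \<in> {1..q}" for j
      proof (rule zc[OF F.lf_hol F.F0[OF that]])
        show "Ncount (ord (F.F j)) (\<rho> (i + 4)) \<le> b' (i + 4)"
          using Cb[OF \<rho>0(1)[of "i+4"] \<rho>(4)[of _ "i+4"]] that bb(1)[of "i + 4"] by fastforce
      qed
      have NG: "real (zcount (G.F j) (s (i + 3))) \<le> 16 * Y" if "j \<in> {1..q}" for j
      proof (rule zc[OF G.lf_hol G.F0[OF that]])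
        show "Ncount (ord (G.F j)) (\<rho> (i + 4)) \<le> b' (i + 4)"
          using Cb[OF \<rho>0(1)[of "i+4"] \<rho>(4)[of _ "i+4"]] that bb(2)[of "i + 4"] by fastforce
      qed
      have zmono: "real (zcount H u) \<le> 16 * Y" if "real (zcount H (s (i + 3))) \<le> 16 * Y" "u \<le> s (i + 3)"
        "H holomorphic_on UNIV" "H 0 \<noteq> 0" for H u
      proof -
        have "zcount H u \<le> zcount H (s (i + 3))"
          unfolding zcount_def using that finite_zeros_ball[OF that(3,4), of "s (i + 3)"] by (intro sum_mono2) auto
        then show ?thesis using that(1) by linarith
      qed
      have mmb: "real (mm k) \<le> 2 * real q * (16 * Y)" if "k \<le> i + 2" for k
        unfolding mm_def
      proof (rule card_zeros_\<Phi>)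
        have le: "s (Suc k) \<le> s (i + 3)" using that by (intro s_mono) auto
        fix j assume j: "j \<in> {1..q}"
        show "real (zcount (F.F j) (s (Suc k))) \<le> 16 * Y"
          by (rule zmono[OF NF[OF j] le F.lf_hol F.F0[OF j]])
        show "real (zcount (G.F j) (s (Suc k))) \<le> 16 * Y"
          by (rule zmono[OF NG[OF j] le G.lf_hol G.F0[OF j]])
      qed
      \<comment> \<open>A separation valid for every \<open>\<rho> k\<close> with
        \<open>k \<le> i + 2\<close>: the smallest of the gaps, with the bound \<open>mmb\<close>
        for the number of zeros.\<close>
      define \<delta> where "\<delta> = (1/2) ^ (i + 3) / (4 * (2 * real q * (16 * Y) + 1))"
      have \<delta>0: "0 < \<delta>" using Y1 by (simp add: \<delta>_def add_nonneg_pos)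
      have sp: "sep \<Phi> \<delta> (\<rho> k)" if "k \<le> i + 2" for k
      proof -
        have "(1/2::real) ^ (i + 3) \<le> (1/2) ^ Suc k" using that by (intro power_decreasing) auto
        then have "\<delta> \<le> (1/2) ^ Suc k / (4 * (real (mm k) + 1))"
          unfolding \<delta>_def using mmb[OF that] by (intro frac_le) (auto simp: mult_ac)
        then show ?thesis by (rule sep_mono[OF \<rho>(3)])
      qed
      \<comment> \<open>Half the distance between \<open>s (i + 1)\<close> and
        \<open>s (i + 2)\<close>, which lie between \<open>\<rho> i\<close> and
        \<open>\<rho> (i + 2)\<close>.\<close>
      define \<eta> :: real where "\<eta> = (1/2) ^ (i + 3)"
      have \<eta>: "0 < \<eta>" "\<eta> \<le> 1" by (auto simp: \<eta>_def intro: power_le_one)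
      have gap: "\<rho> i + 2 * \<eta> \<le> \<rho> (i + 2)"
        using \<rho>(2)[of i] \<rho>(1)[of "i + 2"] s_step[of "Suc i"] by (simp add: \<eta>_def eval_nat_numeral)
      define S' where "S' = b' (i + 2)"
      have R_le: "\<rho> (i + 2) \<le> s (i + 3)" using \<rho>(2)[of "i + 2"] by (simp add: eval_nat_numeral)
      define d where "d = 16 * Y / \<delta> + 1 / \<eta> + 2 * \<rho> (i + 2) / \<eta>\<^sup>2 * (2 * S' + K + 2 * (16 * Y) * (1 / \<delta> + 2 * \<rho> (i
          + 2)))"
      have "S (\<rho> i) \<le> C2 + C3 * ln d" unfolding d_def
      proof (rule key)
        show "sep \<Phi> \<delta> (\<rho> i)" "sep \<Phi> \<delta> (\<rho> (i + 2))" by (auto intro: sp)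
        show "Tchar n f (\<rho> (i + 2)) \<le> S'" "Tchar n g (\<rho> (i + 2)) \<le> S'" "0 \<le> S'"
          using bb[of "i + 2"] C unfolding S'_def by linarith+
      qed (use \<rho>0 \<rho>(4) \<eta> gap \<delta>0 zmono[OF NF R_le F.lf_hol F.F0] zmono[OF NG R_le G.lf_hol G.F0] in auto)
      also have "ln d \<le> \<bar>ln A\<bar> + 6 * ln Y"
      proof -
        have dp: "0 < d" unfolding d_def
          using \<eta> \<delta>0 Y1 \<rho>0[of "i + 2"] bb(3)[of "i + 2"] K
          by (intro add_pos_nonneg add_nonneg_pos mult_nonneg_nonneg divide_nonneg_nonneg add_nonneg_nonneg) (auto simp: S'_def)
        have "d = 16 * Y * (1 / \<delta>) + 1 / \<eta> + 2 * \<rho> (i + 2) * (1 / \<eta>)\<^sup>2 * ((2 * S' + K) + 2 * (16 * Y) * (1 / \<delta>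
            + 2 * \<rho> (i + 2)))"
          by (simp add: d_def power_divide)
        also have "\<dots> \<le> A * Y ^ 6"
          unfolding A_def
        proof (rule log_derivative_bound_le_power)
          have e8: "1 / \<eta> = 8 * 2 ^ i" by (simp add: \<eta>_def power_add power_one_over)
          then show "1 / \<eta> \<le> 8 * Y" using Y1 by simp
          have "1 / \<delta> = 32 * 2 ^ i * (32 * real q * Y + 1)" by (simp add: \<delta>_def power_add power_one_over field_simps)
          also have "\<dots> \<le> 32 * Y * (32 * real q * Y + Y)" using Y1 by (intro mult_mono add_left_mono) auto
          also have "\<dots> = 32 * (32 * real q + 1) * Y\<^sup>2" by (simp add: power2_eq_square algebra_simps)
          also have "\<dots> \<le> c1 * Y\<^sup>2" by (intro mult_right_mono) (auto simp: c1_def)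
          finally show "1 / \<delta> \<le> c1 * Y\<^sup>2" .
          show "\<rho> (i + 2) \<le> Y" using \<rho>0[of "i + 2"] Y1 by linarith
          show "2 * S' + K \<le> 2 * Y" using Y1(3) bb(3)[of "i + 2"] bb(3)[of "i + 4"] C K unfolding S'_def E_def C5_def
              by linarith
          show "0 \<le> 2 * S' + K" using bb(3)[of "i + 2"] K by (simp add: S'_def)
        qed (use Y1 \<delta>0 \<eta> \<rho>0[of "i + 2"] c1 in auto)
        finally have "ln d \<le> ln (A * Y ^ 6)" using dp by (intro ln_mono)
        also have "\<dots> = ln A + 6 * ln Y" using A Y1 by (simp add: ln_mult_pos ln_realpow)
        finally show ?thesis by linarith
      qed
      also have "ln Y = real i * ln 2 + ln (r0 + 1) + ln E"
        using r0 E1 unfolding Y_def by (subst ln_mult_pos, simp, simp, subst ln_mult_pos) (auto simp: ln_realpow)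
      also have "real i * ln 2 \<le> real i" using ln_2_less_1 mult_left_mono[of "ln 2" 1 "real i"] by simp
      also have "ln E \<le> E / m + ln m" using E1 m by (intro ln_le_linear) auto
      finally have "S (\<rho> i) \<le> C2 + C3 * (\<bar>ln A\<bar> + 6 * (real i + ln (r0 + 1) + (E / m + ln m)))"
        using K(2) by (simp add: mult_left_mono)
      also have "\<dots> \<le> C2 + C3 * (\<bar>ln A\<bar> + 6 * (real i + ln (r0 + 1) + (E / m + \<bar>ln m\<bar>)))"
        using K(2) by (intro add_left_mono mult_left_mono) auto
      also have "\<dots> = C2 + C3 * \<bar>ln A\<bar> + 6 * C3 * (C5 / m + \<bar>ln m\<bar>) + 6 * C3 * real i + 6 * C3 * ln (r0 + 1)
          + 6 * C3 / m * (b' (i + 2) + b' (i + 4))"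
        by (simp add: E_def algebra_simps add_divide_distrib)
      also have "6 * C3 / m * (b' (i + 2) + b' (i + 4)) \<le> 1 / 4 * (b' (i + 2) + b' (i + 4))"
        using K(2) bb(3)[of "i + 2"] bb(3)[of "i + 4"] by (intro mult_right_mono) (auto simp: m_def field_simps)
      finally have "S (\<rho> i) \<le> L0 - 2 * C + 6 * C3 * real i + 6 * C3 * ln (r0 + 1) + (b' (i + 2) + b' (i + 4)) / 4"
        by (simp add: L0_def)
      then show ?thesis using K(2) by (simp add: b'_def algebra_simps)
    qed
    obtain M where M: "\<And>r. 0 < r \<Longrightarrow> r \<le> r0 + 1 \<Longrightarrow> S r \<le> M" using S_bounded by blast
    have "b' i \<le> M + 2 * C" for i using M[of "\<rho> i"] \<rho>0[of i] by (simp add: b'_def)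
    then have "b' 0 \<le> 2 * (L0 + 6 * C3 * ln (r0 + 1)) + 8 * (6 * C3)"
      by (rule bounded_chain_le[OF _ _ step]) (use K in auto)
    then have "S (\<rho> 0) \<le> 2 * L0 + 8 * (6 * C3) + 12 * C3 * ln (r0 + 1)" using C by (simp add: b'_def)
    moreover have "s 0 = r0" by (simp add: s_def)
    ultimately show "\<exists>\<rho>. r0 < \<rho> \<and> \<rho> < r0 + 1 \<and> (\<forall>z. norm z = \<rho> \<longrightarrow> Q z \<noteq> 0) \<and> S \<rho>
        \<le> 2 * L0 + 8 * (6 * C3) + 12 * C3 * ln (r0 + 1)"
      using \<rho>(1)[of 0] \<rho>0[of 0] \<rho>(4)[of _ 0] by (intro exI[of _ "\<rho> 0"]) auto
  qed
qed

text \<open>The zeros \<open>t i\<close> with \<open>i < k\<close> lie in the disc of radius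
  \<open>\<rho> / 2\<close>, so each adds at least \<open>ln 2\<close> to the counting function of
  the form \<open>b\<close>. Since \<open>\<rho>\<close> is of size O(k), linear growth meets the
  logarithmic bound.\<close>

theorem contradiction: False
proof -
  obtain C where C': "generic_bound C" using generic_bound_exists by blast
  then have C: "0 \<le> C" by (simp add: generic_bound_def)
  note Cb = generic_boundD[OF C']
  obtain D1 D2 where D: "0 \<le> D1" "0 \<le> D2" "\<forall>r0\<ge>1. \<exists>\<rho>. r0 < \<rho> \<and> \<rho> < r0 + 1 \<and> (\<forall>z. norm z = \<rho> \<longrightarrow> Q z \<noteq> 0) \<and> S \<rho>
      \<le> D1 + D2 * ln (r0 + 1)"
    using logarithmic_growth by blast
  define t where "t = (\<lambda>k::nat. t0 + of_nat k * (2 * of_real pi * \<i>))"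
  have inj: "inj t" by (auto simp: inj_def t_def)
  have nt: "norm (t k) \<le> norm t0 + 2 * pi * real k" for k
    unfolding t_def by (rule order_trans[OF norm_triangle_ineq]) (simp add: norm_mult)
  let ?h = "lf n f b"
  have lower: "real k * ln 2 \<le> D1 + D2 * ln (2 * (norm t0 + 2 * pi * real k) + 2) + 2 * C" for k :: nat
  proof -
    define r0 where "r0 = 2 * (norm t0 + 2 * pi * real k) + 1"
    have r0: "1 \<le> r0" by (simp add: r0_def)
    obtain \<rho> where \<rho>: "r0 < \<rho>" "\<forall>z. norm z = \<rho> \<longrightarrow> Q z \<noteq> 0" "S \<rho> \<le> D1 + D2 * ln (r0 + 1)"
      using D(3)[rule_format, OF r0] by blast
    have tb: "norm (t i) \<le> \<rho> / 2" if "i < k" for i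
    proof -
      have "2 * pi * real i \<le> 2 * pi * real k" using that by (intro mult_left_mono) auto
      then have "norm (t i) \<le> norm t0 + 2 * pi * real k" using nt[of i] by linarith
      moreover have "x \<le> \<rho> / 2" if "x \<le> A" "2 * A + 1 < \<rho>" for x A :: real using that by linarith
      ultimately show ?thesis using \<rho>(1) unfolding r0_def by blast
    qed
    have \<rho>0: "0 < \<rho>" using r0 \<rho>(1) by linarith
    have fin: "finite {z \<in> ball 0 \<rho>. ord ?h z \<noteq> 0}" by (rule finite_ord_support[OF F.lf_hol h0])
    have tz: "t i \<noteq> 0" "ord ?h (t i) \<noteq> 0" for i
    proof -
      have "?h (t i) = 0" using hz[of i] by (simp add: t_def)
      then show "t i \<noteq> 0" "ord ?h (t i) \<noteq> 0" using h0 ord_pos_iff[OF F.lf_hol h0, of "t i"] by auto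
    qed
    have "real k * ln 2 = (\<Sum>z\<in>t ` {..<k}. ln 2)" using inj by (simp add: card_image inj_on_subset)
    also have "\<dots> \<le> (\<Sum>z\<in>t ` {..<k}. real (ord ?h z) * ln (\<rho> / norm z))"
    proof (rule sum_mono)
      fix z assume "z \<in> t ` {..<k}"
      then obtain i where i: "i < k" "z = t i" by blast
      have "2 \<le> \<rho> / norm z" using tb[OF i(1)] tz(1)[of i] i(2) by (simp add: field_simps)
      then have l: "ln 2 \<le> ln (\<rho> / norm z)" by (intro ln_mono) auto
      have o: "1 \<le> real (ord ?h z)" using tz(2)[of i] i(2) by simp
      have "1 * ln 2 \<le> real (ord ?h z) * ln (\<rho> / norm z)" by (rule mult_mono[OF o l]) auto
      then show "ln 2 \<le> real (ord ?h z) * ln (\<rho> / norm z)" by simp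
    qed
    also have "\<dots> \<le> Ncount (ord ?h) \<rho>" unfolding Ncount_def
    proof (rule sum_mono2)
      show "t ` {..<k} \<subseteq> {a. a \<in> ball 0 \<rho> \<and> ord ?h a \<noteq> 0}"
        using tz tb \<rho>0 by fastforce
      show "0 \<le> real (ord ?h x) * ln (\<rho> / norm x)" if "x \<in> {a. a \<in> ball 0 \<rho> \<and> ord ?h a \<noteq> 0} - t ` {..<k}" for x
        using that by (intro mult_nonneg_nonneg ln_ratio_nonneg) auto
    qed (use fin in auto)
    also have "\<dots> \<le> S \<rho> + 2 * C" using Cb[OF \<rho>0] \<rho>(2) unfolding S_def by fastforce
    also have "S \<rho> \<le> D1 + D2 * ln (2 * (norm t0 + 2 * pi * real k) + 2)"
      using \<rho>(3) by (simp only: r0_def add.assoc one_add_one)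
    finally show ?thesis by simp
  qed
  \<comment> \<open>With this slope the linear part of the bound for the logarithm uses up at most
    half of \<open>k * ln 2\<close>.\<close>
  define m where "m = (8 * pi * D2 + 1) / ln 2"
  have m: "0 < m" using D(2) by (simp add: m_def add_nonneg_pos)
  define B where "B = D1 + D2 * ((2 * norm t0 + 2) / m + \<bar>ln m\<bar>) + 2 * C"
  have "real k * (ln 2 / 2) \<le> B" for k :: nat
  proof -
    define v where "v = 2 * (norm t0 + 2 * pi * real k) + 2"
    have v: "0 < v" by (simp add: v_def add_nonneg_pos)
    have "D2 * ln v \<le> D2 * (v / m + \<bar>ln m\<bar>)"
      using ln_le_linear[OF v m] D(2) by (intro mult_left_mono) auto
    also have "\<dots> = D2 * ((2 * norm t0 + 2) / m + \<bar>ln m\<bar>) + real k * (4 * pi * D2 / m)"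
      by (simp add: v_def add_divide_distrib algebra_simps)
    also have "real k * (4 * pi * D2 / m) \<le> real k * (ln 2 / 2)"
    proof (rule mult_left_mono)
      have "4 * pi * D2 * 2 \<le> ln 2 * m" by (simp add: m_def)
      then show "4 * pi * D2 / m \<le> ln 2 / 2" using m by (simp add: field_simps)
    qed simp
    finally have "D2 * ln v \<le> D2 * ((2 * norm t0 + 2) / m + \<bar>ln m\<bar>) + real k * (ln 2 / 2)" by simp
    moreover have "real k * ln 2 \<le> D1 + D2 * ln v + 2 * C" using lower[of k] by (simp only: v_def)
    moreover have "real k * ln 2 = real k * (ln 2 / 2) + real k * (ln 2 / 2)" by simp
    ultimately show ?thesis unfolding B_def by linarith
  qed
  moreover obtain k :: nat where "B / (ln 2 / 2) < real k" using reals_Archimedean2 by blast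
  ultimately show False by (simp add: field_simps not_le[symmetric])
qed

end

section \<open>Generic complex lines\<close>

lemma bounded_linear_vector_scalar_mult: "bounded_linear (\<lambda>t::complex. t *s (e::complex^'m))"
proof -
  have "linear (\<lambda>t::complex. t *s (e::complex^'m))"
    by (rule linearI) (simp_all add: Finite_Cartesian_Product.vec_eq_iff distrib_right)
  then show ?thesis by (simp add: linear_conv_bounded_linear)
qed

lemma cplx_linear_axis:
  assumes "bounded_linear D" "cplx_linear D"
  shows "D v = (\<Sum>i\<in>UNIV. vec_nth v i * D (axis i 1))"
proof -
  have "D v = D (\<Sum>i\<in>UNIV. vec_nth v i *s axis i 1)" by (simp add: basis_expansion)
  also have "\<dots> = (\<Sum>i\<in>UNIV. D (vec_nth v i *s axis i 1))"
    using linear_sum[OF bounded_linear.linear[OF assms(1)]] by blast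
  also have "\<dots> = (\<Sum>i\<in>UNIV. vec_nth v i * D (axis i 1))"
    using assms(2) by (simp add: cplx_linear_def)
  finally show ?thesis .
qed

lemma has_derivative_line:
  assumes "(F has_derivative D) (at (z + t *s e))" "cplx_linear D"
  shows "((\<lambda>t. F (z + t *s e)) has_field_derivative D e) (at t)"
proof -
  have "((\<lambda>t. z + t *s e) has_derivative (\<lambda>s. 0 + s *s e)) (at t)"
    by (intro has_derivative_add has_derivative_const bounded_linear_imp_has_derivative bounded_linear_vector_scalar_mult)
  from has_derivative_compose[OF this assms(1)]
  have "((\<lambda>t. F (z + t *s e)) has_derivative (\<lambda>s. D (s *s e))) (at t)" by simp
  moreover have "(\<lambda>s. D (s *s e)) = (*) (D e)"
    using assms(2) by (auto simp: cplx_linear_def fun_eq_iff mult.commute)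
  ultimately show ?thesis by (simp add: has_field_derivative_def)
qed

definition pd :: "complex^'m \<Rightarrow> (complex^'m \<Rightarrow> complex) \<Rightarrow> complex^'m \<Rightarrow> complex" where
  "pd e F z = deriv (\<lambda>t. F (z + t *s e)) 0"

lemma pd_eq:
  assumes "(F has_derivative D) (at z)" "cplx_linear D"
  shows "pd e F z = D e"
  unfolding pd_def by (rule DERIV_imp_deriv) (use has_derivative_line[of F D z 0 e] assms in simp)

lemma holo_on_line:
  assumes "holo_on F UNIV"
  shows "(\<lambda>t. F (z + t *s e)) holomorphic_on UNIV"
    and "deriv (\<lambda>t. F (z + t *s e)) t = pd e F (z + t *s e)"
proof -
  have d: "((\<lambda>t. F (z + t *s e)) has_field_derivative pd e F (z + t *s e)) (at t)" for t
  proof -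
    obtain D where "(F has_derivative D) (at (z + t *s e))" "cplx_linear D"
      using assms by (auto simp: holo_on_def)
    then show ?thesis using has_derivative_line pd_eq by metis
  qed
  show "(\<lambda>t. F (z + t *s e)) holomorphic_on UNIV"
    unfolding holomorphic_on_def field_differentiable_def using d by blast
  show "deriv (\<lambda>t. F (z + t *s e)) t = pd e F (z + t *s e)"
    using d by (rule DERIV_imp_deriv)
qed

lemma holo_on_continuous: "holo_on F UNIV \<Longrightarrow> continuous_on A F"
  unfolding holo_on_def continuous_on_eq_continuous_within
  by (meson UNIV_I continuous_at_imp_continuous_at_within has_derivative_continuous)

text \<open>\<open>holo_on\<close> asks only for differentiability at each point. Writing the
  derivative as an integral of \<open>F\<close> over a fixed circle makes it continuous first, and
  then differentiable under the integral sign.\<close>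

lemma pd_integral:
  assumes "holo_on F UNIV"
  shows "pd e F z = integral (cbox 0 1) (\<lambda>s. F (z + circlepath 0 1 s *s e) / circlepath 0 1 s)"
proof -
  let ?G = "\<lambda>t. F (z + t *s e)"
  have "((\<lambda>s. ?G (circlepath 0 1 s) * circlepath 0 1 s / (circlepath 0 1 s - 0)\<^sup>2) has_integral deriv ?G 0) {0..1}"
    using holo_on_line(1)[OF assms, of z e]
    by (intro deriv_circle_integral) (auto intro: holomorphic_on_subset holomorphic_on_imp_continuous_on)
  then have "((\<lambda>s. F (z + circlepath 0 1 s *s e) / circlepath 0 1 s) has_integral pd e F z) {0..1}"
    unfolding pd_def by (rule has_integral_eq[rotated]) (auto simp: power2_eq_square circlepath)
  then show ?thesis by (simp add: integral_unique)
qed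

lemma continuous_on_pd:
  assumes "holo_on F UNIV"
  shows "continuous_on A (pd e F)"
proof -
  have "continuous_on (UNIV \<times> cbox 0 1) (\<lambda>(z, s). F (z + circlepath 0 1 s *s e) / circlepath 0 1 s)"
  proof -
    have "continuous_on (UNIV \<times> cbox 0 1) (\<lambda>x :: (complex^'a) \<times> real. circlepath 0 1 (snd x))"
      by (intro continuous_on_compose2[OF continuous_on_circlepath[of UNIV]] continuous_intros) auto
    moreover from this have "continuous_on (UNIV \<times> cbox 0 1) (\<lambda>x. F (fst x + circlepath 0 1 (snd x) *s e))"
      by (intro continuous_on_compose2[OF holo_on_continuous[OF assms, of UNIV]] continuous_intros
          bounded_linear.continuous_on[OF bounded_linear_vector_scalar_mult]) auto
    ultimately show ?thesis unfolding case_prod_unfold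
      by (intro continuous_on_divide) (auto simp: circlepath)
  qed
  then have "continuous_on UNIV (\<lambda>z. integral (cbox 0 1) (\<lambda>s. F (z + circlepath 0 1 s *s e) / circlepath 0 1 s))"
    by (rule integral_continuous_on_param)
  then show ?thesis using pd_integral[OF assms, of e] continuous_on_subset
    by (metis (no_types, lifting) continuous_on_cong subset_UNIV)
qed

lemma holo_on_pd:
  assumes F: "holo_on F UNIV"
  shows "holo_on (pd e F) (UNIV :: (complex^'m) set)"
proof -
  let ?c = "circlepath 0 1"
  define L where "L = (\<lambda>i. Blinfun (\<lambda>v::complex^'m. vec_nth v i))"
  have L: "blinfun_apply (L i) v = vec_nth v i" for i v
    unfolding L_def by (simp add: bounded_linear_Blinfun_apply bounded_linear_vec_nth)
  \<comment> \<open>The derivative of the integrand with respect to \<open>z\<close>, as a bounded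
    linear map. Expanded along the axes, its joint continuity in \<open>z\<close> and
    \<open>s\<close> follows from the continuity of the partial derivatives, and its complex
    linearity can be read off.\<close>
  define fx where "fx = (\<lambda>(z::complex^'m) s. \<Sum>i\<in>UNIV. blinfun_mult_right (pd (axis i 1) F (z
      + ?c s *s e) / ?c s) o\<^sub>L L i)"
  have fx: "blinfun_apply (fx z s) v = (\<Sum>i\<in>UNIV. vec_nth v i * pd (axis i 1) F (z + ?c s *s e)) / ?c s" for z s v
    unfolding fx_def by (simp add: blinfun.sum_left L sum_divide_distrib mult.commute)
  have der: "((\<lambda>z. F (z + ?c s *s e) / ?c s) has_derivative blinfun_apply (fx z s)) (at z within UNIV)" for z s
  proof -
    obtain D where D: "(F has_derivative D) (at (z + ?c s *s e))" "cplx_linear D"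
      using F by (auto simp: holo_on_def)
    have "((\<lambda>z. z + ?c s *s e) has_derivative (\<lambda>h. h)) (at z)"
      by (auto intro!: derivative_eq_intros)
    from has_derivative_compose[OF this D(1)]
    have "((\<lambda>z. F (z + ?c s *s e)) has_derivative D) (at z)" by simp
    then have "((\<lambda>z. F (z + ?c s *s e) / ?c s) has_derivative (\<lambda>v. D v / ?c s)) (at z)"
      by (rule bounded_linear.has_derivative[OF bounded_linear_divide])
    moreover have "D v / ?c s = blinfun_apply (fx z s) v" for v
      unfolding fx pd_eq[OF D]
      by (subst cplx_linear_axis[OF has_derivative_bounded_linear[OF D(1)] D(2), of v]) (rule refl)
    ultimately show ?thesis by simp
  qed
  have contc: "continuous_on (UNIV \<times> cbox 0 1) (\<lambda>x :: (complex^'m) \<times> real. ?c (snd x))"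
    by (intro continuous_on_compose2[OF continuous_on_circlepath[of UNIV]] continuous_intros) auto
  have contl: "continuous_on (UNIV \<times> cbox 0 1) (\<lambda>x. fst x + ?c (snd x) *s e)"
    by (intro continuous_intros bounded_linear.continuous_on[OF bounded_linear_vector_scalar_mult] contc)
  have cont: "continuous_on (UNIV \<times> cbox 0 1) (\<lambda>(z, s). fx z s)"
  proof -
    have "continuous_on (UNIV \<times> cbox 0 1) (\<lambda>x. pd (axis i 1) F (fst x + ?c (snd x) *s e) / ?c (snd x))" for i
      by (intro continuous_on_divide contc continuous_on_compose2[OF continuous_on_pd[OF F, of UNIV] contl])
        (auto simp: circlepath)
    then show ?thesis unfolding case_prod_unfold fx_def
      by (intro continuous_on_sum bounded_bilinear.continuous_on[OF bounded_bilinear_blinfun_compose]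
          bounded_linear.continuous_on[OF bounded_linear_blinfun_mult_right] continuous_on_const)
  qed
  have int: "(\<lambda>s. F (z + ?c s *s e) / ?c s) integrable_on cbox 0 1" for z
  proof -
    have "continuous_on (cbox 0 1) (\<lambda>s. z + ?c s *s e)"
      by (intro continuous_intros bounded_linear.continuous_on[OF bounded_linear_vector_scalar_mult] continuous_on_circlepath)
    then show ?thesis
      by (intro integrable_continuous continuous_on_divide continuous_on_circlepath
          continuous_on_compose2[OF holo_on_continuous[OF F, of UNIV]]) (auto simp: circlepath)
  qed
  have fxi: "fx z integrable_on cbox 0 1" for z
  proof (rule integrable_continuous)
    show "continuous_on (cbox 0 1) (fx z)"
    proof -
      have "continuous_on (cbox 0 1) (\<lambda>s::real. (z, s))"
        by (intro continuous_on_Pair continuous_on_const continuous_on_id)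
      from continuous_on_compose2[OF cont this] show ?thesis by auto
    qed
  qed
  have "\<exists>D. (pd e F has_derivative D) (at z) \<and> cplx_linear D" for z
  proof (intro exI conjI)
    have "((\<lambda>z. integral (cbox 0 1) (\<lambda>s. F (z + ?c s *s e) / ?c s)) has_derivative
        blinfun_apply (integral (cbox 0 1) (fx z))) (at z within UNIV)"
      by (rule leibniz_rule[OF der int cont]) auto
    moreover have "pd e F = (\<lambda>z. integral (cbox 0 1) (\<lambda>s. F (z + ?c s *s e) / ?c s))"
      by (rule ext) (rule pd_integral[OF F])
    ultimately show "(pd e F has_derivative blinfun_apply (integral (cbox 0 1) (fx z))) (at z)"
      by (simp only:)
    have ap: "blinfun_apply (integral (cbox 0 1) (fx z)) v = integral (cbox 0 1) (\<lambda>s. blinfun_apply (fx z s) v)" for v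
      using integral_linear[OF fxi[of z] blinfun.bounded_linear_left[of v]] by (simp add: o_def)
    show "cplx_linear (blinfun_apply (integral (cbox 0 1) (fx z)))"
      unfolding cplx_linear_def ap fx
      by (simp add: mult.assoc sum_distrib_left[symmetric] times_divide_eq_right[symmetric] del: times_divide_eq_right)
  qed
  then show ?thesis by (simp add: holo_on_def)
qed

lemma holo_on_pd_iter: "holo_on F UNIV \<Longrightarrow> holo_on ((pd e ^^ l) F) UNIV"
  by (induction l) (auto intro: holo_on_pd)

lemma higher_deriv_line:
  assumes "holo_on F UNIV"
  shows "(deriv ^^ l) (\<lambda>t. F (z + t *s e)) = (\<lambda>t. (pd e ^^ l) F (z + t *s e))"
proof (induction l)
  case (Suc l)
  have "(deriv ^^ Suc l) (\<lambda>t. F (z + t *s e)) = deriv (\<lambda>t. (pd e ^^ l) F (z + t *s e))"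
    using Suc by simp
  also have "\<dots> = (\<lambda>t. pd e ((pd e ^^ l) F) (z + t *s e))"
    using holo_on_line(2)[OF holo_on_pd_iter[OF assms]] by blast
  finally show ?case by simp
qed simp

lemma pd_iter_zero_imp_line_zero:
  assumes F: "holo_on F UNIV" and z: "\<And>l. (pd e ^^ l) F z = 0"
  shows "F (z + t *s e) = 0"
proof (rule ccontr)
  assume "F (z + t *s e) \<noteq> 0"
  then obtain l where "(deriv ^^ l) (\<lambda>t. F (z + t *s e)) 0 \<noteq> 0"
    using entire_nonzero_deriv[where F = "\<lambda>t. F (z + t *s e)" and b = t and a = 0] holo_on_line(1)[OF F] by blast
  then show False using z by (simp add: higher_deriv_line[OF F])
qed

text \<open>Near \<open>a\<close> the derivative along \<open>e\<close> differs from its value at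
  \<open>a\<close> by less than half the modulus of that value, so along a line \<open>h\<close>
  minus its linear part varies too slowly to allow two zeros of \<open>h\<close>.\<close>

lemma line_injective:
  assumes h: "holo_on h UNIV" and a: "pd e h a \<noteq> 0"
  obtains \<epsilon> where "0 < \<epsilon>"
    "\<And>z s. z \<in> ball a \<epsilon> \<Longrightarrow> z + s *s e \<in> ball a \<epsilon> \<Longrightarrow> h z = 0 \<Longrightarrow> h (z + s *s e) = 0 \<Longrightarrow> s = 0"
proof -
  let ?L = "pd e h a"
  have "isCont (pd e h) a" using continuous_on_pd[OF h, of UNIV e] by (simp add: continuous_on_eq_continuous_at)
  then obtain \<epsilon> where \<epsilon>: "0 < \<epsilon>" "\<And>w. dist w a < \<epsilon> \<Longrightarrow> dist (pd e h w) ?L < norm ?L / 2"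
    using a by (metis continuous_at_eps_delta half_gt_zero zero_less_norm_iff)
  have inj0: "s = 0" if z: "z \<in> ball a \<epsilon>" "z + s *s e \<in> ball a \<epsilon>" and h0: "h z = 0" "h (z + s *s e) = 0" for z s
  proof (rule ccontr)
    assume "s \<noteq> 0"
    define S where "S = {t. z + t *s e \<in> ball a \<epsilon>}"
    have "convex S"
    proof (rule convexI)
      fix x y :: complex and u v :: real
      assume xy: "x \<in> S" "y \<in> S" and uv: "0 \<le> u" "0 \<le> v" "u + v = 1"
      have "z + (u *\<^sub>R x + v *\<^sub>R y) *s e = u *\<^sub>R (z + x *s e) + v *\<^sub>R (z + y *s e)"
      proof -
        have "(u *\<^sub>R x + v *\<^sub>R y) *s e = u *\<^sub>R (x *s e) + v *\<^sub>R (y *s e)"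
          by (simp add: Finite_Cartesian_Product.vec_eq_iff distrib_right)
        moreover have "z = u *\<^sub>R z + v *\<^sub>R z" using uv(3) by (metis scaleR_add_left scaleR_one)
        moreover have "u *\<^sub>R (z + x *s e) + v *\<^sub>R (z + y *s e)
            = (u *\<^sub>R z + v *\<^sub>R z) + (u *\<^sub>R (x *s e) + v *\<^sub>R (y *s e))"
          by (simp add: scaleR_add_right)
        ultimately show ?thesis by metis
      qed
      then show "u *\<^sub>R x + v *\<^sub>R y \<in> S"
        using xy convexD[OF convex_ball, of "z + x *s e" a \<epsilon> "z + y *s e" u v] uv by (simp add: S_def)
    qed
    have "norm ((h (z + s *s e) - ?L * s) - (h (z + 0 *s e) - ?L * 0)) \<le> norm ?L / 2 * norm (s - 0)"
    proof (rule field_differentiable_bound[OF \<open>convex S\<close>, of "\<lambda>t. h (z + t *s e) - ?L * t"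
        "\<lambda>t. pd e h (z + t *s e) - ?L"])
      fix t assume t: "t \<in> S"
      have "((\<lambda>t. h (z + t *s e)) has_field_derivative pd e h (z + t *s e)) (at t)"
        using holomorphic_derivI[OF holo_on_line(1)[OF h] open_UNIV UNIV_I] holo_on_line(2)[OF h] by metis
      then show "((\<lambda>t. h (z + t *s e) - ?L * t) has_field_derivative pd e h (z + t *s e) - ?L) (at t within S)"
        by (auto intro!: derivative_eq_intros intro: has_field_derivative_at_within)
      show "norm (pd e h (z + t *s e) - ?L) \<le> norm ?L / 2"
        using \<epsilon>(2)[of "z + t *s e"] t by (simp add: S_def dist_norm norm_minus_commute)
    qed (use z in \<open>auto simp: S_def\<close>)
    then have "norm ?L * norm s \<le> norm ?L / 2 * norm s" using h0 by (simp add: norm_mult)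
    then show False using a \<open>s \<noteq> 0\<close> by (simp add: field_simps)
  qed
  show ?thesis by (rule that[OF \<epsilon>(1) inj0])
qed

text \<open>Suppose the lines through an open set of points \<open>c\<close> all meet
  \<open>K\<close>. Shifting that set along \<open>e\<close> gives a neighbourhood \<open>U\<close>
  of a point of \<open>K\<close> such that the line through any zero of \<open>h\<close> in
  \<open>U\<close> meets \<open>K\<close>; by \<open>inj\<close> that zero is then itself in
  \<open>K\<close>. As the derivative of \<open>h\<close> is nonzero there, \<open>A\<close> would
  contain a smooth piece of hypersurface.\<close>

lemma no_interior_along_lines:
  assumes h: "holo_on h UNIV" and A: "dim_le_m2 A" and K: "K \<subseteq> A" "K \<subseteq> ball a \<epsilon>"
    and h0: "\<And>z. z \<in> K \<Longrightarrow> h z = 0" "\<And>z. z \<in> K \<Longrightarrow> pd e h z \<noteq> 0"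
    and inj: "\<And>z s. z \<in> ball a \<epsilon> \<Longrightarrow> z + s *s e \<in> ball a \<epsilon> \<Longrightarrow> h z = 0 \<Longrightarrow> h (z + s *s e) = 0 \<Longrightarrow> s = 0"
  shows "interior {c. \<exists>t. c + t *s e \<in> K} = {}"
proof (rule ccontr)
  let ?V = "interior {c. \<exists>t. c + t *s e \<in> K}"
  assume "?V \<noteq> {}"
  then obtain c0 where c0: "c0 \<in> ?V" by blast
  then obtain t where t: "c0 + t *s e \<in> K" using interior_subset by blast
  define k where "k = c0 + t *s e"
  define U where "U = {z \<in> ball a \<epsilon>. z - t *s e \<in> ?V}"
  have "U = ball a \<epsilon> \<inter> (\<lambda>z. z - t *s e) -` ?V" by (auto simp: U_def)
  then have "open U" by (auto intro!: continuous_open_preimage continuous_intros)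
  moreover have kU: "k \<in> U" using t K(2) c0 by (auto simp: U_def k_def)
  moreover have "{w \<in> U. h w = 0} \<subseteq> A"
  proof clarify
    fix z assume z: "z \<in> U" "h z = 0"
    then obtain s where s: "z - t *s e + s *s e \<in> K" using interior_subset by (auto simp: U_def)
    have eq: "z - t *s e + s *s e = z + (s - t) *s e" by (simp add: Finite_Cartesian_Product.vec_eq_iff algebra_simps)
    have "s - t = 0" using inj[of z "s - t"] z s K(2) h0(1) unfolding eq by (auto simp: U_def)
    then show "z \<in> A" using s K(1) by auto
  qed
  moreover obtain D where D: "(h has_derivative D) (at k)" "cplx_linear D"
    using h by (auto simp: holo_on_def)
  moreover have "D \<noteq> (\<lambda>v. 0)"
    using pd_eq[OF D, of e] h0(2)[of k] t by (auto simp: k_def)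
  moreover have "h k = 0" using h0(1) t by (simp add: k_def)
  moreover have "holo_on h U" using h by (simp add: holo_on_def)
  ultimately show False using A unfolding dim_le_m2_def by blast
qed

section \<open>Meagre sets and Baire's theorem\<close>

definition meagre_cover :: "'a::topological_space set \<Rightarrow> bool" where
  "meagre_cover B \<longleftrightarrow> (\<exists>\<C>. countable \<C> \<and> (\<forall>C\<in>\<C>. closed C \<and> interior C = {}) \<and> B \<subseteq> \<Union>\<C>)"

lemma meagre_cover_UN:
  assumes "countable I" "\<And>i. i \<in> I \<Longrightarrow> meagre_cover (B i)"
  shows "meagre_cover (\<Union>i\<in>I. B i)"
proof -
  define P where "P = (\<lambda>i \<C>. countable \<C> \<and> (\<forall>C\<in>\<C>. closed C \<and> interior C = {}) \<and> B i \<subseteq> \<Union>\<C>)"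
  have "\<forall>i\<in>I. \<exists>\<C>. P i \<C>" using assms(2) unfolding meagre_cover_def P_def by simp
  from bchoice[OF this] obtain \<C> where "\<forall>i\<in>I. P i (\<C> i)" ..
  then have \<C>: "countable (\<C> i)" "\<And>C. C \<in> \<C> i \<Longrightarrow> closed C \<and> interior C = {}" "B i \<subseteq> \<Union>(\<C> i)" if "i \<in> I" for i
    using that by (auto simp: P_def)
  have "countable (\<Union>i\<in>I. \<C> i)" using assms(1) \<C> by (intro countable_UN) auto
  moreover have "\<forall>C\<in>(\<Union>i\<in>I. \<C> i). closed C \<and> interior C = {}" using \<C>(2) by auto
  moreover have "(\<Union>i\<in>I. B i) \<subseteq> \<Union>(\<Union>i\<in>I. \<C> i)"
  proof clarify
    fix x i assume i: "i \<in> I" "x \<in> B i"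
    then obtain C where "C \<in> \<C> i" "x \<in> C" using \<C>(3)[OF i(1)] by (meson UnionE subsetD)
    then show "x \<in> \<Union>(\<Union>i\<in>I. \<C> i)" using i(1) by (meson UN_I UnionI)
  qed
  ultimately show ?thesis unfolding meagre_cover_def by blast
qed

lemma meagre_cover_mono: "meagre_cover B \<Longrightarrow> A \<subseteq> B \<Longrightarrow> meagre_cover A"
  unfolding meagre_cover_def by (meson subset_trans)

lemma meagre_coverI: "closed C \<Longrightarrow> interior C = {} \<Longrightarrow> meagre_cover C"
  unfolding meagre_cover_def by (intro exI[of _ "{C}"]) auto

lemma meagre_cover_avoid:
  fixes B :: "'a::{real_normed_vector,heine_borel} set"
  assumes B: "meagre_cover B" and V: "open V" "V \<noteq> {}"
  shows "\<exists>c\<in>V. c \<notin> B"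
proof -
  obtain \<C> where \<C>: "countable \<C>" "\<forall>C\<in>\<C>. closed C \<and> interior C = {}" "B \<subseteq> \<Union>\<C>"
    using B unfolding meagre_cover_def by blast
  have "UNIV \<subseteq> closure (\<Inter>(uminus ` \<C>))"
  proof (rule Baire)
    show "openin (top_of_set UNIV) T \<and> UNIV \<subseteq> closure T" if "T \<in> uminus ` \<C>" for T
      using that \<C>(2) by (auto simp: closure_complement)
  qed (use \<C> in auto)
  then have "V \<inter> \<Inter>(uminus ` \<C>) \<noteq> {}" using V open_Int_closure_eq_empty[OF V(1)] by blast
  then show ?thesis using \<C>(3) by blast
qed

text \<open>The parameter is confined to a disc to keep the set compact, hence closed; later the
  plane is exhausted by countably many discs.\<close>

lemma compact_lines_through_compact:
  fixes K :: "(complex^'m) set"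
  assumes "compact K"
  shows "compact {c. \<exists>t\<in>cball 0 r. c + t *s e \<in> K}"
proof -
  have "{c. \<exists>t\<in>cball 0 r. c + t *s e \<in> K} = (\<lambda>x. fst x - snd x *s e) ` (K \<times> cball 0 r)"
  proof (intro equalityI subsetI)
    fix c assume "c \<in> {c. \<exists>t\<in>cball 0 r. c + t *s e \<in> K}"
    then obtain t where "t \<in> cball 0 r" "c + t *s e \<in> K" by blast
    then show "c \<in> (\<lambda>x. fst x - snd x *s e) ` (K \<times> cball 0 r)"
      by (intro image_eqI[of _ _ "(c + t *s e, t)"]) auto
  next
    fix c assume "c \<in> (\<lambda>x. fst x - snd x *s e) ` (K \<times> cball 0 r)"
    then obtain k t where kt: "k \<in> K" "t \<in> cball 0 r" "c = k - t *s e" by auto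
    then have "c + t *s e \<in> K" by simp
    then show "c \<in> {c. \<exists>t\<in>cball 0 r. c + t *s e \<in> K}" using kt(2) by blast
  qed
  moreover
  have "continuous_on (K \<times> cball 0 r) (\<lambda>x. fst x - snd x *s e)"
    by (intro continuous_intros bounded_linear.continuous_on[OF bounded_linear_vector_scalar_mult])
  from compact_continuous_image[OF this compact_Times[OF assms compact_cball]]
  have "compact ((\<lambda>x. fst x - snd x *s e) ` (K \<times> cball 0 r))" .
  ultimately show ?thesis by (simp only:)
qed

text \<open>The identity theorem on the complex line through \<open>w\<close> and a point of the
  interior.\<close>

lemma zero_set_interior:
  fixes F :: "complex^'m \<Rightarrow> complex"
  assumes F: "holo_on F UNIV" "F w \<noteq> 0"
  shows "interior {z. F z = 0} = {}"
proof (rule ccontr)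
  assume "interior {z. F z = 0} \<noteq> {}"
  then obtain z r where r: "0 < r" "ball z r \<subseteq> {z. F z = 0}" by (auto simp: mem_interior)
  let ?e = "w - z"
  let ?f = "\<lambda>t. F (z + t *s ?e)"
  have "continuous_on UNIV (\<lambda>t::complex. z + t *s ?e)"
    by (intro continuous_intros bounded_linear.continuous_on[OF bounded_linear_vector_scalar_mult])
  then have op: "open ((\<lambda>t::complex. z + t *s ?e) -` ball z r)" by (intro open_vimage) auto
  have "0 \<in> (\<lambda>t::complex. z + t *s ?e) -` ball z r" using r(1) by simp
  have "?f 1 = 0"
  proof (rule analytic_continuation_open[OF op open_UNIV _ connected_UNIV subset_UNIV, of ?f "\<lambda>_. 0"])
    show "(\<lambda>t::complex. z + t *s ?e) -` ball z r \<noteq> {}" using \<open>0 \<in> (\<lambda>t::complex. z + t *s ?e) -` ball z r\<close> by blast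
    show "?f holomorphic_on UNIV" by (rule holo_on_line(1)[OF F(1)])
    show "?f t = 0" if "t \<in> (\<lambda>t::complex. z + t *s ?e) -` ball z r" for t using that r(2) by blast
  qed auto
  then show False using F(2) by simp
qed

text \<open>Stratify by the order m + 1 of F along e. On a stratum the m-th derivative h along e vanishes to first
  order, hence is injective on the zeros along each line. If the lines through a compact piece of the stratum filled an open
  set, then near some point all zeros of h would belong to the piece, so that the piece would have codimension one.\<close>

lemma generic_line_avoids:
  fixes F :: "complex^'m \<Rightarrow> complex"
  assumes F: "holo_on F UNIV" "F w \<noteq> 0" and C: "closed C" and U: "open U"
    and sub: "C \<inter> U \<subseteq> {z. F z = 0}" and A: "dim_le_m2 (C \<inter> U)"
  shows "meagre_cover {c. \<exists>t. c + t *s e \<in> C \<inter> U}"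
proof -
  define h where "h = (\<lambda>l. (pd e ^^ l) F)"
  have hh: "holo_on (h l) UNIV" for l unfolding h_def by (rule holo_on_pd_iter[OF F(1)])
  have hS: "pd e (h l) = h (Suc l)" for l by (simp add: h_def)
  define Am where "Am = (\<lambda>m. {z \<in> C \<inter> U. (\<forall>l\<le>m. h l z = 0) \<and> h (Suc m) z \<noteq> 0})"
  have meag: "meagre_cover {c. \<exists>t. c + t *s e \<in> Am m}" for m
  proof -
    have op: "open (U \<inter> {z. h (Suc m) z \<noteq> 0})"
      by (intro open_Int U open_Collect_neq continuous_on_const holo_on_continuous[OF hh])
    \<comment> \<open>The doubled radius is there because the compact piece \<open>K a\<close> fills
      the closed ball of radius \<open>r a\<close>, whereas \<open>no_interior_along_lines\<close>
      wants it inside an open ball.\<close>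
    define P where "P = (\<lambda>a r. 0 < r \<and> cball a r \<subseteq> U \<inter> {z. h (Suc m) z \<noteq> 0} \<and>
      (\<forall>z s. z \<in> ball a (2 * r) \<longrightarrow> z + s *s e \<in> ball a (2 * r) \<longrightarrow> h m z = 0 \<longrightarrow> h m (z + s *s e) = 0 \<longrightarrow> s = 0))"
    have "\<exists>r. P a r" if a: "a \<in> Am m" for a
    proof -
      have "pd e (h m) a \<noteq> 0" using a unfolding hS by (simp add: Am_def)
      then obtain \<epsilon> where \<epsilon>: "0 < \<epsilon>"
        "\<And>z s. z \<in> ball a \<epsilon> \<Longrightarrow> z + s *s e \<in> ball a \<epsilon> \<Longrightarrow> h m z = 0 \<Longrightarrow> h m (z + s *s e) = 0 \<Longrightarrow> s = 0"
        using line_injective[OF hh] by metis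
      have "a \<in> U \<inter> {z. h (Suc m) z \<noteq> 0}" using a by (simp add: Am_def)
      then obtain r where r: "0 < r" "cball a r \<subseteq> U \<inter> {z. h (Suc m) z \<noteq> 0}"
        using op open_contains_cball by blast
      define r' where "r' = min r (\<epsilon> / 2)"
      have "0 < r'" "cball a r' \<subseteq> cball a r" "ball a (2 * r') \<subseteq> ball a \<epsilon>" using r(1) \<epsilon>(1) by (auto simp: r'_def)
      then show ?thesis using r(2) \<epsilon>(2) unfolding P_def by (intro exI[of _ r']) (meson subsetD subset_trans)
    qed
    then have "\<forall>a\<in>Am m. \<exists>r. P a r" by blast
    from bchoice[OF this] obtain r where r0: "\<forall>a\<in>Am m. P a (r a)" ..
    have r: "0 < r a" "cball a (r a) \<subseteq> U \<inter> {z. h (Suc m) z \<noteq> 0}"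
      and rinj: "\<And>z s. z \<in> ball a (2 * r a) \<Longrightarrow> z + s *s e \<in> ball a (2 * r a) \<Longrightarrow> h m z = 0 \<Longrightarrow> h m (z + s *s e) = 0 \<Longrightarrow> s = 0"
      if "a \<in> Am m" for a
      using r0 that unfolding P_def by blast+
    \<comment> \<open>Countably many of these balls cover the stratum, so the exceptional set is a
      countable union.\<close>
    obtain \<B> where \<B>: "\<B> \<subseteq> (\<lambda>a. ball a (r a)) ` Am m" "countable \<B>" "\<Union>\<B> = (\<Union>a\<in>Am m. ball a (r a))"
      using Lindelof[of "(\<lambda>a. ball a (r a)) ` Am m"] by auto
    obtain I where I: "I \<subseteq> Am m" "countable I" "\<B> = (\<lambda>a. ball a (r a)) ` I"
      using iffD1[OF countable_subset_image conjI[OF \<B>(2,1)]] by auto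
    define K where "K = (\<lambda>a. C \<inter> (\<Inter>l\<in>{..m}. {z. h l z = 0}) \<inter> cball a (r a))"
    have Kc: "compact (K a)" for a unfolding K_def
      by (intro closed_Int_compact closed_Int C closed_INT ballI compact_cball closed_Collect_eq continuous_on_const holo_on_continuous[OF hh])
    have int: "interior {c. \<exists>t. c + t *s e \<in> K a} = {}" if "a \<in> Am m" for a
    proof (rule no_interior_along_lines[OF hh A])
      show "K a \<subseteq> C \<inter> U" using r(2)[OF that] by (auto simp: K_def)
      show "K a \<subseteq> ball a (2 * r a)" using r(1)[OF that] by (force simp: K_def)
      show "h m z = 0" if "z \<in> K a" for z using that by (auto simp: K_def)
      show "pd e (h m) z \<noteq> 0" if "z \<in> K a" for z using that r(2)[OF \<open>a \<in> Am m\<close>] by (auto simp: K_def hS)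
    qed (use rinj[OF that] in blast)
    have "meagre_cover (\<Union>x\<in>I \<times> (UNIV::nat set). {c. \<exists>t\<in>cball 0 (real (snd x)). c + t *s e \<in> K (fst x)})"
    proof (rule meagre_cover_UN)
      show "countable (I \<times> (UNIV::nat set))" using I(2) by auto
      fix x assume x: "x \<in> I \<times> (UNIV::nat set)"
      have "interior {c. \<exists>t\<in>cball 0 (real (snd x)). c + t *s e \<in> K (fst x)} \<subseteq> interior {c. \<exists>t. c + t *s e \<in> K (fst x)}"
        by (intro interior_mono) auto
      then show "meagre_cover {c. \<exists>t\<in>cball 0 (real (snd x)). c + t *s e \<in> K (fst x)}"
        using int[of "fst x"] x I(1)
        by (intro meagre_coverI compact_imp_closed compact_lines_through_compact Kc) auto
    qed
    then show ?thesis
    proof (rule meagre_cover_mono, intro subsetI)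
      fix c assume "c \<in> {c. \<exists>t. c + t *s e \<in> Am m}"
      then obtain t where t: "c + t *s e \<in> Am m" by blast
      then have "c + t *s e \<in> (\<Union>a\<in>Am m. ball a (r a))" using r by force
      then have "c + t *s e \<in> (\<Union>a\<in>I. ball a (r a))" using \<B>(3) I(3) by simp
      then obtain a where a: "a \<in> I" "c + t *s e \<in> ball a (r a)" by blast
      have "c + t *s e \<in> K a" using t a(2) by (auto simp: K_def Am_def)
      moreover obtain N :: nat where "norm t \<le> real N" using real_arch_simple by blast
      ultimately show "c \<in> (\<Union>x\<in>I \<times> (UNIV::nat set). {c. \<exists>t\<in>cball 0 (real (snd x)). c + t *s e \<in> K (fst x)})"
        using a(1) by (intro UN_I[of "(a, N)"]) auto
    qed
  qed
  \<comment> \<open>A line on which \<open>F\<close> vanishes identically meets no stratum; for it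
    already \<open>F c = 0\<close>, which excludes only a meagre set of \<open>c\<close>.\<close>
  have zero: "meagre_cover {z. F z = 0}"
    by (intro meagre_coverI zero_set_interior[OF F] closed_Collect_eq continuous_on_const holo_on_continuous[OF F(1)])
  have "meagre_cover ((\<Union>m\<in>UNIV. {c. \<exists>t. c + t *s e \<in> Am m}) \<union> {z. F z = 0})"
  proof -
    have "meagre_cover (\<Union>i\<in>{None} \<union> range Some. case i of None \<Rightarrow> {z. F z = 0} | Some m \<Rightarrow> {c. \<exists>t. c + t *s e \<in> Am m})"
      by (rule meagre_cover_UN) (use zero meag in auto)
    then show ?thesis by (rule meagre_cover_mono) force
  qed
  then show ?thesis
  proof (rule meagre_cover_mono, intro subsetI)
    fix c assume "c \<in> {c. \<exists>t. c + t *s e \<in> C \<inter> U}"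
    then obtain t where t: "c + t *s e \<in> C \<inter> U" by blast
    show "c \<in> (\<Union>m\<in>UNIV. {c. \<exists>t. c + t *s e \<in> Am m}) \<union> {z. F z = 0}"
    proof (cases "\<forall>l. h l (c + t *s e) = 0")
      case True
      then have "F ((c + t *s e) + (- t) *s e) = 0"
        by (intro pd_iter_zero_imp_line_zero[OF F(1)]) (simp add: h_def)
      moreover have "(c + t *s e) + (- t) *s e = c" by (simp add: Finite_Cartesian_Product.vec_eq_iff)
      ultimately show ?thesis by simp
    next
      case False
      define k where "k = (LEAST l. h l (c + t *s e) \<noteq> 0)"
      have k: "h k (c + t *s e) \<noteq> 0" 
        unfolding k_def by (rule LeastI_ex) (use False in simp)
      have "F (c + t *s e) = 0" using t sub by blast
      then have "h 0 (c + t *s e) = 0" by (simp add: h_def)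
      then obtain m where m: "k = Suc m" using k by (cases k) auto
      have "h l (c + t *s e) = 0" if "l \<le> m" for l
      proof -
        have "l < k" using that m by simp
        then show ?thesis unfolding k_def using not_less_Least by blast
      qed
      then have "c + t *s e \<in> Am m" using t k m by (simp add: Am_def)
      then show ?thesis by blast
    qed
  qed
qed

section \<open>Reduction to curves\<close>

text \<open>The bound on \<open>x\<close> gives \<open>3 * x < 2 * (n - 1)\<close>, because
  \<open>3 * y \<le> 2 * (n + 1 + y)\<close> and \<open>p \<le> n\<close>. For
  \<open>\<kappa> = 0\<close> the inequality then is the positivity of a product with the factor
  \<open>n - 1 - x\<close>; the lower bound on \<open>k\<close> makes the term with
  \<open>\<kappa>\<close> smaller than this product.\<close>

lemma numeric_condition:
  fixes n x y p q :: nat and \<kappa> :: real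
  assumes p: "2 \<le> p" "p \<le> n" and y: "1 \<le> y" "y \<le> 2 * n"
    and x: "real x < real ((p - 1) * y) / real (n + 1 + y)"
    and k: "\<kappa> = 0 \<or> (\<exists>k'::nat. \<kappa> = 1 / (real k' + 1) \<and>
       real (2 * n * (n + 1 + y) * (3 * n + p - x)) / (real ((p - 1) * y) - real x * real (n + 1 + y)) \<le> real k')"
    and q: "q = 3 * n + 1 - x"
  shows "2 * n + 2 \<le> q"
    and "real q + 2 * real n * real q * (2 + (real q - 2 - 2 * real n) / (2 * real n)) * \<kappa>
       < (2 + (real q - 2 - 2 * real n) / (2 * real n)) * (real q - real n - 1)"
proof -
  define N where "N = real n"
  define X where "X = real x"
  define M where "M = real (n + 1 + y)"
  define Pr where "Pr = real p"
  define Y where "Y = real y"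
  define D where "D = (Pr - 1) * Y - X * M"
  have b: "2 \<le> Pr" "Pr \<le> N" "1 \<le> Y" "Y \<le> 2 * N" "0 \<le> X" "M = N + 1 + Y"
    using p y by (auto simp: N_def X_def M_def Pr_def Y_def)
  have M0: "0 < M" using b by simp
  have py: "real ((p - 1) * y) = (Pr - 1) * Y" using p by (simp add: Pr_def Y_def of_nat_diff)
  have D0: "0 < D"
  proof -
    have "X < (Pr - 1) * Y / M" using x unfolding py X_def M_def .
    then show ?thesis using M0 by (simp add: D_def pos_less_divide_eq)
  qed
  have PY: "(Pr - 1) * Y \<le> (N - 1) * Y" using b by (intro mult_right_mono) auto
  have "3 * Y * X \<le> 2 * M * X" using b by (intro mult_right_mono) auto
  then have "3 * X * Y < 2 * (N - 1) * Y" using D0 PY unfolding D_def by (simp add: algebra_simps)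
  then have X1: "3 * X < 2 * (N - 1)" using b by simp
  moreover have "2 \<le> N" using b(1,2) by (rule order_trans)
  ultimately have E1: "0 < N - 1 - X" by argo
  have "real x + 1 < real n" using E1 by (simp add: N_def X_def)
  then have xn: "x + 2 \<le> n" by linarith
  then show "2 * n + 2 \<le> q" using q by simp
  have B: "real q = 3 * N + 1 - X" using q xn by (simp add: N_def X_def of_nat_diff)
  \<comment> \<open>With \<open>c\<close> as in \<open>curve_pair\<close>, \<open>A\<close> is
    \<open>2 * N * c\<close> and \<open>B'\<close> is \<open>q\<close>. After multiplication by
    \<open>2 * N\<close> the surplus without the term in \<open>\<kappa>\<close> factors as
    \<open>E\<close>.\<close>
  define A where "A = 5 * N - 1 - X"
  define B' where "B' = 3 * N + 1 - X"
  have N0: "0 < N" using b by simp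
  have c: "2 + (real q - 2 - 2 * real n) / (2 * real n) = A / (2 * N)"
    using N0 unfolding B A_def by (simp add: N_def[symmetric] field_simps)
  define E where "E = (4 * N - X) * (N - 1 - X)"
  have E0: "0 < E" unfolding E_def using E1 b by (intro mult_pos_pos) auto
  have Eeq: "A * (2 * N - X) - 2 * N * B' = E" by (simp add: A_def B'_def E_def algebra_simps)
  have key: "2 * N * A * B' * \<kappa> < E"
    using k
  proof (elim disjE exE conjE)
    assume "\<kappa> = 0" then show ?thesis using E0 by simp
  next
    fix k' :: nat
    assume \<kappa>: "\<kappa> = 1 / (real k' + 1)" and le: "real (2 * n * (n + 1 + y) * (3 * n + p - x)) /
      (real ((p - 1) * y) - real x * real (n + 1 + y)) \<le> real k'"
    define Q where "Q = 3 * N + Pr - X"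
    have "real (3 * n + p - x) = Q" using xn by (simp add: N_def Q_def X_def Pr_def of_nat_diff)
    then have "real (2 * n * (n + 1 + y) * (3 * n + p - x)) = 2 * N * M * Q"
      by (simp only: of_nat_mult N_def M_def of_nat_numeral)
    then have kD: "2 * N * M * Q \<le> real k' * D"
      using le D0 unfolding py D_def X_def[symmetric] M_def[symmetric] by (simp add: pos_divide_le_eq)
    \<comment> \<open>Combined with \<open>kD\<close> this reduces the claim to
      \<open>2 * A * B' \<le> 3 * (4 * N - X) * Q\<close>, which holds factor by factor. Strictness
      comes from \<open>k' + 1\<close> in place of \<open>k'\<close>.\<close>
    have "3 * D \<le> 2 * M * (N - 1 - X)"
    proof -
      have "3 * Y * (N - 1) \<le> 2 * M * (N - 1)" using b X1 by (intro mult_right_mono) auto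
      moreover have "0 \<le> X * M" using b M0 by simp
      ultimately show ?thesis using PY unfolding D_def by (simp add: algebra_simps)
    qed
    then have d3: "3 * D * (A * B') \<le> 2 * M * (N - 1 - X) * (A * B')"
      using b E1 by (intro mult_right_mono mult_nonneg_nonneg) (auto simp: A_def B'_def)
    have "2 * A * B' \<le> 3 * (4 * N - X) * Q"
      using b E1 by (intro mult_mono[of "2 * A"]) (auto simp: A_def B'_def Q_def)
    then have "M * (N - 1 - X) * (2 * A * B') \<le> M * (N - 1 - X) * (3 * (4 * N - X) * Q)"
      using M0 E1 by (intro mult_left_mono mult_nonneg_nonneg) auto
    moreover have "2 * M * (N - 1 - X) * (A * B') = M * (N - 1 - X) * (2 * A * B')" by (simp only: mult_ac)
    moreover have "M * (N - 1 - X) * (3 * (4 * N - X) * Q) = 3 * (M * Q * E)" by (simp only: E_def mult_ac)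
    ultimately have "3 * D * (A * B') \<le> 3 * (M * Q * E)" using d3 by linarith
    then have "2 * N * (D * (A * B')) \<le> 2 * N * (M * Q * E)" using N0 by (intro mult_left_mono) auto
    also have "\<dots> \<le> real k' * D * E" using mult_right_mono[OF kD, of E] E0 by (simp add: mult_ac)
    finally have "D * (2 * N * A * B') \<le> D * (real k' * E)" by (simp add: mult_ac)
    then have "2 * N * A * B' \<le> real k' * E" using D0 by simp
    also have "\<dots> < (real k' + 1) * E" using E0 by (simp add: distrib_right)
    finally show ?thesis by (simp add: \<kappa> pos_divide_less_eq mult.commute)
  qed
  have "2 * N * (real q + 2 * real n * real q * (A / (2 * N)) * \<kappa>) = 2 * N * B' + 2 * N * A * B' * \<kappa>"
    using N0 unfolding B B'_def[symmetric] N_def[symmetric] by (simp add: field_simps)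
  also have "\<dots> < A * (2 * N - X)" using key Eeq by linarith
  also have "\<dots> = 2 * N * (A / (2 * N) * (real q - real n - 1))"
    using N0 unfolding B by (simp add: N_def[symmetric])
  finally have "real q + 2 * real n * real q * (A / (2 * N)) * \<kappa> < A / (2 * N) * (real q - real n - 1)"
    by (rule mult_left_less_imp_less) (use N0 in simp)
  then show "real q + 2 * real n * real q * (2 + (real q - 2 - 2 * real n) / (2 * real n)) * \<kappa>
       < (2 + (real q - 2 - 2 * real n) / (2 * real n)) * (real q - real n - 1)"
    unfolding c .
qed

text \<open>Each of the finitely many functions has only finitely many zeros in the unit
  disc.\<close>

lemma common_nonzero_point:
  assumes "finite \<H>" "\<And>h. h \<in> \<H> \<Longrightarrow> h holomorphic_on UNIV" "\<And>h. h \<in> \<H> \<Longrightarrow> \<exists>z. h z \<noteq> 0"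
  shows "\<exists>z. \<forall>h\<in>\<H>. h z \<noteq> (0::complex)"
proof -
  have "finite (\<Union>h\<in>\<H>. {z \<in> cball 0 1. h z = 0})"
  proof (intro finite_UN_I assms(1))
    fix h assume "h \<in> \<H>"
    then obtain z where "h holomorphic_on UNIV" "h z \<noteq> 0" using assms(2,3) by metis
    then show "finite {z \<in> cball 0 1. h z = 0}" by (rule finite_zeros_cball)
  qed
  moreover have "infinite (cball (0::complex) 1)" 
    using uncountable_cball[of 1 "0::complex"] uncountable_infinite by auto
  ultimately have "infinite (cball 0 1 - (\<Union>h\<in>\<H>. {z \<in> cball 0 1. h z = 0}))"
    by (intro Diff_infinite_finite)
  then have "cball 0 1 - (\<Union>h\<in>\<H>. {z \<in> cball 0 1. h z = 0}) \<noteq> {}" by (metis finite.emptyI)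
  then obtain z where "z \<in> cball 0 1 - (\<Union>h\<in>\<H>. {z \<in> cball 0 1. h z = 0})" by blast
  then show ?thesis by (intro exI[of _ z]) auto
qed

section \<open>Moving the origin, and the contradiction for two periodic curves\<close>

lemma higher_deriv_shift:
  assumes "F holomorphic_on UNIV"
  shows "(deriv ^^ l) (\<lambda>z. F (z + \<tau>)) = (\<lambda>z. (deriv ^^ l) F (z + \<tau>))"
proof (induction l)
  case (Suc l)
  have "((\<lambda>z. (deriv ^^ l) F (z + \<tau>)) has_field_derivative deriv ((deriv ^^ l) F) (z + \<tau>)) (at z)" for z
  proof -
    have "((deriv ^^ l) F has_field_derivative deriv ((deriv ^^ l) F) (z + \<tau>)) (at (z + \<tau>))"
      using holomorphic_higher_deriv[OF assms open_UNIV, of l] holomorphic_derivI open_UNIV by blast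
    then show ?thesis by (simp add: DERIV_shift)
  qed
  then have "deriv (\<lambda>z. (deriv ^^ l) F (z + \<tau>)) = (\<lambda>z. deriv ((deriv ^^ l) F) (z + \<tau>))"
    by (intro ext DERIV_imp_deriv)
  then show ?case by (simp add: Suc)
qed simp

lemma ord_shift: "F holomorphic_on UNIV \<Longrightarrow> ord (\<lambda>z. F (z + \<tau>)) z = ord F (z + \<tau>)"
  by (simp add: ord_def higher_deriv_shift)

lemma wron_shift: "(\<And>j. j < n \<Longrightarrow> F j holomorphic_on UNIV) \<Longrightarrow> wron n (\<lambda>j z. F j (z + \<tau>)) z = wron n F (z + \<tau>)"
  unfolding wron_def by (intro ndet_cong) (simp add: higher_deriv_shift)

lemma lf_shift: "lf n (\<lambda>i z. f i (z + \<tau>)) b = (\<lambda>z. lf n f b (z + \<tau>))"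
  by (simp add: lf_def fun_eq_iff)

text \<open>Supplies the data of \<open>curve_pair\<close>: an origin \<open>\<tau>\<close> at which
  finitely many functions are nonzero, the permutation \<open>\<sigma>\<close>, and a form
  \<open>b\<close> with zeros in arithmetic progression. The facts \<open>share\<close> and
  \<open>disj\<close> are what the sharing and dimension hypotheses become on a generic
  curve.\<close>

lemma no_two_curves:
  fixes f g :: "nat \<Rightarrow> complex \<Rightarrow> complex" and k :: enat
  assumes hf: "\<And>i. i \<le> n \<Longrightarrow> f i holomorphic_on UNIV" and hg: "\<And>i. i \<le> n \<Longrightarrow> g i holomorphic_on UNIV"
    and indf: "\<And>c. (\<And>z. lf n f c z = 0) \<Longrightarrow> \<forall>i\<le>n. c i = 0" and indg: "\<And>c. (\<And>z. lf n g c z = 0) \<Longrightarrow> \<forall>i\<le>n. c i = 0"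
    and nzf: "\<And>z. \<exists>i\<le>n. f i z \<noteq> 0" and nzg: "\<And>z. \<exists>i\<le>n. g i z \<noteq> 0"
    and gp: "general_position n q a" and n: "1 \<le> n" and q: "2 * n + 2 \<le> q"
    and num: "real q + 2 * real n * real q * (2 + (real q - 2 - 2 * real n) / (2 * real n)) * (case k of enat k' \<Rightarrow> 1 / (real k' + 1) | \<infinity> \<Rightarrow> 0)
       < (2 + (real q - 2 - 2 * real n) / (2 * real n)) * (real q - real n - 1)"
    and share: "\<And>j z. \<lbrakk>j \<in> {1..q}; enat (ord (lf n f (a j)) z) \<le> k; enat (ord (lf n g (a j)) z) \<le> k;
        lf n f (a j) z = 0 \<or> lf n g (a j) z = 0\<rbrakk> \<Longrightarrow>
        lf n f (a j) z = 0 \<and> lf n g (a j) z = 0 \<and> (\<forall>i\<le>n. \<forall>l\<le>n. f i z * g l z = f l z * g i z)"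
    and disj: "\<And>i j z. \<lbrakk>i \<in> {1..q}; j \<in> {1..q}; i < j; lf n f (a i) z = 0; lf n f (a j) z = 0;
        enat (ord (lf n f (a i)) z) \<le> k; enat (ord (lf n f (a j)) z) \<le> k\<rbrakk> \<Longrightarrow> False"
    and ne: "i0 \<le> n" "l0 \<le> n" "f i0 z0 * g l0 z0 \<noteq> f l0 z0 * g i0 z0"
    and per: "\<And>i z. i \<le> n \<Longrightarrow> f i (z + 2 * of_real pi * \<i>) = f i z"
  shows False
proof -
  have Fh: "lf n f b holomorphic_on UNIV" "lf n g b holomorphic_on UNIV" for b
    using hf hg by (auto intro: lf_holomorphic)
  have anz: "\<exists>i\<le>n. a j i \<noteq> 0" if "j \<in> {1..q}" for j
    using general_position_nonzero[OF gp _ that] q by simp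
  have Fnz: "\<exists>z. lf n f (a j) z \<noteq> 0" "\<exists>z. lf n g (a j) z \<noteq> 0" if "j \<in> {1..q}" for j
    using anz[OF that] indf[of "a j"] indg[of "a j"] by blast+
  have Wf: "\<exists>z. wron (Suc n) f z \<noteq> 0"
    by (rule wron_nonzero) (use hf indf in \<open>auto simp: lf_def lessThan_Suc_atMost\<close>)
  have Wg: "\<exists>z. wron (Suc n) g z \<noteq> 0"
    by (rule wron_nonzero) (use hg indg in \<open>auto simp: lf_def lessThan_Suc_atMost\<close>)
  obtain ts where ts: "f 0 ts \<noteq> 0"
  proof -
    have "lf n f (\<lambda>i. if i = 0 then 1 else 0) z = f 0 z" for z
      by (simp add: lf_def if_distrib[of "\<lambda>x. x * _"] cong: if_cong)
    then show ?thesis using indf[of "\<lambda>i. if i = 0 then 1 else 0"] that by fastforce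
  qed
  \<comment> \<open>A hyperplane through \<open>f ts\<close>: its form vanishes at \<open>ts\<close>
    and, by periodicity, at all translates by multiples of the period. The coefficient
    \<open>- f 0 ts\<close> is nonzero, so by independence the form is not identically zero.\<close>
  define b where "b = (\<lambda>i::nat. if i = 0 then f 1 ts else if i = 1 then - f 0 ts else 0)"
  have bz: "lf n f b z = f 1 ts * f 0 z - f 0 ts * f 1 z" for z
  proof -
    have "lf n f b z = (\<Sum>i\<in>{0, 1}. b i * f i z)"
      unfolding lf_def using n by (intro sum.mono_neutral_right) (auto simp: b_def)
    then show ?thesis by (simp add: b_def)
  qed
  have bnz: "\<exists>z. lf n f b z \<noteq> 0"
  proof (rule ccontr)
    assume "\<not> ?thesis"
    then have "\<forall>i\<le>n. b i = 0" using indf[of b] by blast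
    then have "b 1 = 0" using n by blast
    then show False using ts by (simp add: b_def)
  qed
  define wd where "wd = (\<lambda>z. f i0 z * g l0 z - f l0 z * g i0 z)"
  define \<H> where "\<H> = (\<lambda>j. lf n f (a j)) ` {1..q} \<union> (\<lambda>j. lf n g (a j)) ` {1..q} \<union>
    {wron (Suc n) f, wron (Suc n) g, lf n f b, wd}"
  have "\<exists>\<tau>. \<forall>h\<in>\<H>. h \<tau> \<noteq> 0"
  proof (rule common_nonzero_point)
    show "finite \<H>" by (simp add: \<H>_def)
    show "h holomorphic_on UNIV" if "h \<in> \<H>" for h
    proof -
      have "wron (Suc n) f holomorphic_on UNIV" "wron (Suc n) g holomorphic_on UNIV" "wd holomorphic_on UNIV"
        unfolding wd_def using hf hg ne by (auto intro!: wron_holomorphic holomorphic_intros)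
      then show ?thesis using that Fh by (auto simp: \<H>_def)
    qed
    show "\<exists>z. h z \<noteq> 0" if "h \<in> \<H>" for h
    proof -
      have "wd z0 \<noteq> 0" using ne by (simp add: wd_def)
      then show ?thesis using that Fnz Wf Wg bnz unfolding \<H>_def by blast
    qed
  qed
  then obtain \<tau> where \<tau>: "\<forall>h\<in>\<H>. h \<tau> \<noteq> 0" by blast
  have \<tau>F: "lf n f (a j) \<tau> \<noteq> 0" "lf n g (a j) \<tau> \<noteq> 0" if "j \<in> {1..q}" for j
    using \<tau> that by (auto simp: \<H>_def)
  have \<tau>W: "wron (Suc n) f \<tau> \<noteq> 0" "wron (Suc n) g \<tau> \<noteq> 0" "lf n f b \<tau> \<noteq> 0" "wd \<tau> \<noteq> 0"
    using \<tau> by (auto simp: \<H>_def)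
  \<comment> \<open>Classes are formed from ratios at the single point \<open>\<tau>\<close>, so
    that indices in different classes give a \<open>P j\<close> that is nonzero at the new origin
    and not merely somewhere. \<open>\<kappa>\<close> names a class by its least member, since
    \<open>permutation_avoiding_classes\<close> sorts by natural numbers.\<close>
  define r where "r = (\<lambda>j. lf n f (a j) \<tau> / lf n g (a j) \<tau>)"
  define \<kappa> where "\<kappa> = (\<lambda>j. LEAST l. l \<in> {1..q} \<and> r l = r j)"
  have \<kappa>r: "r (\<kappa> j) = r j" if "j \<in> {1..q}" for j
    unfolding \<kappa>_def using LeastI[of "\<lambda>l. l \<in> {1..q} \<and> r l = r j" j] that by blast
  have \<kappa>eq: "r i = r j \<Longrightarrow> \<kappa> i = \<kappa> j" for i j by (simp add: \<kappa>_def)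
  have cls: "card {j \<in> {1..q}. \<kappa> j = v} \<le> n" for v
  proof (rule ccontr)
    assume "\<not> ?thesis"
    then have "Suc n \<le> card {j \<in> {1..q}. \<kappa> j = v}" by (simp only: not_less_eq_eq)
    then obtain J where J: "J \<subseteq> {j \<in> {1..q}. \<kappa> j = v}" "card J = Suc n"
      by (rule obtain_subset_with_card_n)
    have J': "J \<subseteq> {1..q}" using J(1) by blast
    obtain j0 where j0: "j0 \<in> J" using J(2) by (metis card.empty nat.distinct(1) all_not_in_conv)
    obtain B where B: "\<And>w i. i \<le> n \<Longrightarrow> w i = (\<Sum>j\<in>J. B i j * (\<Sum>k\<le>n. a j k * w k))"
      using general_position_inverse[OF gp J' J(2)] by blast
    \<comment> \<open>If \<open>n + 1\<close> indices have the same ratio, their forms all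
      annihilate \<open>w\<close>, so \<open>w = 0\<close> by general position. Then
      \<open>f\<close> and \<open>g\<close> are proportional at \<open>\<tau>\<close>, against
      \<open>wd \<tau> \<noteq> 0\<close>.\<close>
    define w where "w = (\<lambda>i. lf n g (a j0) \<tau> * f i \<tau> - lf n f (a j0) \<tau> * g i \<tau>)"
    have "(\<Sum>k\<le>n. a j k * w k) = 0" if j: "j \<in> J" for j
    proof -
      have "r j = r j0"
        using \<kappa>r[of j] \<kappa>r[of j0] J(1) j j0 by (metis (mono_tags, lifting) mem_Collect_eq subsetD)
      then have "lf n f (a j) \<tau> * lf n g (a j0) \<tau> = lf n f (a j0) \<tau> * lf n g (a j) \<tau>"
        using \<tau>F[of j] \<tau>F[of j0] J' j j0 unfolding r_def by (metis frac_eq_eq subsetD)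
      moreover have "(\<Sum>k\<le>n. a j k * w k) = lf n g (a j0) \<tau> * lf n f (a j) \<tau> - lf n f (a j0) \<tau> * lf n g (a j) \<tau>"
        by (simp add: w_def lf_def[of n f "a j"] lf_def[of n g
            "a j"] sum_distrib_left sum_subtractf[symmetric] algebra_simps)
      ultimately show ?thesis by (simp add: mult.commute)
    qed
    then have w0: "w i = 0" if "i \<le> n" for i using B[OF that, of w] by simp
    have "lf n g (a j0) \<tau> * wd \<tau> = w i0 * g l0 \<tau> - w l0 * g i0 \<tau>"
      by (simp add: wd_def w_def algebra_simps)
    then have "wd \<tau> = 0" using w0[OF ne(1)] w0[OF ne(2)] \<tau>F(2)[of j0] J' j0 by auto
    then show False using \<tau>W(4) by simp
  qed
  obtain \<sigma> where \<sigma>: "bij_betw \<sigma> {1..q} {1..q}" "\<And>j. j \<in> {1..q} \<Longrightarrow> \<kappa> (\<sigma> j) \<noteq> \<kappa> j"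
    using permutation_avoiding_classes[OF cls] q n by auto
  have \<sigma>m: "\<sigma> j \<in> {1..q}" if "j \<in> {1..q}" for j using \<sigma>(1) that by (auto simp: bij_betw_def)
  let ?f = "\<lambda>i z. f i (z + \<tau>)" and ?g = "\<lambda>i z. g i (z + \<tau>)"
  define good where "good = (\<lambda>j z. lf n f (a j) (z + \<tau>) = 0 \<and> lf n g (a j) (z + \<tau>) = 0 \<and>
     enat (ord (lf n f (a j)) (z + \<tau>)) \<le> k \<and> enat (ord (lf n g (a j)) (z + \<tau>)) \<le> k)"
  have shf: "(\<lambda>z. h (z + \<tau>)) holomorphic_on UNIV" if "h holomorphic_on UNIV" for h :: "complex \<Rightarrow> complex"
  proof -
    have "(\<lambda>z. z + \<tau>) holomorphic_on UNIV" by (intro holomorphic_intros)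
    from holomorphic_on_compose_gen[OF this that] show ?thesis by (simp add: o_def)
  qed
  have ordf: "ord (\<lambda>z. lf n f (a j) (z + \<tau>)) z = ord (lf n f (a j)) (z + \<tau>)" for j z by (rule ord_shift[OF Fh(1)])
  have ordg: "ord (\<lambda>z. lf n g (a j) (z + \<tau>)) z = ord (lf n g (a j)) (z + \<tau>)" for j z by (rule ord_shift[OF Fh(2)])
  have perk: "f i (z + of_nat m * (2 * of_real pi * \<i>)) = f i z" if "i \<le> n" for i z and m :: nat
  proof (induction m)
    case (Suc m)
    have "f i (z + of_nat (Suc m) * (2 * of_real pi * \<i>)) = f i ((z + of_nat m * (2 * of_real pi * \<i>))
        + 2 * of_real pi * \<i>)"
      by (simp add: algebra_simps)
    then show ?case using per[OF that] Suc by simp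
  qed simp
  have q1: "Suc n \<le> q" using q by simp
  interpret curve_pair n q ?f ?g a \<sigma> good "case k of enat k' \<Rightarrow> 1 / (real k' + 1) | \<infinity> \<Rightarrow> 0"
    "2 + (real q - 2 - 2 * real n) / (2 * real n)" b "ts - \<tau>"
  proof (unfold_locales, goal_cases)
    case (1 i) then show ?case using hf shf by blast
  next
    case (2 z) then show ?case using nzf by blast
  next
    case 3 then show ?case by (rule gp)
  next
    case 4 then show ?case by (rule q1)
  next
    case (5 j) then show ?case using \<tau>F by (simp add: lf_shift)
  next
    case 6 then show ?case using \<tau>W hf by (simp add: wron_shift)
  next
    case (7 i) then show ?case using hg shf by blast
  next
    case (8 z) then show ?case using nzg by blast
  next
    case (9 j) then show ?case using \<tau>F by (simp add: lf_shift)
  next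
    case 10 then show ?case using \<tau>W hg by (simp add: wron_shift)
  next
    case 11 then show ?case by (rule n)
  next
    case 12 then show ?case by (rule q)
  next
    case 13 then show ?case by (rule \<sigma>(1))
  next
    case (14 j) then show ?case using \<sigma>(2) by metis
  next
    case (15 j)
    have "r j \<noteq> r (\<sigma> j)" using \<sigma>(2)[OF 15] \<kappa>eq by metis
    then have "lf n f (a j) \<tau> * lf n g (a (\<sigma> j)) \<tau> \<noteq> lf n f (a (\<sigma> j)) \<tau> * lf n g (a j) \<tau>"
      using \<tau>F[OF 15] \<tau>F[OF \<sigma>m[OF 15]] unfolding r_def by (metis frac_eq_eq)
    then show ?case by (simp add: lf_shift mult.commute)
  next
    case 16 then show ?case by (simp split: enat.split)
  next
    case (17 j z)
    show ?case
    proof (cases "enat (ord (lf n f (a j)) (z + \<tau>)) \<le> k \<and> enat (ord (lf n g (a j)) (z + \<tau>)) \<le> k")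
      case True
      then have "good j z" using share[of j "z + \<tau>"] 17 unfolding good_def lf_shift by blast
      then show ?thesis ..
    next
      \<comment> \<open>One of the orders is at least \<open>k' + 1\<close>, the reciprocal of the
        weight handed to \<open>curve_pair\<close>.\<close>
      case False
      then obtain k' where k': "k = enat k'" by (cases k) auto
      then have "real k' + 1 \<le> real (ord (lf n f (a j)) (z + \<tau>) + ord (lf n g (a j)) (z + \<tau>))" using False by auto
      then show ?thesis by (simp add: lf_shift ordf ordg k' field_simps)
    qed
  next
    case (18 j z) then show ?case by (simp add: good_def lf_shift)
  next
    case (19 j z i l) then show ?case using share[of j "z + \<tau>"] by (auto simp: good_def)
  next
    case (20 i j z)
    then have gij: "good i z" "good j z" "i \<in> {1..q}" "j \<in> {1..q}" by blast+
    show ?case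
    proof (rule linorder_cases[of i j])
      assume "i < j" then show ?thesis using disj[of i j "z + \<tau>"] gij unfolding good_def by metis
    next
      assume "j < i" then show ?thesis using disj[of j i "z + \<tau>"] gij unfolding good_def by metis
    qed
  next
    case 21 then show ?case by simp
  next
    case 22 then show ?case by (rule num)
  next
    case 23 then show ?case using \<tau>W by (simp add: lf_shift)
  next
    case (24 m) then show ?case
      using perk[of 0 ts m] perk[of 1 ts m] n by (simp add: lf_shift bz algebra_simps)
  qed
  show False by (rule contradiction)
qed

section \<open>Vanishing orders along curves\<close>

lemma has_derivative_imp_lipschitz_at:
  assumes "(f has_derivative D) (at x)"
  obtains L d where "0 < L" "0 < d" "\<And>y. norm (y - x) < d \<Longrightarrow> norm (f y - f x) \<le> L * norm (y - x)"
proof -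
  have bl: "bounded_linear D" using assms by (rule has_derivative_bounded_linear)
  obtain K where K: "0 < K" "\<And>h. norm (D h) \<le> norm h * K" using bounded_linear.pos_bounded[OF bl] by blast
  obtain d where d: "0 < d" "\<And>y. norm (y - x) < d \<Longrightarrow> norm (f y - f x - D (y - x)) \<le> 1 * norm (y - x)"
  proof -
    have "\<forall>e>0. \<exists>d>0. \<forall>y. norm (y - x) < d \<longrightarrow> norm (f y - f x - D (y - x)) \<le> e * norm (y - x)"
      using assms unfolding has_derivative_at_alt by blast
    from this[rule_format, of 1] show ?thesis using that by auto
  qed
  have "norm (f y - f x) \<le> (K + 1) * norm (y - x)" if "norm (y - x) < d" for y
  proof -
    have "norm (f y - f x) \<le> norm (f y - f x - D (y - x)) + norm (D (y - x))"
      using norm_triangle_ineq[of "f y - f x - D (y - x)" "D (y - x)"] by simp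
    then show ?thesis using d(2)[OF that] K(2)[of "y - x"] by (simp add: algebra_simps)
  qed
  then show ?thesis using that[of "K + 1" d] K(1) d(1) by simp
qed

text \<open>A bound by |w|^k at \<open>\<gamma> t0\<close> becomes a bound by |t - t0|^k along the
  curve, because \<open>\<gamma>\<close> is Lipschitz at \<open>t0\<close>; hence \<open>k\<close>
  is at most the order in \<open>t\<close>. This also shows that the exponents in
  \<open>vorder\<close> are bounded, so that \<open>GREATEST\<close> is meaningful, and it is here
  that \<open>nz\<close> enters.\<close>

lemma vorder_curve:
  fixes F :: "complex^'m \<Rightarrow> complex" and \<gamma> :: "complex \<Rightarrow> complex^'m"
  assumes F: "holo_on F UNIV" and \<gamma>: "(\<gamma> has_derivative D) (at t0)"
    and hol: "(\<lambda>t. F (\<gamma> t)) holomorphic_on UNIV" and nz: "F (\<gamma> t1) \<noteq> 0"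
  shows "vorder F (\<gamma> t0) \<le> ord (\<lambda>t. F (\<gamma> t)) t0"
    and "F (\<gamma> t0) = 0 \<Longrightarrow> 0 < vorder F (\<gamma> t0)"
proof -
  let ?z = "\<gamma> t0" and ?p = "ord (\<lambda>t. F (\<gamma> t)) t0"
  define P where "P = (\<lambda>k. \<exists>C>0. \<exists>r>0. \<forall>w. norm w < r \<longrightarrow> norm (F (?z + w)) \<le> C * norm w ^ k)"
  have vo: "vorder F ?z = (GREATEST k. P k)" by (simp add: vorder_def P_def)
  obtain H where H: "H holomorphic_on UNIV" "H t0 \<noteq> 0" "\<And>t. F (\<gamma> t) = (t - t0) ^ ?p * H t"
    using entire_factor_ord[OF hol nz, of t0] by blast
  obtain L d where L: "0 < L" "0 < d" "\<And>t. norm (t - t0) < d \<Longrightarrow> norm (\<gamma> t - \<gamma> t0) \<le> L * norm (t - t0)"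
    using has_derivative_imp_lipschitz_at[OF \<gamma>] by blast
  have bound: "k \<le> ?p" if "P k" for k
  proof (rule ccontr)
    assume "\<not> k \<le> ?p"
    then have kp: "?p < k" by simp
    obtain C r where C: "0 < C" "0 < r" "\<And>w. norm w < r \<Longrightarrow> norm (F (?z + w)) \<le> C * norm w ^ k"
      using \<open>P k\<close> unfolding P_def by blast
    have est: "norm (H t) \<le> C * L ^ k * norm (t - t0) ^ (k - ?p)" if t: "norm (t - t0) < min d (r / L)" "t \<noteq> t0" for t
    proof -
      have l: "norm (\<gamma> t - \<gamma> t0) \<le> L * norm (t - t0)" using L(3) t by simp
      also have "\<dots> < r" using t L(1) by (simp add: pos_less_divide_eq mult.commute)
      finally have "norm (F (?z + (\<gamma> t - \<gamma> t0))) \<le> C * norm (\<gamma> t - \<gamma> t0) ^ k" by (rule C(3))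
      also have "\<dots> \<le> C * (L * norm (t - t0)) ^ k" using l C(1) by (intro mult_left_mono power_mono) auto
      finally have "norm (t - t0) ^ ?p * norm (H t) \<le> C * (L * norm (t - t0)) ^ k"
        by (simp add: H(3)[of t] norm_mult norm_power)
      also have "\<dots> = norm (t - t0) ^ ?p * (C * L ^ k * norm (t - t0) ^ (k - ?p))"
        using kp by (simp add: power_mult_distrib power_add[symmetric])
      finally show ?thesis using t(2) by simp
    qed
    have lim: "((\<lambda>t. C * L ^ k * norm (t - t0) ^ (k - ?p)) \<longlongrightarrow> C * L ^ k * norm (t0 - t0) ^ (k - ?p)) (at t0)"
      by (intro tendsto_intros)
    have limH: "((\<lambda>t. norm (H t)) \<longlongrightarrow> norm (H t0)) (at t0)"
      using entire_isCont[OF H(1), of t0] by (intro tendsto_norm) (simp add: isCont_def)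
    have "eventually (\<lambda>t. norm (H t) \<le> C * L ^ k * norm (t - t0) ^ (k - ?p)) (at t0)"
      unfolding eventually_at using est L C
      by (intro exI[of _ "min d (r / L)"]) (auto simp: dist_norm)
    from tendsto_le[OF _ lim limH this] have "norm (H t0) \<le> C * L ^ k * norm (t0 - t0) ^ (k - ?p)" by simp
    moreover have "0 ^ (k - ?p) = (0::real)" using kp by (simp add: zero_power)
    ultimately show False using H(2) by simp
  qed
  have P0: "P 0"
  proof -
    have "isCont F ?z" using holo_on_continuous[OF F, of UNIV] by (simp add: continuous_on_eq_continuous_at)
    from this[unfolded continuous_at_eps_delta, rule_format, of 1]
    obtain r where r: "0 < r" "\<And>y. dist y ?z < r \<Longrightarrow> dist (F y) (F ?z) < 1" by auto
    have "norm (F (?z + w)) \<le> (norm (F ?z) + 1) * norm w ^ 0" if "norm w < r" for w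
      using r(2)[of "?z + w"] that norm_triangle_ineq2[of "F (?z + w)" "F ?z"] by (simp add: dist_norm)
    then show ?thesis unfolding P_def using r(1)
      by (intro exI[of _ "norm (F ?z) + 1"]) (auto intro: add_nonneg_pos)
  qed
  have "P (vorder F ?z)" unfolding vo using P0 bound by (intro GreatestI_nat[of P 0 ?p]) auto
  then show "vorder F ?z \<le> ?p" by (rule bound)
  assume z0: "F ?z = 0"
  obtain D' where "(F has_derivative D') (at ?z)" using F by (auto simp: holo_on_def)
  then obtain L' d' where L': "0 < L'" "0 < d'" "\<And>y. norm (y - ?z) < d' \<Longrightarrow> norm (F y - F ?z) \<le> L' * norm (y - ?z)"
    using has_derivative_imp_lipschitz_at by blast
  have "norm (F (?z + w)) \<le> L' * norm w ^ 1" if "norm w < d'" for w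
    using L'(3)[of "?z + w"] that z0 by simp
  then have "P 1" unfolding P_def using L'(1,2) by blast
  then have "1 \<le> vorder F ?z" unfolding vo using bound by (intro Greatest_le_nat[of P 1 ?p]) auto
  then show "0 < vorder F ?z" by simp
qed

text \<open>\<open>exp t - exp t0\<close> is divisible by \<open>t - t0\<close>, so every factor
  \<open>s - exp t0\<close> of \<open>\<phi>\<close> contributes at least one to the order in
  \<open>t\<close>.\<close>

lemma ord_le_ord_exp:
  assumes \<phi>: "\<phi> holomorphic_on UNIV" and nz: "\<phi> (exp t1) \<noteq> 0"
  shows "ord \<phi> (exp t0) \<le> ord (\<lambda>t. \<phi> (exp t)) t0"
proof -
  let ?p = "ord \<phi> (exp t0)"
  obtain H where H: "H holomorphic_on UNIV" "\<And>s. \<phi> s = (s - exp t0) ^ ?p * H s"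
    using entire_factor_ord[OF \<phi> nz] by blast
  let ?K = "\<lambda>t. exp t - exp t0"
  have K: "?K holomorphic_on UNIV" by (intro holomorphic_intros)
  have "exp (t0 + 1) = exp 1 * exp t0" by (simp add: exp_add)
  moreover have "exp 1 \<noteq> (1::complex)"
  proof -
    have "exp (1::complex) = of_real (exp 1)" by (metis exp_of_real of_real_1)
    then show ?thesis by simp
  qed
  ultimately have K1: "?K (t0 + 1) \<noteq> 0" by simp
  obtain E where E: "E holomorphic_on UNIV" "\<And>t. ?K t = (t - t0) ^ ord ?K t0 * E t"
    using entire_factor_ord[OF K K1] by blast
  have "0 < ord ?K t0" using ord_pos_iff[OF K K1, of t0] by simp
  then obtain m where m: "ord ?K t0 = Suc m" by (cases "ord ?K t0") auto
  show ?thesis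
  proof (rule le_ordI)
    show "(\<lambda>t. \<phi> (exp t)) holomorphic_on UNIV"
      using holomorphic_on_compose_gen[of exp UNIV \<phi> UNIV] \<phi> by (simp add: o_def holomorphic_on_exp)
    show "\<phi> (exp t1) \<noteq> 0" by (rule nz)
    show "(\<lambda>t. ((t - t0) ^ m * E t) ^ ?p * H (exp t)) holomorphic_on UNIV"
      using holomorphic_on_compose_gen[of exp UNIV H UNIV] H(1) E(1)
      by (intro holomorphic_intros) (simp_all add: o_def holomorphic_on_exp)
    show "\<phi> (exp t) = (t - t0) ^ ?p * (((t - t0) ^ m * E t) ^ ?p * H (exp t))" for t
      unfolding H(2)[of "exp t"] E(2)[of t] m by (simp add: power_mult_distrib mult.assoc)
  qed
qed

lemma holo_on_lincomb:
  assumes "finite I" "\<And>i. i \<in> I \<Longrightarrow> holo_on (f i) U"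
  shows "holo_on (\<lambda>z. \<Sum>i\<in>I. b i * f i z) U"
  unfolding holo_on_def
proof
  fix z assume z: "z \<in> U"
  have "\<forall>i\<in>I. \<exists>D. (f i has_derivative D) (at z) \<and> cplx_linear D" using assms(2) z by (auto simp: holo_on_def)
  from bchoice[OF this] obtain D where D: "\<forall>i\<in>I. (f i has_derivative D i) (at z) \<and> cplx_linear (D i)" ..
  have "((\<lambda>z. \<Sum>i\<in>I. b i * f i z) has_derivative (\<lambda>v. \<Sum>i\<in>I. b i * D i v)) (at z)"
    using D by (intro has_derivative_sum has_derivative_mult_right) auto
  moreover have "cplx_linear (\<lambda>v. \<Sum>i\<in>I. b i * D i v)"
    unfolding cplx_linear_def
  proof (intro allI)
    fix c :: complex and v
    have "(\<Sum>i\<in>I. b i * D i (c *s v)) = (\<Sum>i\<in>I. c * (b i * D i v))"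
      using D by (intro sum.cong) (auto simp: cplx_linear_def)
    then show "(\<Sum>i\<in>I. b i * D i (c *s v)) = c * (\<Sum>i\<in>I. b i * D i v)" by (simp add: sum_distrib_left)
  qed
  ultimately show "\<exists>D. ((\<lambda>z. \<Sum>i\<in>I. b i * f i z) has_derivative D) (at z) \<and> cplx_linear D" by blast
qed

lemma holo_on_fH: "(\<And>i. i \<le> n \<Longrightarrow> holo_on (f i) U) \<Longrightarrow> holo_on (fH n f b) U"
  using holo_on_lincomb[of "{..n}" f U b] by (simp add: fH_def[abs_def])

text \<open>When \<open>r i0 = 0\<close> this is an automorphism of C^m with the shear by
  \<open>- r\<close> as inverse: coordinate \<open>i0\<close> stays, the others are moved by
  functions of it. It bends a line in direction \<open>i0\<close> into a curve through prescribed
  points.\<close>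

definition shear :: "'m \<Rightarrow> ('m \<Rightarrow> complex \<Rightarrow> complex) \<Rightarrow> complex^'m \<Rightarrow> complex^'m" where
  "shear i0 r z = z + (\<chi> i. r i (vec_nth z i0))"

lemma shear_nth: "vec_nth (shear i0 r z) i = vec_nth z i + r i (vec_nth z i0)"
  by (simp add: shear_def)

lemma shear_inverse:
  assumes "r i0 = (\<lambda>_. 0)"
  shows "shear i0 (\<lambda>i t. - r i t) (shear i0 r z) = z" "shear i0 r (shear i0 (\<lambda>i t. - r i t) z) = z"
  using assms by (simp_all add: Finite_Cartesian_Product.vec_eq_iff shear_nth)

lemma shear_has_derivative:
  assumes "\<And>i. r i holomorphic_on UNIV"
  shows "\<exists>D. (shear i0 r has_derivative D) (at z) \<and> (\<forall>c v. D (c *s v) = c *s D v)"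
proof -
  let ?D = "\<lambda>v. v + (\<Sum>i\<in>UNIV. (deriv (r i) (vec_nth z i0) * vec_nth v i0) *s axis i 1)"
  have eq: "shear i0 r = (\<lambda>z. z + (\<Sum>i\<in>UNIV. r i (vec_nth z i0) *s axis i 1))"
  proof
    fix z
    show "shear i0 r z = z + (\<Sum>i\<in>UNIV. r i (vec_nth z i0) *s axis i 1)"
      using basis_expansion[of "\<chi> i. r i (vec_nth z i0)"] by (simp add: shear_def)
  qed
  have "((\<lambda>z. r i (vec_nth z i0)) has_derivative (\<lambda>v. deriv (r i) (vec_nth z i0) * vec_nth v i0)) (at z)" for i
  proof -
    have "(r i has_derivative (*) (deriv (r i) (vec_nth z i0))) (at (vec_nth z i0))"
      using holomorphic_derivI[OF assms open_UNIV UNIV_I] by (simp add: has_field_derivative_def)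
    from has_derivative_compose[OF bounded_linear_imp_has_derivative[OF bounded_linear_vec_nth] this]
    show ?thesis .
  qed
  then have "((\<lambda>z. r i (vec_nth z i0) *s axis i 1) has_derivative (\<lambda>v. (deriv (r i) (vec_nth z i0) * vec_nth v i0) *s axis i 1)) (at z)" for i
    by (rule bounded_linear.has_derivative[OF bounded_linear_vector_scalar_mult])
  then have "(shear i0 r has_derivative ?D) (at z)"
    unfolding eq by (intro has_derivative_add has_derivative_ident has_derivative_sum)
  moreover have "?D (c *s v) = c *s ?D v" for c v
    by (simp add: Finite_Cartesian_Product.vec_eq_iff sum_distrib_left algebra_simps)
  ultimately show ?thesis by blast
qed

lemma continuous_on_shear:
  assumes "\<And>i. r i holomorphic_on UNIV"
  shows "continuous_on A (shear i0 r)"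
proof -
  have "isCont (shear i0 r) z" for z
    using shear_has_derivative[of r i0 z, OF assms] has_derivative_continuous by metis
  then show ?thesis by (simp add: continuous_at_imp_continuous_on)
qed

lemma holo_on_shear:
  assumes F: "holo_on F U" and r: "\<And>i. r i holomorphic_on UNIV"
  shows "holo_on (\<lambda>z. F (shear i0 r z)) {z. shear i0 r z \<in> U}"
  unfolding holo_on_def
proof
  fix z assume "z \<in> {z. shear i0 r z \<in> U}"
  then obtain D where D: "(F has_derivative D) (at (shear i0 r z))" "cplx_linear D"
    using F by (auto simp: holo_on_def)
  obtain D' where D': "(shear i0 r has_derivative D') (at z)" "\<And>c v. D' (c *s v) = c *s D' v"
    using shear_has_derivative[of r i0 z, OF r] by metis
  have "((\<lambda>z. F (shear i0 r z)) has_derivative (\<lambda>v. D (D' v))) (at z)"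
    by (rule has_derivative_compose[OF D'(1) D(1)])
  moreover have "cplx_linear (\<lambda>v. D (D' v))" using D(2) D'(2) by (simp add: cplx_linear_def)
  ultimately show "\<exists>D. ((\<lambda>z. F (shear i0 r z)) has_derivative D) (at z) \<and> cplx_linear D" by blast
qed

lemma dim_le_m2_mono: "dim_le_m2 A \<Longrightarrow> B \<subseteq> A \<Longrightarrow> dim_le_m2 B"
  unfolding dim_le_m2_def by (meson subset_trans)

text \<open>The inverse shear carries a smooth piece of hypersurface in the preimage to one in
  \<open>A\<close>; its derivative stays nonzero by the chain rule.\<close>

lemma dim_le_m2_shear:
  assumes A: "dim_le_m2 A" and r: "\<And>i. r i holomorphic_on UNIV" and r0: "r i0 = (\<lambda>_. 0)"
  shows "dim_le_m2 {w. shear i0 r w \<in> A}"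
  unfolding dim_le_m2_def
proof (intro notI, elim exE conjE)
  fix U a h D
  assume U: "open U" "a \<in> U" "holo_on h U" "h a = 0" and D: "(h has_derivative D) (at a)" "D \<noteq> (\<lambda>v. 0)"
    and sub: "{w \<in> U. h w = 0} \<subseteq> {w. shear i0 r w \<in> A}"
  let ?s = "\<lambda>i t. - r i t"
  have s: "?s i holomorphic_on UNIV" for i by (intro holomorphic_intros r)
  define U' where "U' = {z. shear i0 ?s z \<in> U}"
  define h' where "h' = (\<lambda>z. h (shear i0 ?s z))"
  define a' where "a' = shear i0 r a"
  have aa: "shear i0 ?s a' = a" unfolding a'_def by (rule shear_inverse(1)[of r, OF r0])
  have "U' = shear i0 ?s -` U" by (auto simp: U'_def)
  then have "open U'" using U(1) continuous_on_shear[OF s, of UNIV i0] by (simp add: open_vimage)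
  moreover have "a' \<in> U'" "h' a' = 0" using U(2,4) by (simp_all add: U'_def h'_def aa)
  moreover have hU: "holo_on h' U'" unfolding h'_def U'_def by (rule holo_on_shear[OF U(3) s])
  moreover have "{w \<in> U'. h' w = 0} \<subseteq> A"
  proof clarify
    fix z assume "z \<in> U'" "h' z = 0"
    then have "shear i0 r (shear i0 ?s z) \<in> A" using sub by (auto simp: U'_def h'_def)
    then show "z \<in> A" by (simp add: shear_inverse(2)[of r, OF r0])
  qed
  moreover obtain D' where D': "(h' has_derivative D') (at a')" using hU \<open>a' \<in> U'\<close> by (auto simp: holo_on_def)
  moreover have "D' \<noteq> (\<lambda>v. 0)"
  proof
    assume D0: "D' = (\<lambda>v. 0)"
    obtain E where E: "(shear i0 r has_derivative E) (at a)" using shear_has_derivative[of r i0 a, OF r] by metis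
    have "((\<lambda>z. h' (shear i0 r z)) has_derivative (\<lambda>v. D' (E v))) (at a)"
      by (rule has_derivative_compose[OF E D'[unfolded a'_def]])
    moreover have "(\<lambda>z. h' (shear i0 r z)) = h" by (simp add: h'_def shear_inverse(1)[of r, OF r0])
    ultimately have "(h has_derivative (\<lambda>v. 0)) (at a)" using D0 by simp
    then show False using D has_derivative_unique by blast
  qed
  ultimately show False using A unfolding dim_le_m2_def by blast
qed

text \<open>Newton interpolation: the correction term for a new node vanishes at the old
  ones.\<close>

lemma entire_interpolation:
  assumes "finite T"
  shows "\<exists>p. p holomorphic_on UNIV \<and> (\<forall>t\<in>T. p t = (v t :: complex))"
  using assms
proof (induction T)
  case empty
  show ?case by (intro exI[of _ "\<lambda>_. 0"]) auto
next
  case (insert b T)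
  then obtain p where p: "p holomorphic_on UNIV" "\<forall>t\<in>T. p t = v t" by blast
  let ?q = "\<lambda>z. p z + (v b - p b) * (\<Prod>t\<in>T. (z - t) / (b - t))"
  have "?q holomorphic_on UNIV" using insert(2) by (intro holomorphic_intros p) auto
  moreover have "?q t = v t" if "t \<in> T" for t
  proof -
    have "(\<Prod>u\<in>T. (t - u) / (b - u)) = 0" using insert(1) that by (intro prod_zero) auto
    then show ?thesis using p(2) that by simp
  qed
  moreover have "?q b = v b"
  proof -
    have "(\<Prod>t\<in>T. (b - t) / (b - t)) = 1" using insert(2) by (intro prod.neutral) auto
    then show ?thesis by simp
  qed
  ultimately show ?case by (intro exI[of _ ?q]) auto
qed

text \<open>Points with distinct \<open>i0\<close>-coordinates lie on the graph of an entire map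
  over the \<open>i0\<close>-axis, and this graph is the image of the axis under a shear.\<close>

lemma interpolating_shear:
  fixes Z :: "(complex^'m) set"
  assumes Z: "finite Z" "inj_on (\<lambda>z. vec_nth z i0) Z"
  obtains r where "\<And>i. r i holomorphic_on UNIV" "r i0 = (\<lambda>_. 0)"
    "\<And>z. z \<in> Z \<Longrightarrow> shear i0 r (vec_nth z i0 *s axis i0 1) = z"
proof -
  let ?c = "\<lambda>z. vec_nth z i0"
  have "\<exists>p. p holomorphic_on UNIV \<and> (\<forall>t\<in>?c ` Z. p t = vec_nth (inv_into Z ?c t) i)" for i
    using Z(1) by (intro entire_interpolation) auto
  then obtain p where p: "\<And>i. p i holomorphic_on UNIV" "\<And>i t. t \<in> ?c ` Z \<Longrightarrow> p i t = vec_nth (inv_into Z ?c t) i"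
    by metis
  define r where "r = (\<lambda>i. if i = i0 then (\<lambda>_. 0) else p i)"
  have "shear i0 r (?c z *s axis i0 1) = z" if "z \<in> Z" for z
  proof -
    have "p i (?c z) = vec_nth z i" for i using p(2)[of "?c z" i] that inv_into_f_f[OF Z(2) that] by simp
    then show ?thesis
      by (simp add: Finite_Cartesian_Product.vec_eq_iff shear_nth r_def axis_def)
  qed
  moreover have "r i holomorphic_on UNIV" for i using p(1) by (simp add: r_def)
  moreover have "r i0 = (\<lambda>_. 0)" by (simp add: r_def)
  ultimately show ?thesis using that by blast
qed

text \<open>Moving \<open>w\<close> a little in direction \<open>i0\<close> keeps \<open>G\<close>
  nonzero and lets the coordinate avoid finitely many values.\<close>

lemma nonzero_point_avoiding:
  fixes G :: "complex^'m \<Rightarrow> complex"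
  assumes G: "continuous_on UNIV G" "G w \<noteq> 0" and X: "finite X"
  obtains z where "G z \<noteq> 0" "vec_nth z i0 \<notin> X"
proof -
  let ?l = "\<lambda>t::complex. w + t *s axis i0 1"
  have "continuous_on UNIV ?l"
    by (intro continuous_intros bounded_linear.continuous_on[OF bounded_linear_vector_scalar_mult])
  then have "continuous_on UNIV (\<lambda>t. G (?l t))" by (intro continuous_on_compose2[OF G(1)]) auto
  then have "open {t. G (?l t) \<noteq> 0}" by (intro open_Collect_neq continuous_on_const)
  moreover have "0 \<in> {t. G (?l t) \<noteq> 0}" using G(2) by simp
  ultimately obtain \<epsilon> where \<epsilon>: "0 < \<epsilon>" "ball 0 \<epsilon> \<subseteq> {t. G (?l t) \<noteq> 0}" by (meson open_contains_ball)
  have "infinite (ball (0::complex) \<epsilon>)" using uncountable_ball[OF \<epsilon>(1)] uncountable_infinite by blast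
  then have "infinite {t. G (?l t) \<noteq> 0}" using \<epsilon>(2) infinite_super by blast
  then have "infinite ({t. G (?l t) \<noteq> 0} - (\<lambda>x. x - vec_nth w i0) ` X)"
    using X by (intro Diff_infinite_finite) auto
  then have "{t. G (?l t) \<noteq> 0} - (\<lambda>x. x - vec_nth w i0) ` X \<noteq> {}" by (metis finite.emptyI)
  then obtain t where t: "t \<in> {t. G (?l t) \<noteq> 0} - (\<lambda>x. x - vec_nth w i0) ` X" by blast
  have "vec_nth (?l t) i0 \<notin> X"
  proof
    assume "vec_nth (?l t) i0 \<in> X"
    then have "t \<in> (\<lambda>x. x - vec_nth w i0) ` X"
      by (intro image_eqI[of _ _ "vec_nth (?l t) i0"]) (auto simp: axis_def)
    then show False using t by blast
  qed
  then show ?thesis using that[of "?l t"] t by simp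
qed

text \<open>As a function of the last point, the determinant of size \<open>N + 1\<close> is a
  linear combination of the \<open>f i\<close> whose coefficient at \<open>f N\<close> is the
  previous determinant. Independence yields a point where it is nonzero. The
  \<open>i0\<close>-coordinates are kept distinct for \<open>interpolating_shear\<close>.\<close>

lemma independent_points:
  fixes f :: "nat \<Rightarrow> complex^'m \<Rightarrow> complex"
  assumes "\<And>i. i < N \<Longrightarrow> continuous_on UNIV (f i)"
    and "\<And>c. (\<And>z. (\<Sum>i<N. c i * f i z) = 0) \<Longrightarrow> \<forall>i<N. c i = 0" and X: "finite X"
  shows "\<exists>zs. inj_on (\<lambda>j. vec_nth (zs j) i0) {..<N} \<and> (\<forall>j<N. vec_nth (zs j) i0 \<notin> X) \<and>
    ndet N (\<lambda>i j. f i (zs j)) \<noteq> 0"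
  using assms(1,2)
proof (induction N)
  case 0
  then show ?case by (simp add: ndet_expand)
next
  case (Suc N)
  have ind: "\<forall>i<N. c i = 0" if c: "\<And>z. (\<Sum>i<N. c i * f i z) = 0" for c
  proof -
    have "(\<Sum>i<Suc N. (if i < N then c i else 0) * f i z) = (\<Sum>i<N. c i * f i z)" for z by simp
    then have "\<forall>i<Suc N. (if i < N then c i else 0) = 0" using c by (intro Suc.prems(2)) simp
    then show ?thesis by (metis less_Suc_eq)
  qed
  then obtain zs where zs: "inj_on (\<lambda>j. vec_nth (zs j) i0) {..<N}" "\<forall>j<N. vec_nth (zs j) i0 \<notin> X"
    "ndet N (\<lambda>i j. f i (zs j)) \<noteq> 0"
    using Suc.IH[OF Suc.prems(1) ind] by auto
  obtain C where C: "C N = ndet N (\<lambda>i j. f i (zs j))"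
    "\<And>A'. (\<And>i j. j < N \<Longrightarrow> A' i j = f i (zs j)) \<Longrightarrow> ndet (Suc N) A' = (\<Sum>i<Suc N. A' i N * C i)"
    using ndet_last_col[of N "\<lambda>i j. f i (zs j)"] by blast
  define G where "G = (\<lambda>z. \<Sum>i<Suc N. C i * f i z)"
  have "\<exists>w. G w \<noteq> 0"
  proof (rule ccontr)
    assume "\<not> ?thesis"
    then have "\<forall>i<Suc N. C i = 0" by (intro Suc.prems(2)) (simp add: G_def)
    then show False using C(1) zs(3) by simp
  qed
  then obtain w where w: "G w \<noteq> 0" by blast
  have "continuous_on UNIV G" unfolding G_def
    using Suc.prems(1) by (intro continuous_intros) auto
  from nonzero_point_avoiding[OF this w, of "X \<union> (\<lambda>j. vec_nth (zs j) i0) ` {..<N}" i0] X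
  obtain z where z: "G z \<noteq> 0" "vec_nth z i0 \<notin> X \<union> (\<lambda>j. vec_nth (zs j) i0) ` {..<N}" by auto
  let ?zs = "zs(N := z)"
  have "ndet (Suc N) (\<lambda>i j. f i (?zs j)) = (\<Sum>i<Suc N. f i (?zs N) * C i)"
    by (rule C(2)) auto
  also have "\<dots> = G z" by (simp add: G_def mult.commute)
  finally have "ndet (Suc N) (\<lambda>i j. f i (?zs j)) \<noteq> 0" using z(1) by simp
  moreover have "inj_on (\<lambda>j. vec_nth (?zs j) i0) {..<Suc N}"
  proof (rule inj_onI)
    fix j k assume jk: "j \<in> {..<Suc N}" "k \<in> {..<Suc N}" "vec_nth (?zs j) i0 = vec_nth (?zs k) i0"
    have ne: "vec_nth (zs l) i0 \<noteq> vec_nth z i0" if "l < N" for l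
    proof
      assume "vec_nth (zs l) i0 = vec_nth z i0"
      then have "vec_nth z i0 \<in> (\<lambda>j. vec_nth (zs j) i0) ` {..<N}" using that by (intro image_eqI[of _ _ l]) auto
      then show False using z(2) by blast
    qed
    show "j = k"
    proof (cases "j = N \<or> k = N")
      case True
      then show ?thesis using jk ne[of j] ne[of k] by (auto split: if_splits)
    next
      case False
      then show ?thesis using jk inj_onD[OF zs(1), of j k] by auto
    qed
  qed
  moreover have "\<forall>j<Suc N. vec_nth (?zs j) i0 \<notin> X" using zs(2) z(2) by (auto simp: less_Suc_eq)
  ultimately show ?case by blast
qed

lemma meagre_cover_Un: "meagre_cover A \<Longrightarrow> meagre_cover B \<Longrightarrow> meagre_cover (A \<union> B)"
  using meagre_cover_UN[of UNIV "\<lambda>b. if b then A else B"] by (auto simp: UNIV_bool Un_commute)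

lemma meagre_lines_through_common_zeros:
  fixes f :: "nat \<Rightarrow> complex^'m \<Rightarrow> complex"
  assumes f: "\<And>i. i \<le> n \<Longrightarrow> holo_on (f i) UNIV" and nz: "i1 \<le> n" "f i1 w \<noteq> 0"
    and dim: "dim_le_m2 {z. \<forall>i\<le>n. f i z = 0}"
  shows "meagre_cover {c. \<exists>t. \<forall>i\<le>n. f i (c + t *s e) = 0}"
proof -
  let ?C = "{z. \<forall>i\<le>n. f i z = 0}"
  have "?C = (\<Inter>i\<in>{..n}. {z. f i z = 0})" by auto
  moreover have "closed (\<Inter>i\<in>{..n}. {z. f i z = 0})"
    by (intro closed_INT ballI closed_Collect_eq continuous_on_const holo_on_continuous f) auto
  ultimately have "closed ?C" by (simp only:)
  moreover have "?C \<inter> UNIV \<subseteq> {z. f i1 z = 0}" using nz(1) by auto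
  ultimately show ?thesis
    using generic_line_avoids[OF f[OF nz(1)] nz(2) _ open_UNIV, of ?C e] dim by simp
qed

text \<open>The order along \<open>e\<close> takes the place of \<open>vorder\<close>: that some
  derivative of order at most \<open>k\<close> is nonzero is an open condition, so the set has the
  shape of a closed set intersected with an open one, as \<open>generic_line_avoids\<close>
  requires.\<close>

lemma meagre_lines_through_intersection:
  fixes F G :: "complex^'m \<Rightarrow> complex"
  assumes F: "holo_on F UNIV" "F w \<noteq> 0" and G: "holo_on G UNIV"
    and dim: "dim_le_m2 ({z. F z = 0 \<and> G z = 0} \<inter>
      {z. (\<exists>l. enat l \<le> k \<and> (pd e ^^ l) F z \<noteq> 0) \<and> (\<exists>l. enat l \<le> k \<and> (pd e ^^ l) G z \<noteq> 0)})"
  shows "meagre_cover {c. \<exists>t. c + t *s e \<in> {z. F z = 0 \<and> G z = 0} \<inter>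
      {z. (\<exists>l. enat l \<le> k \<and> (pd e ^^ l) F z \<noteq> 0) \<and> (\<exists>l. enat l \<le> k \<and> (pd e ^^ l) G z \<noteq> 0)}}"
proof (rule generic_line_avoids[OF F _ _ _ dim])
  show "closed {z. F z = 0 \<and> G z = 0}"
    by (intro closed_Collect_conj closed_Collect_eq continuous_on_const holo_on_continuous F G)
  have op: "open {z. \<exists>l. enat l \<le> k \<and> (pd e ^^ l) H z \<noteq> 0}" if "holo_on H UNIV" for H :: "complex^'m \<Rightarrow> complex"
  proof -
    have "{z. \<exists>l. enat l \<le> k \<and> (pd e ^^ l) H z \<noteq> 0} = (\<Union>l\<in>{l. enat l \<le> k}. {z. (pd e ^^ l) H z \<noteq> 0})" by auto
    moreover have "open (\<Union>l\<in>{l. enat l \<le> k}. {z. (pd e ^^ l) H z \<noteq> 0})"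
      by (intro open_UN ballI open_Collect_neq continuous_on_const holo_on_continuous holo_on_pd_iter that)
    ultimately show ?thesis by (simp only:)
  qed
  show "open {z. (\<exists>l. enat l \<le> k \<and> (pd e ^^ l) F z \<noteq> 0) \<and> (\<exists>l. enat l \<le> k \<and> (pd e ^^ l) G z \<noteq> 0)}"
    by (intro open_Collect_conj op F G)
qed auto

theorem theorem1:
  fixes n x y p q :: nat and k :: enat
    and f g :: "nat \<Rightarrow> complex^'m \<Rightarrow> complex"
    and a :: "nat \<Rightarrow> nat \<Rightarrow> complex"
  assumes "2 \<le> p" "p \<le> n" "1 \<le> y" "y \<le> 2 * n"
    and "real x < real (2 * n - y + 1)"
    and "real x < real ((p - 1) * y) / real (n + 1 + y)"
    and "k = \<infinity> \<or> (\<exists>k'::nat. k = enat k' \<and>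
           real (2 * n * (n + 1 + y) * (3 * n + p - x)) / (real ((p - 1) * y) - real x * real (n + 1 + y))
             \<le> real k')"
    and "reduced_rep n f" "reduced_rep n g"
    and "lin_nondegenerate n f" "lin_nondegenerate n g"
    and "q = 3 * n + 1 - x"
    and "general_position n q a"
    and "\<forall>j\<in>{n + 2 + y..q}. \<forall>z \<in> Eset n k f (a j) \<inter> Eset n k g (a j).
           min (vorder (fH n f (a j)) z) 1 = min (vorder (fH n g (a j)) z) 1"
    and "\<forall>j\<in>{1..n + 1 + y}. \<forall>z \<in> Eset n k f (a j) \<inter> Eset n k g (a j).
           min (vorder (fH n f (a j)) z) p = min (vorder (fH n g (a j)) z) p"
    and "\<forall>i j. 1 \<le> i \<and> i < j \<and> j \<le> q \<longrightarrow>
           dim_le_m2 (Estar n k f (a i) \<inter> Estar n k f (a j)) \<and>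
           dim_le_m2 (Estar n k g (a i) \<inter> Estar n k g (a j))"
    and "eq_on n f g (\<Union>j\<in>{1..q}. Estar n k f (a j) \<inter> Estar n k g (a j))"
  shows "eq_on n f g UNIV"
proof (rule ccontr)
  assume "\<not> eq_on n f g UNIV"
  then obtain z0 i1 l1 where ne: "i1 \<le> n" "l1 \<le> n" "f i1 z0 * g l1 z0 \<noteq> f l1 z0 * g i1 z0"
    by (auto simp: eq_on_def)
  define \<kappa> :: real where "\<kappa> = (case k of enat k' \<Rightarrow> 1 / (real k' + 1) | \<infinity> \<Rightarrow> 0)"
  have "\<kappa> = 0 \<or> (\<exists>k'::nat. \<kappa> = 1 / (real k' + 1) \<and>
       real (2 * n * (n + 1 + y) * (3 * n + p - x)) / (real ((p - 1) * y) - real x * real (n + 1 + y)) \<le> real k')"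
    using assms(7) by (auto simp: \<kappa>_def)
  note num = numeric_condition[OF assms(1-4,6) this assms(12)]
  have n: "1 \<le> n" using assms(1,2) by linarith
  have hf: "holo_on (f i) UNIV" and hg: "holo_on (g i) UNIV" if "i \<le> n" for i
    using assms(8,9) that by (auto simp: reduced_rep_def)
  have indf: "\<forall>i\<le>n. c i = 0" if "\<And>z. (\<Sum>i\<le>n. c i * f i z) = 0" for c
    using assms(10) that unfolding lin_nondegenerate_def by blast
  have indg: "\<forall>i\<le>n. c i = 0" if "\<And>z. (\<Sum>i\<le>n. c i * g i z) = 0" for c
    using assms(11) that unfolding lin_nondegenerate_def by blast
  \<comment> \<open>Both truncation levels, 1 and \<open>p \<ge> 2\<close>, are positive, so either
    assumption gives the same zeros.\<close>
  have share: "(0 < vorder (fH n f (a j)) z \<longleftrightarrow> 0 < vorder (fH n g (a j)) z)"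
    if "j \<in> {1..q}" "enat (vorder (fH n f (a j)) z) \<le> k" "enat (vorder (fH n g (a j)) z) \<le> k" for j z
  proof (cases "j \<le> n + 1 + y")
    case True
    then have "min (vorder (fH n f (a j)) z) p = min (vorder (fH n g (a j)) z) p"
      using assms(15) that by (auto simp: Eset_def)
    then show ?thesis using assms(1) by (auto simp: min_def split: if_splits)
  next
    case False
    then have "min (vorder (fH n f (a j)) z) 1 = min (vorder (fH n g (a j)) z) 1"
      using assms(14) that by (auto simp: Eset_def)
    then show ?thesis by (auto simp: min_def split: if_splits)
  qed
  define i0 :: 'm where "i0 = undefined" \<comment> \<open>any coordinate will do\<close>
  define e :: "complex^'m" where "e = axis i0 1"
  let ?co = "\<lambda>z::complex^'m. vec_nth z i0"

  \<comment> \<open>Test points and the shear through them\<close>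
  define wd where "wd = (\<lambda>z. f i1 z * g l1 z - f l1 z * g i1 z)"
  have cf: "continuous_on A (f i)" and cg: "continuous_on A (g i)" if "i \<le> n" for i A
    using that by (auto intro: holo_on_continuous hf hg)
  have cwd: "continuous_on A wd" for A unfolding wd_def using ne(1,2) by (intro continuous_intros cf cg)
  \<comment> \<open>The points \<open>zf\<close> and \<open>zg\<close> witness the nondegeneracy of
    \<open>f\<close> and \<open>g\<close> by nonzero determinants, and \<open>zw\<close> witnesses
    that \<open>f\<close> and \<open>g\<close> differ.\<close>
  obtain zf where zf: "inj_on (\<lambda>j. ?co (zf j)) {..<Suc n}" "ndet (Suc n) (\<lambda>i j. f i (zf j)) \<noteq> 0"
    using independent_points[of "Suc n" f "{}" i0] cf indf by (auto simp: lessThan_Suc_atMost less_Suc_eq_le)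
  define X1 where "X1 = (\<lambda>j. ?co (zf j)) ` {..<Suc n}"
  obtain zg where zg: "inj_on (\<lambda>j. ?co (zg j)) {..<Suc n}" "\<forall>j<Suc n. ?co (zg j) \<notin> X1"
      "ndet (Suc n) (\<lambda>i j. g i (zg j)) \<noteq> 0"
    using independent_points[of "Suc n" g X1 i0] cg indg by (auto simp: lessThan_Suc_atMost less_Suc_eq_le X1_def)
  define X2 where "X2 = X1 \<union> (\<lambda>j. ?co (zg j)) ` {..<Suc n}"
  obtain zw where zw: "wd zw \<noteq> 0" "?co zw \<notin> X2"
    using nonzero_point_avoiding[OF cwd, of z0 X2 i0] ne(3) by (auto simp: wd_def X2_def X1_def)
  define Z where "Z = zf ` {..<Suc n} \<union> zg ` {..<Suc n} \<union> {zw}"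
  have injZ: "inj_on ?co Z"
  proof -
    have 1: "inj_on ?co (zf ` {..<Suc n})" "inj_on ?co (zg ` {..<Suc n})"
      using zf(1) zg(1) by (auto simp: inj_on_def)
    have "?co ` (zf ` {..<Suc n}) = X1" "?co ` (zg ` {..<Suc n}) \<inter> X1 = {}"
        "?co ` (zf ` {..<Suc n} \<union> zg ` {..<Suc n}) = X2"
      using zg(2) by (auto simp: X1_def X2_def image_image image_Un)
    then show ?thesis unfolding Z_def using 1 zw(2)
      by (simp add: inj_on_Un inj_on_insert) blast
  qed
  have finZ: "finite Z" by (simp add: Z_def)
  obtain r where r: "\<And>i. r i holomorphic_on UNIV" "r i0 = (\<lambda>_. 0)" "\<And>z. z \<in> Z \<Longrightarrow> shear i0 r (?co z *s e) = z"
    using interpolating_shear[OF finZ injZ] unfolding e_def by blast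
  let ?\<Psi> = "shear i0 r"
  let ?f = "\<lambda>i z. f i (?\<Psi> z)" and ?g = "\<lambda>i z. g i (?\<Psi> z)"
  have hcomp: "holo_on (\<lambda>z. F (?\<Psi> z)) UNIV" if "holo_on F UNIV" for F
    using holo_on_shear[OF that r(1)] by simp
  have hf': "holo_on (?f i) UNIV" and hg': "holo_on (?g i) UNIV" if "i \<le> n" for i
    using that by (auto intro: hcomp hf hg)
  have hF: "holo_on (fH n f b) UNIV" "holo_on (fH n g b) UNIV" for b
    by (auto intro: holo_on_fH hf hg)
  have fH': "fH n ?f b z = fH n f b (?\<Psi> z)" "fH n ?g b z = fH n g b (?\<Psi> z)" for b z
    by (simp_all add: fH_def)
  \<comment> \<open>The translations \<open>c\<close> for which the curve still passes all three
    tests. The conditions are open and hold at \<open>c = 0\<close>, where the curve runs through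
    the test points.\<close>
  define V where "V = {c. ndet (Suc n) (\<lambda>i j. ?f i (c + ?co (zf j) *s e)) \<noteq> 0} \<inter>
    {c. ndet (Suc n) (\<lambda>i j. ?g i (c + ?co (zg j) *s e)) \<noteq> 0} \<inter> {c. wd (?\<Psi> (c + ?co zw *s e)) \<noteq> 0}"
  have cont_ndet: "continuous_on UNIV (\<lambda>c. ndet (Suc n) (\<lambda>i j. h i (c + s j *s e)))"
    if "\<And>i. i \<le> n \<Longrightarrow> holo_on (h i) UNIV" for h :: "nat \<Rightarrow> complex^'m \<Rightarrow> complex" and s :: "nat \<Rightarrow> complex"
  proof -
    have "continuous_on UNIV (\<lambda>c. h i (c + s j *s e))" if "i < Suc n" for i j
      by (intro continuous_on_compose2[OF holo_on_continuous[of "h i" UNIV]] continuous_intros)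
        (use that \<open>\<And>i. i \<le> n \<Longrightarrow> holo_on (h i) UNIV\<close> in auto)
    then show ?thesis unfolding ndet_expand by (intro continuous_intros) auto
  qed
  have "open V"
  proof -
    have "continuous_on UNIV (\<lambda>c. wd (?\<Psi> (c + ?co zw *s e)))"
      by (intro continuous_on_compose2[OF cwd[of UNIV]] continuous_on_compose2[OF continuous_on_shear[OF r(1), of UNIV]] continuous_intros) auto
    then show ?thesis unfolding V_def
      by (intro open_Int open_Collect_neq continuous_on_const cont_ndet hf' hg')
  qed
  moreover have "0 \<in> V"
  proof -
    have "ndet (Suc n) (\<lambda>i j. ?f i (0 + ?co (zf j) *s e)) = ndet (Suc n) (\<lambda>i j. f i (zf j))"
      by (intro ndet_cong) (use r(3) in \<open>auto simp: Z_def\<close>)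
    moreover have "ndet (Suc n) (\<lambda>i j. ?g i (0 + ?co (zg j) *s e)) = ndet (Suc n) (\<lambda>i j. g i (zg j))"
      by (intro ndet_cong) (use r(3) in \<open>auto simp: Z_def\<close>)
    moreover have "?\<Psi> (0 + ?co zw *s e) = zw" using r(3)[of zw] by (simp add: Z_def)
    ultimately show ?thesis using zf(2) zg(3) zw(1) by (simp add: V_def)
  qed
  ultimately have V: "open V" "V \<noteq> {}" by auto

  \<comment> \<open>Exceptional translations and the choice of \<open>c\<close>\<close>
  have anz: "\<exists>i\<le>n. a j i \<noteq> 0" if "j \<in> {1..q}" for j
    using general_position_nonzero[OF assms(13) _ that] num(1) by simp
  have surj: "\<exists>w. ?\<Psi> w = z" for z
    using shear_inverse(2)[of r, OF r(2)] by blast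
  have Fnz: "\<exists>w. fH n f (a j) (?\<Psi> w) \<noteq> 0" if j: "j \<in> {1..q}" for j
  proof -
    obtain z where "fH n f (a j) z \<noteq> 0" using indf[of "a j"] anz[OF j] unfolding fH_def by blast
    then show ?thesis using surj[of z] by metis
  qed
  have line_der: "\<exists>D. ((\<lambda>t. ?\<Psi> (c + \<phi> t *s e)) has_derivative D) (at t0)"
    if "\<phi> holomorphic_on UNIV" for c t0 and \<phi> :: "complex \<Rightarrow> complex"
  proof -
    have "(\<phi> has_derivative (*) (deriv \<phi> t0)) (at t0)"
      using holomorphic_derivI[OF that open_UNIV UNIV_I] by (simp add: has_field_derivative_def)
    from bounded_linear.has_derivative[OF bounded_linear_vector_scalar_mult this, of e]
    have "((\<lambda>t. c + \<phi> t *s e) has_derivative (\<lambda>h. (deriv \<phi> t0 * h) *s e)) (at t0)"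
      by (auto intro!: derivative_eq_intros)
    moreover obtain D' where "(?\<Psi> has_derivative D') (at (c + \<phi> t0 *s e))"
      using shear_has_derivative[of r i0 "c + \<phi> t0 *s e", OF r(1)] by metis
    ultimately show ?thesis using has_derivative_compose by blast
  qed
  \<comment> \<open>Large enough to contain every common zero whose orders along the line are at
    most \<open>k\<close>, and small enough to lie over the intersection of the sets
    \<open>Estar\<close>, because \<open>vorder\<close> never exceeds the order along the
    line.\<close>
  define A where "A = (\<lambda>i j. {z. fH n f (a i) (?\<Psi> z) = 0 \<and> fH n f (a j) (?\<Psi> z) = 0} \<inter>
      {z. (\<exists>l. enat l \<le> k \<and> (pd e ^^ l) (\<lambda>z. fH n f (a i) (?\<Psi> z)) z \<noteq> 0) \<and>
          (\<exists>l. enat l \<le> k \<and> (pd e ^^ l) (\<lambda>z. fH n f (a j) (?\<Psi> z)) z \<noteq> 0)})"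
  have Estar: "?\<Psi> z \<in> Estar n k f (a j)"
    if "fH n f (a j) (?\<Psi> z) = 0" "enat l \<le> k" "(pd e ^^ l) (\<lambda>z. fH n f (a j) (?\<Psi> z)) z \<noteq> 0" for j l z
  proof -
    let ?h = "\<lambda>t. fH n f (a j) (?\<Psi> (z + t *s e))"
    have hh: "?h holomorphic_on UNIV" by (rule holo_on_line(1)[OF hcomp[OF hF(1)]])
    have dl: "(deriv ^^ l) ?h 0 \<noteq> 0" using that(3) by (simp add: higher_deriv_line[OF hcomp[OF hF(1)]])
    then have "ord ?h 0 \<le> l" by (rule ord_le)
    have "\<exists>t1. ?h t1 \<noteq> 0"
    proof (rule ccontr)
      assume "\<not> ?thesis"
      then have "?h = (\<lambda>t. 0)" by auto
      then show False using dl by (simp add: higher_deriv_const)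
    qed
    then obtain t1 where t1: "?h t1 \<noteq> 0" by blast
    obtain D where D: "((\<lambda>t. ?\<Psi> (z + t *s e)) has_derivative D) (at 0)"
      using line_der[of "\<lambda>t. t"] by (auto simp: holomorphic_on_ident)
    from vorder_curve[OF hF(1) D hh t1] \<open>ord ?h 0 \<le> l\<close> that(1)
    have "vorder (fH n f (a j)) (?\<Psi> z) \<le> l" "0 < vorder (fH n f (a j)) (?\<Psi> z)" by auto
    then show ?thesis using that(2) by (simp add: Estar_def) (meson enat_ord_simps(1) order_trans)
  qed
  have Adim: "dim_le_m2 (A i j)" if "1 \<le> i" "i < j" "j \<le> q" for i j
  proof (rule dim_le_m2_mono)
    show "dim_le_m2 {w. ?\<Psi> w \<in> Estar n k f (a i) \<inter> Estar n k f (a j)}"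
      using assms(16) that by (intro dim_le_m2_shear r) blast
    show "A i j \<subseteq> {w. ?\<Psi> w \<in> Estar n k f (a i) \<inter> Estar n k f (a j)}"
      using Estar by (auto simp: A_def)
  qed
  define IJ where "IJ = {(i, j). 1 \<le> i \<and> i < j \<and> j \<le> q}"
  have "meagre_cover (\<Union>x\<in>IJ. {c. \<exists>t. c + t *s e \<in> A (fst x) (snd x)})"
  proof (rule meagre_cover_UN)
    show "countable IJ" by (rule countable_subset[OF subset_UNIV]) simp
    fix x assume "x \<in> IJ"
    then obtain i j where x: "x = (i, j)" "1 \<le> i" "i < j" "j \<le> q" by (auto simp: IJ_def)
    obtain w where w: "fH n f (a i) (?\<Psi> w) \<noteq> 0" using Fnz[of i] x by auto
    from meagre_lines_through_intersection[OF hcomp[OF hF(1)] w hcomp[OF hF(1)] Adim[OF x(2-4), unfolded A_def]]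
    show "meagre_cover {c. \<exists>t. c + t *s e \<in> A (fst x) (snd x)}" by (simp add: x(1) A_def)
  qed
  moreover have "meagre_cover {c. \<exists>t. \<forall>i\<le>n. ?f i (c + t *s e) = 0}"
  proof -
    have "f i1 z0 \<noteq> 0 \<or> f l1 z0 \<noteq> 0" using ne(3) by auto
    then obtain i where "i \<le> n" "f i z0 \<noteq> 0" using ne(1,2) by blast
    moreover obtain w where "?\<Psi> w = z0" using surj by blast
    moreover have "dim_le_m2 {w. ?\<Psi> w \<in> {z. \<forall>i\<le>n. f i z = 0}}"
      using assms(8) by (intro dim_le_m2_shear r) (simp add: reduced_rep_def)
    ultimately show ?thesis using hf' by (intro meagre_lines_through_common_zeros[of n ?f i w]) auto
  qed
  moreover have "meagre_cover {c. \<exists>t. \<forall>i\<le>n. ?g i (c + t *s e) = 0}"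
  proof -
    have "g i1 z0 \<noteq> 0 \<or> g l1 z0 \<noteq> 0" using ne(3) by auto
    then obtain i where "i \<le> n" "g i z0 \<noteq> 0" using ne(1,2) by blast
    moreover obtain w where "?\<Psi> w = z0" using surj by blast
    moreover have "dim_le_m2 {w. ?\<Psi> w \<in> {z. \<forall>i\<le>n. g i z = 0}}"
      using assms(9) by (intro dim_le_m2_shear r) (simp add: reduced_rep_def)
    ultimately show ?thesis using hg' by (intro meagre_lines_through_common_zeros[of n ?g i w]) auto
  qed
  ultimately have "meagre_cover ((\<Union>x\<in>IJ. {c. \<exists>t. c + t *s e \<in> A (fst x) (snd x)}) \<union>
    ({c. \<exists>t. \<forall>i\<le>n. ?f i (c + t *s e) = 0} \<union> {c. \<exists>t. \<forall>i\<le>n. ?g i (c + t *s e) = 0}))"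
    by (intro meagre_cover_Un)
  from meagre_cover_avoid[OF this V] obtain c where c: "c \<in> V"
    and cA: "\<And>i j t. 1 \<le> i \<Longrightarrow> i < j \<Longrightarrow> j \<le> q \<Longrightarrow> c + t *s e \<notin> A i j"
    and cf0: "\<And>t. \<exists>i\<le>n. ?f i (c + t *s e) \<noteq> 0" and cg0: "\<And>t. \<exists>i\<le>n. ?g i (c + t *s e) \<noteq> 0"
    by (auto simp: IJ_def)
  \<comment> \<open>Composing with exp gives periodic curves, whose characteristic functions grow at least linearly.\<close>
  let ?\<gamma> = "\<lambda>t. ?\<Psi> (c + exp t *s e)"
  let ?F = "\<lambda>i t. f i (?\<gamma> t)" and ?G = "\<lambda>i t. g i (?\<gamma> t)"
  have exph: "(\<lambda>t. \<phi> (exp t)) holomorphic_on UNIV" if "\<phi> holomorphic_on UNIV" for \<phi> :: "complex \<Rightarrow> complex"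
    using holomorphic_on_compose_gen[OF holomorphic_on_exp that, of UNIV] by (simp add: o_def)
  have lineh: "(\<lambda>s. H (?\<Psi> (c + s *s e))) holomorphic_on UNIV" if "holo_on H UNIV" for H
    by (rule holo_on_line(1)[OF hcomp[OF that]])
  \<comment> \<open>\<open>exp\<close> omits 0, so the curve misses the point \<open>c\<close> of
    the line; the identity theorem recovers it.\<close>
  have extend: "\<phi> s = 0" if "\<phi> holomorphic_on UNIV" "\<And>t. \<phi> (exp t) = 0" for \<phi> :: "complex \<Rightarrow> complex" and s
  proof (rule analytic_continuation_open[of "- {0}" UNIV \<phi> "\<lambda>_. 0"])
    fix z :: complex assume "z \<in> - {0}"
    then show "\<phi> z = 0" using that(2)[of "Ln z"] by simp
  qed (use that(1) in \<open>auto intro!: exI[of _ "1::complex"]\<close>)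
  have ndet_ind: "\<forall>i\<le>n. b i = 0"
    if "\<And>j. j < Suc n \<Longrightarrow> (\<Sum>i\<le>n. b i * u i j) = 0" "ndet (Suc n) u \<noteq> 0" for b :: "nat \<Rightarrow> complex" and u
  proof (rule ccontr)
    assume "\<not> ?thesis"
    then have "\<exists>i<Suc n. b i \<noteq> 0" by (auto simp: less_Suc_eq_le)
    moreover have "\<forall>j<Suc n. (\<Sum>i<Suc n. u i j * b i) = 0"
      using that(1) by (simp add: lessThan_Suc_atMost mult.commute)
    ultimately have "ndet (Suc n) (\<lambda>j i. u i j) = 0" unfolding ndet_zero_iff by blast
    then show False using that(2) ndet_transpose[of "Suc n" u] by simp
  qed
  have ordF: "vorder H (?\<gamma> t) \<le> ord (\<lambda>t. H (?\<gamma> t)) t" "H (?\<gamma> t) = 0 \<Longrightarrow> 0 < vorder H (?\<gamma> t)"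
    if H: "holo_on H UNIV" and nz: "H (?\<gamma> t1) \<noteq> 0" for H t t1
  proof -
    obtain D where D: "(?\<gamma> has_derivative D) (at t)" using line_der[OF holomorphic_on_exp] by blast
    show "vorder H (?\<gamma> t) \<le> ord (\<lambda>t. H (?\<gamma> t)) t" "H (?\<gamma> t) = 0 \<Longrightarrow> 0 < vorder H (?\<gamma> t)"
      using vorder_curve[OF H D exph[OF lineh[OF H]] nz] by auto
  qed
  have lfF: "lf n ?F b t = fH n f b (?\<gamma> t)" "lf n ?G b t = fH n g b (?\<gamma> t)" for b t
    by (simp_all add: lf_def fH_def)
  have indF: "\<forall>i\<le>n. b i = 0" if "\<And>t. lf n ?F b t = 0" for b
  proof -
    have "fH n f b (?\<Psi> (c + s *s e)) = 0" for s
      by (rule extend[OF lineh[OF hF(1)]]) (use that lfF in simp)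
    then have "(\<Sum>i\<le>n. b i * ?f i (c + ?co (zf j) *s e)) = 0" for j by (simp add: fH_def)
    then show ?thesis using c by (intro ndet_ind[of b "\<lambda>i j. ?f i (c + ?co (zf j) *s e)"]) (auto simp: V_def)
  qed
  have indG: "\<forall>i\<le>n. b i = 0" if "\<And>t. lf n ?G b t = 0" for b
  proof -
    have "fH n g b (?\<Psi> (c + s *s e)) = 0" for s
      by (rule extend[OF lineh[OF hF(2)]]) (use that lfF in simp)
    then have "(\<Sum>i\<le>n. b i * ?g i (c + ?co (zg j) *s e)) = 0" for j by (simp add: fH_def)
    then show ?thesis using c by (intro ndet_ind[of b "\<lambda>i j. ?g i (c + ?co (zg j) *s e)"]) (auto simp: V_def)
  qed
  have FGnz: "\<exists>t. fH n f (a j) (?\<gamma> t) \<noteq> 0" "\<exists>t. fH n g (a j) (?\<gamma> t) \<noteq> 0" if "j \<in> {1..q}" for j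
    using indF[of "a j"] indG[of "a j"] anz[OF that] unfolding lfF by blast+
  have "\<exists>t. wd (?\<gamma> t) \<noteq> 0"
  proof (rule ccontr)
    assume "\<not> ?thesis"
    then have "wd (?\<Psi> (c + exp t *s e)) = 0" for t by simp
    moreover have "(\<lambda>s. wd (?\<Psi> (c + s *s e))) holomorphic_on UNIV"
      unfolding wd_def using ne(1,2) by (intro holomorphic_intros lineh hf hg)
    ultimately have "wd (?\<Psi> (c + ?co zw *s e)) = 0" by (rule extend[rotated])
    then show False using c by (simp add: V_def)
  qed
  then obtain t1 where t1: "wd (?\<gamma> t1) \<noteq> 0" by blast

  \<comment> \<open>Verification of the hypotheses for the restricted curves\<close>
  show False
  proof (rule no_two_curves[of n ?F ?G q a k i1 l1 t1])
    show "?F i holomorphic_on UNIV" if "i \<le> n" for i by (rule exph[OF lineh[OF hf[OF that]]])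
    show "?G i holomorphic_on UNIV" if "i \<le> n" for i by (rule exph[OF lineh[OF hg[OF that]]])
    show "\<exists>i\<le>n. ?F i z \<noteq> 0" "\<exists>i\<le>n. ?G i z \<noteq> 0" for z using cf0[of "exp z"] cg0[of "exp z"] by auto
    show "real q + 2 * real n * real q * (2 + (real q - 2 - 2 * real n) / (2 * real n)) * (case k of enat k' \<Rightarrow> 1 / (real k' + 1) | \<infinity> \<Rightarrow> 0)
       < (2 + (real q - 2 - 2 * real n) / (2 * real n)) * (real q - real n - 1)"
      using num(2) by (simp only: \<kappa>_def)
    show "?F i (z + 2 * of_real pi * \<i>) = ?F i z" if "i \<le> n" for i z
      by (simp add: exp_add exp_two_pi_i)
    show "?F i1 t1 * ?G l1 t1 \<noteq> ?F l1 t1 * ?G i1 t1" using t1 by (simp add: wd_def)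
  next
    fix j t
    assume j: "j \<in> {1..q}" and o: "enat (ord (lf n ?F (a j)) t) \<le> k" "enat (ord (lf n ?G (a j)) t) \<le> k"
      and z: "lf n ?F (a j) t = 0 \<or> lf n ?G (a j) t = 0"
    obtain s1 s2 where s: "fH n f (a j) (?\<gamma> s1) \<noteq> 0" "fH n g (a j) (?\<gamma> s2) \<noteq> 0" using FGnz[OF j] by blast
    note vF = ordF[OF hF(1) s(1), of t] and vG = ordF[OF hF(2) s(2), of t]
    have lf': "lf n ?F (a j) = (\<lambda>t. fH n f (a j) (?\<gamma> t))" "lf n ?G (a j) = (\<lambda>t. fH n g (a j) (?\<gamma> t))"
      using lfF by auto
    have k1: "enat (vorder (fH n f (a j)) (?\<gamma> t)) \<le> k" "enat (vorder (fH n g (a j)) (?\<gamma> t)) \<le> k"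
      using o vF(1) vG(1) unfolding lf' by (meson enat_ord_simps(1) order_trans)+
    have "vorder (fH n f (a j)) (?\<gamma> t) = 0" if "fH n f (a j) (?\<gamma> t) \<noteq> 0"
      using vF(1) ord_eq_0[of "\<lambda>t. fH n f (a j) (?\<gamma> t)" t] that by simp
    moreover have "vorder (fH n g (a j)) (?\<gamma> t) = 0" if "fH n g (a j) (?\<gamma> t) \<noteq> 0"
      using vG(1) ord_eq_0[of "\<lambda>t. fH n g (a j) (?\<gamma> t)" t] that by simp
    \<comment> \<open>If one form vanishes, its \<open>vorder\<close> is positive, by
      \<open>share\<close> so is that of the other, and a form that does not vanish has
      \<open>vorder\<close> 0.\<close>
    ultimately have both: "fH n f (a j) (?\<gamma> t) = 0" "fH n g (a j) (?\<gamma> t) = 0"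
      using z vF(2) vG(2) share[OF j k1] unfolding lf' by fastforce+
    then have "?\<gamma> t \<in> Estar n k f (a j) \<inter> Estar n k g (a j)"
      using vF(2) vG(2) k1 by (simp add: Estar_def)
    then have "\<forall>i\<le>n. \<forall>l\<le>n. f i (?\<gamma> t) * g l (?\<gamma> t) = f l (?\<gamma> t) * g i (?\<gamma> t)"
      using assms(17) j unfolding eq_on_def by blast
    then show "lf n ?F (a j) t = 0 \<and> lf n ?G (a j) t = 0 \<and> (\<forall>i\<le>n. \<forall>l\<le>n. ?F i t * ?G l t = ?F l t * ?G i t)"
      using both unfolding lf' by blast
  next
    fix i j t
    assume ij: "i \<in> {1..q}" "j \<in> {1..q}" "i < j" and z: "lf n ?F (a i) t = 0" "lf n ?F (a j) t = 0"
      and o: "enat (ord (lf n ?F (a i)) t) \<le> k" "enat (ord (lf n ?F (a j)) t) \<le> k"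
    \<comment> \<open>Composition with \<open>exp\<close> does not lower orders, so the order along
      the line is at most \<open>k\<close> as well, and the derivative of exactly that order is
      nonzero.\<close>
    have pdnz: "\<exists>l. enat l \<le> k \<and> (pd e ^^ l) (\<lambda>z. fH n f (a j) (?\<Psi> z)) (c + exp t *s e) \<noteq> 0"
      if j: "j \<in> {1..q}" and o: "enat (ord (lf n ?F (a j)) t) \<le> k" for j
    proof -
      let ?\<phi> = "\<lambda>s. fH n f (a j) (?\<Psi> (c + s *s e))"
      obtain s1 where s1: "?\<phi> (exp s1) \<noteq> 0" using FGnz[OF j] by blast
      have "lf n ?F (a j) = (\<lambda>t. ?\<phi> (exp t))" using lfF by auto
      then have "ord ?\<phi> (exp t) \<le> ord (lf n ?F (a j)) t"
        using ord_le_ord_exp[OF lineh[OF hF(1)] s1] by simp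
      then have "enat (ord ?\<phi> (exp t)) \<le> k" using o by (meson enat_ord_simps(1) order_trans)
      moreover have "(deriv ^^ ord ?\<phi> (exp t)) ?\<phi> (exp t) \<noteq> 0"
        by (rule deriv_ord_nonzero[OF lineh[OF hF(1)] s1])
      ultimately show ?thesis by (auto simp: higher_deriv_line[OF hcomp[OF hF(1)]])
    qed
    have "c + exp t *s e \<in> A i j"
      using z pdnz[OF ij(1) o(1)] pdnz[OF ij(2) o(2)] unfolding A_def lfF by blast
    then show False using cA[of i j "exp t"] ij by auto
  qed (use n num(1) assms(13) ne(1,2) indF indG in auto)
qed

end
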